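(* Let $f\in\mathbb{F}_q[x]$ be a monic self-reciprocal polynomial of degree $2n$ with $x\nmid f$, and let $M$ be chosen uniformly at random from $Sp_{2n}(\mathbb{F}_q)$. Then for every integer $0\le\delta<n$, $$\Pr\big[\deg\min(M)=n-\delta\ \text{and}\ \mathrm{char}(M)=f\big]\ll q^{-\frac{n^2}{2(n-\delta)}+o(n)}.$$
   Context: $q$ is a power of an odd prime. With $\Omega_n=\begin{pmatrix}0&I_n\\-I_n&0\end{pmatrix}$, $Sp_{2n}(\mathbb{F}_q)=\{M\in GL_{2n}(\mathbb{F}_q): M^t\Omega_nM=\Omega_n\}$. A monic $f\in\mathbb{F}_q[x]$ with $f(0)\ne0$ is self-reciprocal if $x^{\deg f}f(1/x)/f(0)=f(x)$. $\mathrm{char}(M)=\det(xI-M)$, $\min(M)$ is the minimal polynomial. *)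

theory Defs
  imports
    "HOL-Algebra.UnivPoly"
    "HOL-Algebra.Divisibility"
    "HOL-Combinatorics.Permutations"
    "HOL-Library.Landau_Symbols"
    "HOL-Probability.Probability_Mass_Function"
    "Jordan_Normal_Form.Matrix"
begin

text \<open>
  The constants implied by the asymptotic bound do not depend on \<open>q\<close>, so the finite field has to be
  quantified inside the statement. It is therefore a ring record in the sense of HOL-Algebra, not a
  type. The type \<open>'a mat\<close> serves only as a container for entries: its type-class arithmetic
  is not used, and all arithmetic on entries is that of the record.
\<close>

definition matrix_ring :: "('a, 'm) ring_scheme \<Rightarrow> nat \<Rightarrow> 'a mat ring" where
  "matrix_ring R N = \<lparr>
     carrier = {A \<in> carrier_mat N N. elements_mat A \<subseteq> carrier R},
     monoid.mult = (\<lambda>A B. mat N N (\<lambda>(i, j). \<Oplus>\<^bsub>R\<^esub>k\<in>{..<N}. A $$ (i, k) \<otimes>\<^bsub>R\<^esub> B $$ (k, j))),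
     one = mat N N (\<lambda>(i, j). if i = j then \<one>\<^bsub>R\<^esub> else \<zero>\<^bsub>R\<^esub>),
     zero = mat N N (\<lambda>(i, j). \<zero>\<^bsub>R\<^esub>),
     add = (\<lambda>A B. mat N N (\<lambda>(i, j). A $$ (i, j) \<oplus>\<^bsub>R\<^esub> B $$ (i, j)))\<rparr>"

definition ring_det :: "('a, 'm) ring_scheme \<Rightarrow> nat \<Rightarrow> 'a mat \<Rightarrow> 'a" where
  "ring_det R N A =
     (\<Oplus>\<^bsub>R\<^esub>p\<in>{p. p permutes {..<N}}.
        (if evenperm p then \<one>\<^bsub>R\<^esub> else \<ominus>\<^bsub>R\<^esub> \<one>\<^bsub>R\<^esub>) \<otimes>\<^bsub>R\<^esub>
        (\<Otimes>\<^bsub>R\<^esub>i\<in>{..<N}. A $$ (i, p i)))"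

definition Omega_mat :: "('a, 'm) ring_scheme \<Rightarrow> nat \<Rightarrow> 'a mat" where
  "Omega_mat R n =
     four_block_mat \<zero>\<^bsub>matrix_ring R n\<^esub> \<one>\<^bsub>matrix_ring R n\<^esub>
       (\<ominus>\<^bsub>matrix_ring R n\<^esub> \<one>\<^bsub>matrix_ring R n\<^esub>) \<zero>\<^bsub>matrix_ring R n\<^esub>"

definition GL_mat :: "('a, 'm) ring_scheme \<Rightarrow> nat \<Rightarrow> 'a mat set" where
  "GL_mat R N = Units (matrix_ring R N)"

definition Sp_mat :: "('a, 'm) ring_scheme \<Rightarrow> nat \<Rightarrow> 'a mat set" where
  "Sp_mat R n =
     {M \<in> GL_mat R (2 * n).
        transpose_mat M \<otimes>\<^bsub>matrix_ring R (2 * n)\<^esub> Omega_mat R n \<otimes>\<^bsub>matrix_ring R (2 * n)\<^esub> M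
          = Omega_mat R n}"

definition poly_X :: "('a, 'm) ring_scheme \<Rightarrow> nat \<Rightarrow> 'a" where
  "poly_X R = up_ring.monom (UP R) \<one>\<^bsub>R\<^esub> 1"

definition poly_monic :: "('a, 'm) ring_scheme \<Rightarrow> (nat \<Rightarrow> 'a) \<Rightarrow> bool" where
  "poly_monic R p \<longleftrightarrow> p \<in> carrier (UP R) \<and> up_ring.coeff (UP R) p (deg R p) = \<one>\<^bsub>R\<^esub>"

definition poly_reverse :: "('a, 'm) ring_scheme \<Rightarrow> (nat \<Rightarrow> 'a) \<Rightarrow> nat \<Rightarrow> 'a" where
  \<comment> \<open>\<open>x ^ deg p * p (1 / x)\<close>\<close>
  "poly_reverse R p =
     (\<Oplus>\<^bsub>UP R\<^esub>i\<in>{..deg R p}. up_ring.monom (UP R) (up_ring.coeff (UP R) p i) (deg R p - i))"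

definition self_reciprocal :: "('a, 'm) ring_scheme \<Rightarrow> (nat \<Rightarrow> 'a) \<Rightarrow> bool" where
  "self_reciprocal R f \<longleftrightarrow>
     poly_monic R f \<and> up_ring.coeff (UP R) f 0 \<noteq> \<zero>\<^bsub>R\<^esub> \<and>
     inv\<^bsub>R\<^esub> (up_ring.coeff (UP R) f 0) \<odot>\<^bsub>UP R\<^esub> poly_reverse R f = f"

definition charpoly :: "('a, 'm) ring_scheme \<Rightarrow> nat \<Rightarrow> 'a mat \<Rightarrow> nat \<Rightarrow> 'a" where
  "charpoly R N M =
     ring_det (UP R) N
       (mat N N (\<lambda>(i, j). (if i = j then poly_X R else \<zero>\<^bsub>UP R\<^esub>)
          \<ominus>\<^bsub>UP R\<^esub> up_ring.monom (UP R) (M $$ (i, j)) 0))"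

definition poly_at_mat :: "('a, 'm) ring_scheme \<Rightarrow> nat \<Rightarrow> (nat \<Rightarrow> 'a) \<Rightarrow> 'a mat \<Rightarrow> 'a mat" where
  "poly_at_mat R N p M =
     (\<Oplus>\<^bsub>matrix_ring R N\<^esub>i\<in>{..deg R p}.
        map_mat (\<lambda>x. up_ring.coeff (UP R) p i \<otimes>\<^bsub>R\<^esub> x) (M [^]\<^bsub>matrix_ring R N\<^esub> i))"

definition minpoly :: "('a, 'm) ring_scheme \<Rightarrow> nat \<Rightarrow> 'a mat \<Rightarrow> nat \<Rightarrow> 'a" where
  "minpoly R N M =
     (THE p. poly_monic R p \<and> poly_at_mat R N p M = \<zero>\<^bsub>matrix_ring R N\<^esub> \<and>
        (\<forall>g. poly_monic R g \<and> poly_at_mat R N g M = \<zero>\<^bsub>matrix_ring R N\<^esub> \<longrightarrow> deg R p \<le> deg R g))"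

end

theory Submission
  imports Defs
begin

text \<open>
  The bound comes from the minimal polynomial alone.  If it has degree \<open>d\<close>, then every cyclic subspace
  of \<open>M\<close> has dimension at most \<open>d\<close>.  Count pairs of such an \<open>M\<close> and \<open>k\<close> arbitrary vectors
  \<open>v\<^sub>1, \<dots>, v\<^sub>k\<close> up to simultaneous conjugation.  Each class has at most \<open>|Sp|\<close> members.  By Witt's theorem
  the class is determined by the linear relations among the \<open>M\<^sup>t v\<^sub>i\<close> and by their Gram matrix.
  When \<open>v\<^sub>i\<close> is added to the invariant subspace \<open>W\<close> generated by its predecessors, the first relation
  \<open>M\<^sup>e v\<^sub>i \<in> W + \<langle>M\<^sup>t v\<^sub>i | t < e\<rangle>\<close> is one of \<open>|W| q\<^sup>e\<close> choices, the functional \<open>\<langle>v\<^sub>i, -\<rangle>\<close> on \<open>W\<close> one of \<open>|W|\<close>,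
  and of the numbers \<open>\<langle>v\<^sub>i, M\<^sup>t v\<^sub>i\<rangle>\<close> only those with \<open>1 \<le> t \<le> e/2\<close> are free.  As \<open>|W| \<le> q\<close> to the power \<open>(i - 1) d\<close>
  and \<open>e \<le> d\<close>, there are at most \<open>2\<^sup>k q\<close> to the power \<open>d k\<^sup>2 + d k / 2\<close> classes.  Dividing by the number of
  choices of the vectors, \<open>q\<close> to the power \<open>2 n k\<close>, and taking \<open>k = n div d\<close> gives the bound
  with \<open>C = 2\<close> and no error term in the exponent.
\<close>

subsection \<open>Finite symplectic spaces\<close>

text \<open>The i-th vector multiplies the number of pairs by \<open>q\<close> to the power
  \<open>2 n\<close> and the number of classes by about \<open>q\<close> to the power
  \<open>2 (i - 1) d + 3 d / 2\<close>. So vectors pay off until \<open>i\<close> is about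
  \<open>n / d\<close>, whence the choice of \<open>k\<close>. For \<open>k = n / d\<close> exactly
  the exponent would be \<open>n / 2 - n^2 / d\<close>, which is at most
  \<open>- n^2 / (2 d)\<close> because \<open>d \<le> n\<close>; the slack pays for the rounding of
  \<open>k\<close> and for all but one of the factors 2. The obstacle is that the relations and the
  Gram matrix describe only the generated subspace, whereas conjugation needs an isometry of the
  whole space. Witt's theorem therefore enters as transitivity of pointwise stabilizers, applied
  once for each new vector \<open>T^t u\<close>. Cardinalities stand in for dimensions, and counting
  fibres, as in the next lemma, replaces rank-nullity.\<close>

lemma card_eq_card_image_mult:
  assumes "finite A" and "\<And>x. x \<in> A \<Longrightarrow> card {y \<in> A. f y = f x} = m"
  shows "card A = card (f ` A) * m"
proof -
  have "card A = (\<Sum>z\<in>f ` A. card {y \<in> A. f y = z})"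
    using assms(1) by (subst sum.image_gen[where g = f and h = "\<lambda>_. 1::nat", simplified]) auto
  also have "\<dots> = (\<Sum>z\<in>f ` A. m)"
    using assms(2) by (intro sum.cong) auto
  finally show ?thesis by simp
qed

text \<open>Turns a bound on the number of possible invariants into a bound on a set of
  representatives: one preimage is kept for each value of \<open>f\<close> that occurs. It is
  applied with \<open>f = krylov_data W\<close>.\<close>

lemma finite_representatives:
  assumes "f ` A \<subseteq> D" and "finite D"
  obtains B where "B \<subseteq> A" and "finite B" and "card B \<le> card D" and "\<And>x. x \<in> A \<Longrightarrow> \<exists>y\<in>B. f y = f x"
proof
  let ?B = "inv_into A f ` f ` A"
  have fin: "finite (f ` A)" using assms finite_subset by blast
  show "?B \<subseteq> A" by (auto intro: inv_into_into)
  show "finite ?B" using fin by simp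
  show "card ?B \<le> card D"
    using card_image_le[OF fin] card_mono[OF assms(2,1)] le_trans by blast
  show "\<exists>y\<in>?B. f y = f x" if "x \<in> A" for x
    using that by (auto simp: f_inv_into_f)
qed

text \<open>The exponents \<open>e + e div 2\<close> grow by at least 1 at each step, so twice the
  last term bounds the sum, as for a geometric series of ratio 2. Summing over all stopping lengths
  thus costs only a factor 2 per vector.\<close>

lemma sum_power_half_le:
  fixes q :: nat
  assumes "2 \<le> q"
  shows "(\<Sum>e\<le>d. q ^ (e + e div 2)) \<le> 2 * q ^ (d + d div 2)"
proof (induction d)
  case 0
  then show ?case by simp
next
  case (Suc d)
  have "2 * q ^ (d + d div 2) \<le> q * q ^ (d + d div 2)" using assms by simp
  also have "\<dots> = q ^ (Suc d + d div 2)" by simp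
  also have "\<dots> \<le> q ^ (Suc d + Suc d div 2)" using assms by (intro power_increasing) auto
  finally show ?case using Suc by simp
qed

text \<open>The space stays abstract so that Witt's theorem and the counting are free of
  coordinates; \<open>std_symplectic\<close> supplies the concrete instance. Antisymmetry would give
  \<open>form_alternating\<close> only away from characteristic 2, and the locale does not fix the
  characteristic.\<close>

locale finite_symplectic_space = Module.module R M + field R
  for R :: "('a, 'r) ring_scheme" (structure) and M :: "('a, 'b, 'm) module_scheme" (structure) +
  fixes B :: "'b \<Rightarrow> 'b \<Rightarrow> 'a"
  assumes finite_scalars: "finite (carrier R)"
    and finite_vectors: "finite (carrier M)"
    and form_closed [simp, intro]: "\<lbrakk>x \<in> carrier M; y \<in> carrier M\<rbrakk> \<Longrightarrow> B x y \<in> carrier R"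
    and form_add_left: "\<lbrakk>x \<in> carrier M; y \<in> carrier M; z \<in> carrier M\<rbrakk> \<Longrightarrow>
          B (x \<oplus>\<^bsub>M\<^esub> y) z = B x z \<oplus> B y z"
    and form_smult_left: "\<lbrakk>a \<in> carrier R; x \<in> carrier M; y \<in> carrier M\<rbrakk> \<Longrightarrow>
          B (a \<odot>\<^bsub>M\<^esub> x) y = a \<otimes> B x y"
    and form_antisym: "\<lbrakk>x \<in> carrier M; y \<in> carrier M\<rbrakk> \<Longrightarrow> B x y = \<ominus> B y x"
    and form_alternating: "x \<in> carrier M \<Longrightarrow> B x x = \<zero>"
    and form_nondegenerate: "\<lbrakk>x \<in> carrier M; x \<noteq> \<zero>\<^bsub>M\<^esub>\<rbrakk> \<Longrightarrow> \<exists>y\<in>carrier M. B x y \<noteq> \<zero>"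
begin

lemma form_add_right:
  "\<lbrakk>x \<in> carrier M; y \<in> carrier M; z \<in> carrier M\<rbrakk> \<Longrightarrow> B z (x \<oplus>\<^bsub>M\<^esub> y) = B z x \<oplus> B z y"
  by (metis form_add_left form_antisym form_closed M.a_closed R.minus_add)

lemma form_smult_right:
  "\<lbrakk>a \<in> carrier R; x \<in> carrier M; y \<in> carrier M\<rbrakk> \<Longrightarrow> B y (a \<odot>\<^bsub>M\<^esub> x) = a \<otimes> B y x"
  by (metis form_smult_left form_antisym form_closed smult_closed R.r_minus)

lemma form_zero_left [simp]: "x \<in> carrier M \<Longrightarrow> B \<zero>\<^bsub>M\<^esub> x = \<zero>"
  by (metis form_smult_left form_closed R.l_null R.zero_closed M.zero_closed smult_l_null)

lemma form_zero_right [simp]: "x \<in> carrier M \<Longrightarrow> B x \<zero>\<^bsub>M\<^esub> = \<zero>"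
  by (metis form_antisym form_zero_left R.minus_zero M.zero_closed)

lemma form_minus_left: "\<lbrakk>x \<in> carrier M; y \<in> carrier M\<rbrakk> \<Longrightarrow> B (\<ominus>\<^bsub>M\<^esub> x) y = \<ominus> B x y"
  by (metis form_add_left form_closed form_zero_left M.a_inv_closed M.l_neg R.minus_equality)

lemma form_diff_left:
  "\<lbrakk>x \<in> carrier M; y \<in> carrier M; z \<in> carrier M\<rbrakk> \<Longrightarrow> B (x \<ominus>\<^bsub>M\<^esub> y) z = B x z \<ominus> B y z"
  by (simp add: M.minus_eq R.minus_eq form_add_left form_minus_left)

lemma form_diff_right:
  "\<lbrakk>x \<in> carrier M; y \<in> carrier M; z \<in> carrier M\<rbrakk> \<Longrightarrow> B z (x \<ominus>\<^bsub>M\<^esub> y) = B z x \<ominus> B z y"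
  by (metis (no_types, lifting) form_antisym form_closed form_diff_left M.minus_closed R.minus_eq
      R.minus_add R.minus_minus R.a_inv_closed)

abbreviation subspace :: "'b set \<Rightarrow> bool" where
  "subspace U \<equiv> submodule U R M"

lemma subspace_subset: "subspace U \<Longrightarrow> U \<subseteq> carrier M"
  by (rule submoduleE(1))

lemma subspace_zero: "subspace U \<Longrightarrow> \<zero>\<^bsub>M\<^esub> \<in> U"
  using submodule.axioms(1) subgroup.one_closed by fastforce

lemma subspace_diff: "\<lbrakk>subspace U; x \<in> U; y \<in> U\<rbrakk> \<Longrightarrow> x \<ominus>\<^bsub>M\<^esub> y \<in> U"
  by (simp add: M.minus_eq submoduleE(3,5))

lemma subspaceI:
  assumes "U \<subseteq> carrier M" and "\<zero>\<^bsub>M\<^esub> \<in> U"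
    and "\<And>x y. \<lbrakk>x \<in> U; y \<in> U\<rbrakk> \<Longrightarrow> x \<oplus>\<^bsub>M\<^esub> y \<in> U"
    and "\<And>a x. \<lbrakk>a \<in> carrier R; x \<in> U\<rbrakk> \<Longrightarrow> a \<odot>\<^bsub>M\<^esub> x \<in> U"
  shows "subspace U"
proof (rule submoduleI)
  show "\<ominus>\<^bsub>M\<^esub> x \<in> U" if "x \<in> U" for x
    using assms(4)[of "\<ominus> \<one>" x] that assms(1) smult_l_minus[of \<one> x] by auto
qed (use assms in auto)

section \<open>Orthogonal complements, measured by cardinality\<close>

definition perp :: "'b set \<Rightarrow> 'b set" where
  "perp U = {x \<in> carrier M. \<forall>u\<in>U. B x u = \<zero>}"

lemma subspace_perp: "U \<subseteq> carrier M \<Longrightarrow> subspace (perp U)"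
  by (rule subspaceI) (auto simp: perp_def form_add_left form_smult_left subset_iff)

lemma diff_eq_zero_iff: "\<lbrakk>x \<in> carrier M; y \<in> carrier M\<rbrakk> \<Longrightarrow> x \<ominus>\<^bsub>M\<^esub> y = \<zero>\<^bsub>M\<^esub> \<longleftrightarrow> x = y"
  by (metis M.minus_eq M.r_neg M.minus_equality M.minus_minus M.a_inv_closed)

lemma add_diff_cancel: "\<lbrakk>x \<in> carrier M; y \<in> carrier M\<rbrakk> \<Longrightarrow> x \<oplus>\<^bsub>M\<^esub> (y \<ominus>\<^bsub>M\<^esub> x) = y"
  by (metis M.minus_eq M.a_comm M.a_assoc M.l_neg M.r_zero M.a_inv_closed M.a_closed)

text \<open>Rescaling \<open>u\<close> shows that the functional \<open>B x\<close> maps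
  \<open>U\<close> onto the field, and its fibres are translates of its kernel.\<close>

lemma card_subspace_functional:
  assumes U: "subspace U" and x: "x \<in> carrier M" and u: "u \<in> U" "B x u \<noteq> \<zero>"
  shows "card U = card (carrier R) * card {y \<in> U. B x y = \<zero>}"
proof -
  have sub: "U \<subseteq> carrier M" using U by (rule subspace_subset)
  have fin: "finite U" using sub finite_vectors finite_subset by blast
  have "card U = card (B x ` U) * card {y \<in> U. B x y = \<zero>}"
  proof (rule card_eq_card_image_mult[OF fin])
    fix v assume v: "v \<in> U"
    have "bij_betw (\<lambda>y. v \<oplus>\<^bsub>M\<^esub> y) {y \<in> U. B x y = \<zero>} {y \<in> U. B x y = B x v}"
    proof (rule bij_betw_byWitness[where f' = "\<lambda>y. y \<ominus>\<^bsub>M\<^esub> v"])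
      show "\<forall>a\<in>{y \<in> U. B x y = \<zero>}. v \<oplus>\<^bsub>M\<^esub> a \<ominus>\<^bsub>M\<^esub> v = a"
        using sub v
          by (metis (no_types, lifting) M.a_closed M.add.m_comm M.add.inv_closed M.a_assoc M.minus_eq M.r_neg M.r_zero mem_Collect_eq subsetD)
      show "\<forall>a\<in>{y \<in> U. B x y = B x v}. v \<oplus>\<^bsub>M\<^esub> (a \<ominus>\<^bsub>M\<^esub> v) = a"
        using sub v by (auto simp: add_diff_cancel subset_iff)
      show "(\<oplus>\<^bsub>M\<^esub>) v ` {y \<in> U. B x y = \<zero>} \<subseteq> {y \<in> U. B x y = B x v}"
        using sub v x U by (auto simp: form_add_right subset_iff submoduleE(5))
      show "(\<lambda>y. y \<ominus>\<^bsub>M\<^esub> v) ` {y \<in> U. B x y = B x v} \<subseteq> {y \<in> U. B x y = \<zero>}"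
        using sub v x U by (auto simp: form_diff_right subspace_diff subset_iff R.r_neg R.minus_eq)
    qed
    then show "card {y \<in> U. B x y = B x v} = card {y \<in> U. B x y = \<zero>}"
      by (simp add: bij_betw_same_card)
  qed
  moreover have "B x ` U = carrier R"
  proof
    show "B x ` U \<subseteq> carrier R" using sub x by auto
    show "carrier R \<subseteq> B x ` U"
    proof
      fix a assume a: "a \<in> carrier R"
      have Bu: "B x u \<in> Units R" using field_Units u x sub by auto
      then have ib: "inv (B x u) \<in> carrier R" by simp
      have "B x ((a \<otimes> inv (B x u)) \<odot>\<^bsub>M\<^esub> u) = a \<otimes> inv (B x u) \<otimes> B x u"
        using a ib u x sub by (auto simp: form_smult_right subset_iff)
      also have "\<dots> = a" using a ib Bu by (simp add: R.m_assoc R.Units_closed R.Units_l_inv)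
      finally show "a \<in> B x ` U"
        using a ib u U by (metis image_eqI submoduleE(4) R.m_closed)
    qed
  qed
  ultimately show ?thesis by simp
qed

lemma card_scalars_ge_2: "2 \<le> card (carrier R)"
proof -
  have "{\<zero>, \<one>} \<subseteq> carrier R" by simp
  then have "card {\<zero>, \<one>} \<le> card (carrier R)" using finite_scalars card_mono by blast
  then show ?thesis by simp
qed

text \<open>Double counting of the pairs \<open>(x, u)\<close> with \<open>u \<in> U\<close> and \<open>B x u = 0\<close>.\<close>

lemma card_perp:
  assumes U: "subspace U"
  shows "card U * card (perp U) = card (carrier M)"
proof -
  have sub: "U \<subseteq> carrier M" using U by (rule subspace_subset)
  have fin: "finite U" using sub finite_vectors finite_subset by blast
  let ?q = "card (carrier R)" and ?Z = "SIGMA x:carrier M. {u \<in> U. B x u = \<zero>}"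
  have P: "perp U \<subseteq> carrier M" by (auto simp: perp_def)
  have "card ?Z = (\<Sum>x\<in>carrier M. card {u \<in> U. B x u = \<zero>})"
    using finite_vectors fin by (intro card_SigmaI) auto
  also have "\<dots> = (\<Sum>x\<in>perp U. card {u \<in> U. B x u = \<zero>})
      + (\<Sum>x\<in>carrier M - perp U. card {u \<in> U. B x u = \<zero>})"
    by (subst sum.subset_diff[OF P finite_vectors]) (rule add.commute)
  also have "(\<Sum>x\<in>perp U. card {u \<in> U. B x u = \<zero>}) = (\<Sum>x\<in>perp U. card U)"
    by (intro sum.cong refl arg_cong[where f = card]) (auto simp: perp_def)
  finally have "?q * card ?Z = ?q * (card (perp U) * card U)
      + (\<Sum>x\<in>carrier M - perp U. ?q * card {u \<in> U. B x u = \<zero>})"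
    by (simp add: distrib_left sum_distrib_left)
  also have "(\<Sum>x\<in>carrier M - perp U. ?q * card {u \<in> U. B x u = \<zero>}) = (\<Sum>x\<in>carrier M - perp U. card U)"
    by (intro sum.cong refl) (auto simp: perp_def card_subspace_functional[OF U, symmetric])
  finally have 1: "?q * card ?Z = ?q * (card (perp U) * card U)
      + (card (carrier M) - card (perp U)) * card U"
    using P finite_vectors by (simp add: card_Diff_subset finite_subset)
  have "bij_betw prod.swap ?Z (SIGMA u:U. {x \<in> carrier M. B u x = \<zero>})"
  proof -
    have "B u x = \<zero> \<longleftrightarrow> B x u = \<zero>" if "x \<in> carrier M" "u \<in> U" for x u
      using that sub by (metis form_antisym R.minus_zero subsetD)
    then show ?thesis by (intro bij_betw_byWitness[where f' = prod.swap]) auto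
  qed
  from bij_betw_same_card[OF this] have "card ?Z = card (SIGMA u:U. {x \<in> carrier M. B u x = \<zero>})" .
  also have "\<dots> = (\<Sum>u\<in>U. card {x \<in> carrier M. B u x = \<zero>})"
    using finite_vectors fin by (intro card_SigmaI) auto
  also have "\<dots> = card (carrier M) + (\<Sum>u\<in>U - {\<zero>\<^bsub>M\<^esub>}. card {x \<in> carrier M. B u x = \<zero>})"
    using fin subspace_zero[OF U]
      by (simp add: sum.remove Collect_conj_eq[symmetric] cong: conj_cong)
  finally have "?q * card ?Z = ?q * card (carrier M)
      + (\<Sum>u\<in>U - {\<zero>\<^bsub>M\<^esub>}. ?q * card {x \<in> carrier M. B u x = \<zero>})"
    by (simp add: distrib_left sum_distrib_left)
  also have "(\<Sum>u\<in>U - {\<zero>\<^bsub>M\<^esub>}. ?q * card {x \<in> carrier M. B u x = \<zero>}) = (\<Sum>u\<in>U - {\<zero>\<^bsub>M\<^esub>}. card (carrier M))"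
  proof (intro sum.cong refl)
    fix u assume "u \<in> U - {\<zero>\<^bsub>M\<^esub>}"
    then have "u \<in> carrier M" "u \<noteq> \<zero>\<^bsub>M\<^esub>" using sub by auto
    moreover from this obtain y where "y \<in> carrier M" "B u y \<noteq> \<zero>"
      using form_nondegenerate by blast
    ultimately show "?q * card {x \<in> carrier M. B u x = \<zero>} = card (carrier M)"
      using card_subspace_functional[OF carrier_is_submodule] by simp
  qed
  finally have 2: "?q * card ?Z = ?q * card (carrier M) + (card U - 1) * card (carrier M)"
    using fin subspace_zero[OF U] by simp
  have cU: "card U \<ge> 1" using fin subspace_zero[OF U]
    by (metis One_nat_def Suc_leI card_gt_0_iff empty_iff)
  have cP: "card (perp U) \<le> card (carrier M)" using P finite_vectors card_mono by blast
  \<comment> \<open>Equating the two counts, the product \<open>?v * ?u\<close> cancels and a common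
    factor \<open>?r - 1\<close>, which is not zero, remains. Integers make the subtractions
    exact.\<close>
  let ?v = "int (card (carrier M))" and ?u = "int (card U)" and ?p = "int (card (perp U))" and ?r = "int ?q"
  have "?r * ?v + (?u - 1) * ?v = ?r * (?p * ?u) + (?v - ?p) * ?u"
    using 1 2 cU cP by (metis (no_types, lifting) of_nat_add of_nat_mult of_nat_diff of_nat_1)
  then have "(?r - 1) * (?u * ?p) = (?r - 1) * ?v"
    by (simp add: algebra_simps)
  then have "?u * ?p = ?v" using card_scalars_ge_2 by simp
  then show ?thesis by (metis of_nat_eq_iff of_nat_mult)
qed

subsection \<open>Isometries\<close>

text \<open>The condition \<open>permutes\<close> fixes the values outside the carrier. The
  isometries are then a finite set of total functions, closed under composition, \<open>^^\<close>
  and \<open>inv_into UNIV\<close>, and equality of isometries is equality of functions.\<close>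

definition isometries :: "('b \<Rightarrow> 'b) set" where
  "isometries = {g. g permutes carrier M \<and>
     (\<forall>x\<in>carrier M. \<forall>y\<in>carrier M. g (x \<oplus>\<^bsub>M\<^esub> y) = g x \<oplus>\<^bsub>M\<^esub> g y) \<and>
     (\<forall>a\<in>carrier R. \<forall>x\<in>carrier M. g (a \<odot>\<^bsub>M\<^esub> x) = a \<odot>\<^bsub>M\<^esub> g x) \<and>
     (\<forall>x\<in>carrier M. \<forall>y\<in>carrier M. B (g x) (g y) = B x y)}"

lemma finite_isometries: "finite isometries"
  using finite_permutations[OF finite_vectors]
    by (rule rev_finite_subset) (auto simp: isometries_def)

lemma isometries_permutes: "g \<in> isometries \<Longrightarrow> g permutes carrier M"
  by (simp add: isometries_def)

lemma isometries_closed [simp]: "g \<in> isometries \<Longrightarrow> g x \<in> carrier M \<longleftrightarrow> x \<in> carrier M"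
  by (simp add: isometries_def permutes_in_image)

lemma isometries_add: "\<lbrakk>g \<in> isometries; x \<in> carrier M; y \<in> carrier M\<rbrakk> \<Longrightarrow> g (x \<oplus>\<^bsub>M\<^esub> y) = g x \<oplus>\<^bsub>M\<^esub> g y"
  by (simp add: isometries_def)

lemma isometries_smult: "\<lbrakk>g \<in> isometries; a \<in> carrier R; x \<in> carrier M\<rbrakk> \<Longrightarrow> g (a \<odot>\<^bsub>M\<^esub> x) = a \<odot>\<^bsub>M\<^esub> g x"
  by (simp add: isometries_def)

lemma isometries_form: "\<lbrakk>g \<in> isometries; x \<in> carrier M; y \<in> carrier M\<rbrakk> \<Longrightarrow> B (g x) (g y) = B x y"
  by (simp add: isometries_def)

lemma isometries_zero: "g \<in> isometries \<Longrightarrow> g \<zero>\<^bsub>M\<^esub> = \<zero>\<^bsub>M\<^esub>"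
  by (metis isometries_closed isometries_smult M.zero_closed R.zero_closed smult_l_null)

lemma isometries_inv_apply [simp]:
  assumes "g \<in> isometries" shows "inv_into UNIV g (g x) = x" "g (inv_into UNIV g x) = x"
  using permutes_inverses[OF isometries_permutes[OF assms]] by auto

lemma isometries_comp: "\<lbrakk>g \<in> isometries; h \<in> isometries\<rbrakk> \<Longrightarrow> g \<circ> h \<in> isometries"
  unfolding isometries_def by (auto simp: permutes_compose permutes_in_image)

lemma isometries_inv:
  assumes "g \<in> isometries" shows "inv_into UNIV g \<in> isometries"
proof -
  let ?h = "inv_into UNIV g"
  have p: "?h permutes carrier M" by (simp add: permutes_inv isometries_permutes[OF assms])
  have c: "?h x \<in> carrier M" if "x \<in> carrier M" for x using p that by (simp add: permutes_in_image)
  have "?h (x \<oplus>\<^bsub>M\<^esub> y) = ?h x \<oplus>\<^bsub>M\<^esub> ?h y" if "x \<in> carrier M" "y \<in> carrier M" for x y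
    using isometries_add[OF assms c c, of x y] that assms by (metis isometries_inv_apply)
  moreover have "?h (a \<odot>\<^bsub>M\<^esub> x) = a \<odot>\<^bsub>M\<^esub> ?h x" if "a \<in> carrier R" "x \<in> carrier M" for a x
    using isometries_smult[OF assms _ c, of a x] that assms by (metis isometries_inv_apply)
  moreover have "B (?h x) (?h y) = B x y" if "x \<in> carrier M" "y \<in> carrier M" for x y
    using isometries_form[OF assms c c, of x y] that assms by simp
  ultimately show ?thesis using p by (auto simp: isometries_def)
qed

text \<open>Preserving a nondegenerate form forces injectivity: if \<open>f x = f y\<close>, then
  \<open>x - y\<close> is orthogonal to everything. On a finite carrier this already gives a
  permutation.\<close>

lemma isometriesI:
  assumes "\<And>x. x \<in> carrier M \<Longrightarrow> f x \<in> carrier M"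
    and "\<And>x y. \<lbrakk>x \<in> carrier M; y \<in> carrier M\<rbrakk> \<Longrightarrow> f (x \<oplus>\<^bsub>M\<^esub> y) = f x \<oplus>\<^bsub>M\<^esub> f y"
    and "\<And>a x. \<lbrakk>a \<in> carrier R; x \<in> carrier M\<rbrakk> \<Longrightarrow> f (a \<odot>\<^bsub>M\<^esub> x) = a \<odot>\<^bsub>M\<^esub> f x"
    and "\<And>x y. \<lbrakk>x \<in> carrier M; y \<in> carrier M\<rbrakk> \<Longrightarrow> B (f x) (f y) = B x y"
  shows "(\<lambda>x. if x \<in> carrier M then f x else x) \<in> isometries"
proof -
  have "inj_on f (carrier M)"
  proof (rule inj_onI)
    fix x y assume xy: "x \<in> carrier M" "y \<in> carrier M" "f x = f y"
    have "B (x \<ominus>\<^bsub>M\<^esub> y) z = \<zero>" if z: "z \<in> carrier M" for z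
    proof -
      have "B x z = B y z" using assms(4)[OF xy(1) z] assms(4)[OF xy(2) z] xy(3) by metis
      then show ?thesis using xy z by (simp add: form_diff_left R.minus_eq R.r_neg)
    qed
    then have "x \<ominus>\<^bsub>M\<^esub> y = \<zero>\<^bsub>M\<^esub>" using form_nondegenerate xy by (metis M.minus_closed)
    then show "x = y" using diff_eq_zero_iff xy by simp
  qed
  then have "inj_on (\<lambda>x. if x \<in> carrier M then f x else x) (carrier M)"
    by (simp add: inj_on_def)
  then have "(\<lambda>x. if x \<in> carrier M then f x else x) permutes carrier M"
    by (rule inj_imp_permutes) (use assms(1) finite_vectors in auto)
  then show ?thesis using assms by (auto simp: isometries_def)
qed

lemma id_isometries: "id \<in> isometries"
  by (simp add: isometries_def)

section \<open>Transvections and Witt's extension step\<close>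

definition transvection :: "'b \<Rightarrow> 'a \<Rightarrow> 'b \<Rightarrow> 'b" where
  "transvection a c = (\<lambda>x. if x \<in> carrier M then x \<oplus>\<^bsub>M\<^esub> (c \<otimes> B x a) \<odot>\<^bsub>M\<^esub> a else x)"

text \<open>Expanding the form leaves two terms linear in \<open>c\<close>, which are opposite by
  antisymmetry, and a term in \<open>c^2\<close> that contains \<open>B a a = 0\<close>.\<close>

lemma transvection_isometries:
  assumes a: "a \<in> carrier M" and c: "c \<in> carrier R"
  shows "transvection a c \<in> isometries"
  unfolding transvection_def
proof (rule isometriesI)
  show "x \<oplus>\<^bsub>M\<^esub> y \<oplus>\<^bsub>M\<^esub> (c \<otimes> B (x \<oplus>\<^bsub>M\<^esub> y) a) \<odot>\<^bsub>M\<^esub> a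
      = x \<oplus>\<^bsub>M\<^esub> (c \<otimes> B x a) \<odot>\<^bsub>M\<^esub> a \<oplus>\<^bsub>M\<^esub> (y \<oplus>\<^bsub>M\<^esub> (c \<otimes> B y a) \<odot>\<^bsub>M\<^esub> a)"
    if "x \<in> carrier M" "y \<in> carrier M" for x y
    using that a c by (simp add: form_add_left R.r_distr smult_l_distr M.a_ac)
  show "k \<odot>\<^bsub>M\<^esub> x \<oplus>\<^bsub>M\<^esub> (c \<otimes> B (k \<odot>\<^bsub>M\<^esub> x) a) \<odot>\<^bsub>M\<^esub> a = k \<odot>\<^bsub>M\<^esub> (x \<oplus>\<^bsub>M\<^esub> (c \<otimes> B x a) \<odot>\<^bsub>M\<^esub> a)"
    if "k \<in> carrier R" "x \<in> carrier M" for k x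
    using that a c by (simp add: form_smult_left smult_r_distr smult_assoc1[symmetric] R.m_lcomm)
  show "B (x \<oplus>\<^bsub>M\<^esub> (c \<otimes> B x a) \<odot>\<^bsub>M\<^esub> a) (y \<oplus>\<^bsub>M\<^esub> (c \<otimes> B y a) \<odot>\<^bsub>M\<^esub> a) = B x y"
    if x: "x \<in> carrier M" and y: "y \<in> carrier M" for x y
  proof -
    have ay: "B a y = \<ominus> B y a" using a y by (rule form_antisym)
    have "B (x \<oplus>\<^bsub>M\<^esub> (c \<otimes> B x a) \<odot>\<^bsub>M\<^esub> a) (y \<oplus>\<^bsub>M\<^esub> (c \<otimes> B y a) \<odot>\<^bsub>M\<^esub> a)
        = B x y \<oplus> c \<otimes> B x a \<otimes> B a y \<oplus> c \<otimes> B y a \<otimes> (B x a \<oplus> c \<otimes> B x a \<otimes> B a a)"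
      using x y a c by (simp add: form_add_left form_add_right form_smult_left form_smult_right)
    also have "\<dots> = B x y \<oplus> (\<ominus> (c \<otimes> B x a \<otimes> B y a) \<oplus> c \<otimes> B x a \<otimes> B y a)"
      using x y a c by (simp add: ay form_alternating R.r_minus R.m_ac R.a_assoc)
    also have "\<dots> = B x y" using x y a c by (simp add: R.l_neg)
    finally show ?thesis .
  qed
qed (use a c in auto)

text \<open>This is the inclusion of \<open>perp (perp U)\<close> in \<open>U\<close>. If it failed,
  \<open>perp (perp U)\<close> would contain both \<open>U\<close> and \<open>z\<close>, although
  \<open>card_perp\<close>, applied to \<open>U\<close> and to \<open>perp U\<close>, makes it only
  as large as \<open>U\<close>.\<close>

lemma ex_perp_form_nonzero:
  assumes U: "subspace U" and z: "z \<in> carrier M" "z \<notin> U"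
  shows "\<exists>a\<in>perp U. B z a \<noteq> \<zero>"
proof (rule ccontr)
  assume "\<not> ?thesis"
  then have *: "B z a = \<zero>" if "a \<in> perp U" for a using that by blast
  let ?P = "perp (perp U)"
  have sub: "U \<subseteq> carrier M" using U by (rule subspace_subset)
  have P: "subspace (perp U)" using sub by (rule subspace_perp)
  have "z \<in> ?P" using z * by (simp add: perp_def[of "perp U"])
  moreover have "U \<subseteq> ?P"
  proof
    fix u assume u: "u \<in> U"
    have "B u a = \<zero>" if "a \<in> perp U" for a
      using that u sub form_antisym[of u a] by (auto simp: perp_def)
    then show "u \<in> ?P" using u sub by (auto simp: perp_def[of "perp U"])
  qed
  ultimately have "insert z U \<subseteq> ?P" by simp
  moreover have fin: "finite ?P"
    using finite_vectors by (rule rev_finite_subset) (auto simp: perp_def)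
  ultimately have "card (insert z U) \<le> card ?P" by (simp add: card_mono)
  moreover have "finite U" using sub finite_vectors finite_subset by blast
  ultimately have "card U < card ?P" using z by simp
  moreover have "card U * card (perp U) = card ?P * card (perp U)"
    using card_perp[OF U] card_perp[OF P] by (simp add: mult.commute)
  moreover have "card (perp U) > 0"
    using subspace_zero[OF P] finite_vectors
      by (metis card_gt_0_iff empty_iff finite_subset subspace_subset[OF P])
  ultimately show False by simp
qed

text \<open>The transvection along \<open>x - z\<close> works. It fixes \<open>U\<close> because
  \<open>z\<close> and \<open>x\<close> pair equally with \<open>U\<close>. The scalar
  \<open>1 / B z x\<close> is the one for which \<open>z\<close> moves by exactly
  \<open>x - z\<close>, since \<open>B z (x - z) = B z x\<close>.\<close>

lemma transvection_transitive:
  assumes U: "U \<subseteq> carrier M" and z: "z \<in> carrier M" and x: "x \<in> carrier M"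
    and eq: "\<And>y. y \<in> U \<Longrightarrow> B z y = B x y" and nz: "B z x \<noteq> \<zero>"
  shows "\<exists>h\<in>isometries. (\<forall>y\<in>U. h y = y) \<and> h z = x"
proof -
  let ?a = "x \<ominus>\<^bsub>M\<^esub> z" and ?c = "inv (B z x)"
  have unit: "B z x \<in> Units R" using nz x z field_Units by auto
  then have c: "?c \<in> carrier R" by (rule R.Units_inv_closed)
  have a: "?a \<in> carrier M" using x z by simp
  have "B z ?a = B z x" using x z by (simp add: form_diff_right form_alternating R.minus_eq)
  then have "?c \<otimes> B z ?a = \<one>" using unit by (simp add: R.Units_l_inv)
  then have "transvection ?a ?c z = x" using x z a by (simp add: transvection_def add_diff_cancel)
  moreover have "transvection ?a ?c y = y" if y: "y \<in> U" for y
  proof -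
    have yM: "y \<in> carrier M" using y U by auto
    have "B y x = B y z" using form_antisym[of y x] form_antisym[of y z] eq[OF y] x z yM by simp
    then have "B y ?a = \<zero>" using x z yM by (simp add: form_diff_right R.minus_eq R.r_neg)
    then show ?thesis using c a yM by (simp add: transvection_def)
  qed
  ultimately show ?thesis using transvection_isometries[OF a c] by blast
qed

text \<open>One step of Witt's extension theorem.  A vector \<open>a\<close> orthogonal to \<open>U\<close> but not to \<open>z\<close> or \<open>x\<close>
  exists because a group is not the union of two proper subgroups; when \<open>B z x = 0\<close>, the isometry is
  a product of two transvections through \<open>z + a\<close>.\<close>

lemma pointwise_stabilizer_transitive:
  assumes U: "subspace U" and z: "z \<in> carrier M" "z \<notin> U" and x: "x \<in> carrier M" "x \<notin> U"
    and eq: "\<And>y. y \<in> U \<Longrightarrow> B z y = B x y"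
  shows "\<exists>h\<in>isometries. (\<forall>y\<in>U. h y = y) \<and> h z = x"
proof (cases "B z x = \<zero>")
  case False
  then show ?thesis using transvection_transitive[OF subspace_subset[OF U] z(1) x(1)] eq by blast
next
  case True
  have sub: "U \<subseteq> carrier M" using U by (rule subspace_subset)
  have P: "subspace (perp U)" using sub by (rule subspace_perp)
  have PM: "perp U \<subseteq> carrier M" by (auto simp: perp_def)
  obtain b where b: "b \<in> perp U" "B z b \<noteq> \<zero>" using ex_perp_form_nonzero[OF U z] by blast
  obtain c where c: "c \<in> perp U" "B x c \<noteq> \<zero>" using ex_perp_form_nonzero[OF U x] by blast
  have bM: "b \<in> carrier M" and cM: "c \<in> carrier M" using b c PM by auto
  obtain a where a: "a \<in> perp U" "B z a \<noteq> \<zero>" "B x a \<noteq> \<zero>"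
  proof (cases "B x b = \<zero> \<and> B z c = \<zero>")
    case False
    then show ?thesis using that b c by blast
  next
    case True
    show ?thesis
    proof (rule that)
      show "b \<oplus>\<^bsub>M\<^esub> c \<in> perp U" using P b c by (simp add: submoduleE(5))
    qed (use True b c z x bM cM in \<open>simp_all add: form_add_right\<close>)
  qed
  have aM: "a \<in> carrier M" using a PM by auto
  let ?y = "z \<oplus>\<^bsub>M\<^esub> a"
  have yM: "?y \<in> carrier M" using z aM by simp
  have zy: "B z ?y = B z a" using z aM by (simp add: form_add_right form_alternating)
  have "B ?y x = \<ominus> B x a" using z x aM True form_antisym[of a x] by (simp add: form_add_left)
  then have yx: "B ?y x \<noteq> \<zero>" using a x aM by (metis R.minus_minus R.minus_zero form_closed)
  have Uy: "B ?y u = B z u" if "u \<in> U" for u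
    using that a z aM sub by (auto simp: form_add_left perp_def)
  obtain g where g: "g \<in> isometries" "\<forall>u\<in>U. g u = u" "g z = ?y"
    using transvection_transitive[OF sub z(1) yM] Uy zy a by metis
  obtain h where h: "h \<in> isometries" "\<forall>u\<in>U. h u = u" "h ?y = x"
    using transvection_transitive[OF sub yM x(1)] Uy eq yx by metis
  show ?thesis using isometries_comp[OF h(1) g(1)] g h by (intro bexI[of _ "h \<circ> g"]) auto
qed

text \<open>Two vectors define the same functional on \<open>U\<close> iff they differ by an element
  of \<open>perp U\<close>, so \<open>card_perp\<close> leaves \<open>|V| / |perp U| = |U|\<close>
  functionals.\<close>

lemma card_functionals:
  assumes U: "subspace U"
  shows "card ((\<lambda>x. restrict (B x) U) ` carrier M) = card U"
proof -
  have sub: "U \<subseteq> carrier M" using U by (rule subspace_subset)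
  have P: "subspace (perp U)" using sub by (rule subspace_perp)
  have PM: "perp U \<subseteq> carrier M" by (auto simp: perp_def)
  have "card (carrier M) = card ((\<lambda>x. restrict (B x) U) ` carrier M) * card (perp U)"
  proof (rule card_eq_card_image_mult[OF finite_vectors])
    fix v assume v: "v \<in> carrier M"
    have "bij_betw (\<lambda>y. v \<oplus>\<^bsub>M\<^esub> y) (perp U) {y \<in> carrier M. restrict (B y) U = restrict (B v) U}"
    proof (rule bij_betw_byWitness[where f' = "\<lambda>y. y \<ominus>\<^bsub>M\<^esub> v"])
      show "\<forall>a\<in>perp U. v \<oplus>\<^bsub>M\<^esub> a \<ominus>\<^bsub>M\<^esub> v = a"
        using PM v
          by (metis (no_types, lifting) M.a_closed M.add.m_comm M.add.inv_closed M.a_assoc M.minus_eq M.r_neg M.r_zero subsetD)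
      show "\<forall>a\<in>{y \<in> carrier M. restrict (B y) U = restrict (B v) U}. v \<oplus>\<^bsub>M\<^esub> (a \<ominus>\<^bsub>M\<^esub> v) = a"
        using v by (auto simp: add_diff_cancel)
      show "(\<oplus>\<^bsub>M\<^esub>) v ` perp U \<subseteq> {y \<in> carrier M. restrict (B y) U = restrict (B v) U}"
        using sub v by (auto simp: perp_def form_add_left subset_iff intro!: restrict_ext)
      show "(\<lambda>y. y \<ominus>\<^bsub>M\<^esub> v) ` {y \<in> carrier M. restrict (B y) U = restrict (B v) U} \<subseteq> perp U"
      proof
        fix w assume "w \<in> (\<lambda>y. y \<ominus>\<^bsub>M\<^esub> v) ` {y \<in> carrier M. restrict (B y) U = restrict (B v) U}"
        then obtain y where y: "y \<in> carrier M" "restrict (B y) U = restrict (B v) U" "w = y \<ominus>\<^bsub>M\<^esub> v"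
          by auto
        have "B y u = B v u" if "u \<in> U" for u using fun_cong[OF y(2), of u] that by simp
        then show "w \<in> perp U" using y v sub
          by (auto simp: perp_def form_diff_left R.minus_eq R.r_neg subset_iff)
      qed
    qed
    then show "card {y \<in> carrier M. restrict (B y) U = restrict (B v) U} = card (perp U)"
      by (simp add: bij_betw_same_card)
  qed
  moreover have "card (perp U) > 0"
    using subspace_zero[OF P] finite_vectors by (metis card_gt_0_iff empty_iff finite_subset PM)
  ultimately show ?thesis using card_perp[OF U] by simp
qed

subsection \<open>Krylov subspaces\<close>

primrec krylov :: "('b \<Rightarrow> 'b) \<Rightarrow> 'b set \<Rightarrow> 'b \<Rightarrow> nat \<Rightarrow> 'b set" where
  "krylov T W u 0 = W"
| "krylov T W u (Suc m) = {x \<oplus>\<^bsub>M\<^esub> c \<odot>\<^bsub>M\<^esub> (T ^^ m) u | x c. x \<in> krylov T W u m \<and> c \<in> carrier R}"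

text \<open>Names a vector of the Krylov subspace by its part \<open>w\<close> in \<open>W\<close>
  and its coefficients \<open>c\<close>, so that the same relation can be stated for a second pair
  \<open>T'\<close>, \<open>u'\<close>.\<close>

primrec krylov_comb :: "('b \<Rightarrow> 'b) \<Rightarrow> 'b \<Rightarrow> (nat \<Rightarrow> 'a) \<Rightarrow> 'b \<Rightarrow> nat \<Rightarrow> 'b" where
  "krylov_comb T w c u 0 = w"
| "krylov_comb T w c u (Suc m) = krylov_comb T w c u m \<oplus>\<^bsub>M\<^esub> c m \<odot>\<^bsub>M\<^esub> (T ^^ m) u"

lemma funpow_isometries: "T \<in> isometries \<Longrightarrow> T ^^ m \<in> isometries"
  by (induction m) (auto simp: id_isometries isometries_comp)

lemma funpow_closed [simp]: "T \<in> isometries \<Longrightarrow> (T ^^ m) u \<in> carrier M \<longleftrightarrow> u \<in> carrier M"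
  by (simp add: funpow_isometries)

lemma krylov_subset:
  assumes "T \<in> isometries" "W \<subseteq> carrier M" "u \<in> carrier M"
  shows "krylov T W u m \<subseteq> carrier M"
  using assms by (induction m) auto

lemma krylov_mono:
  assumes T: "T \<in> isometries" and W: "W \<subseteq> carrier M" and u: "u \<in> carrier M" and "l \<le> m"
  shows "krylov T W u l \<subseteq> krylov T W u m"
proof (rule lift_Suc_mono_le[OF _ \<open>l \<le> m\<close>])
  fix k
  show "krylov T W u k \<subseteq> krylov T W u (Suc k)"
  proof
    fix x assume x: "x \<in> krylov T W u k"
    then have "x = x \<oplus>\<^bsub>M\<^esub> \<zero> \<odot>\<^bsub>M\<^esub> (T ^^ k) u" using krylov_subset[OF T W u, of k] T u by auto
    then show "x \<in> krylov T W u (Suc k)" using x by auto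
  qed
qed

lemma subspace_krylov:
  assumes T: "T \<in> isometries" and W: "subspace W" and u: "u \<in> carrier M"
  shows "subspace (krylov T W u m)"
proof (induction m)
  case 0
  then show ?case using W by simp
next
  case (Suc m)
  let ?K = "krylov T W u m" and ?z = "(T ^^ m) u"
  have z: "?z \<in> carrier M" using T u by simp
  have K: "?K \<subseteq> carrier M" using Suc by (rule subspace_subset)
  show ?case
  proof (rule subspaceI)
    show "krylov T W u (Suc m) \<subseteq> carrier M" using krylov_subset[OF T subspace_subset[OF W] u] .
    show "\<zero>\<^bsub>M\<^esub> \<in> krylov T W u (Suc m)"
      using krylov_mono[OF T subspace_subset[OF W] u, of m "Suc m"] subspace_zero[OF Suc] by auto
  next
    fix x y assume "x \<in> krylov T W u (Suc m)" "y \<in> krylov T W u (Suc m)"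
    then obtain x' c y' d where *: "x = x' \<oplus>\<^bsub>M\<^esub> c \<odot>\<^bsub>M\<^esub> ?z" "x' \<in> ?K" "c \<in> carrier R"
      "y = y' \<oplus>\<^bsub>M\<^esub> d \<odot>\<^bsub>M\<^esub> ?z" "y' \<in> ?K" "d \<in> carrier R" by auto
    then have "x' \<in> carrier M" "y' \<in> carrier M" using K by auto
    then have "x \<oplus>\<^bsub>M\<^esub> y = (x' \<oplus>\<^bsub>M\<^esub> y') \<oplus>\<^bsub>M\<^esub> (c \<oplus> d) \<odot>\<^bsub>M\<^esub> ?z"
      using * z by (simp add: smult_l_distr M.a_ac)
    then show "x \<oplus>\<^bsub>M\<^esub> y \<in> krylov T W u (Suc m)"
      using * submoduleE(5)[OF Suc] by auto
  next
    fix a x assume a: "a \<in> carrier R" and "x \<in> krylov T W u (Suc m)"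
    then obtain x' c where *: "x = x' \<oplus>\<^bsub>M\<^esub> c \<odot>\<^bsub>M\<^esub> ?z" "x' \<in> ?K" "c \<in> carrier R" by auto
    then have "x' \<in> carrier M" using K by auto
    then have "a \<odot>\<^bsub>M\<^esub> x = a \<odot>\<^bsub>M\<^esub> x' \<oplus>\<^bsub>M\<^esub> (a \<otimes> c) \<odot>\<^bsub>M\<^esub> ?z"
      using * z a by (simp add: smult_r_distr smult_assoc1)
    then show "a \<odot>\<^bsub>M\<^esub> x \<in> krylov T W u (Suc m)"
      using * a submoduleE(4)[OF Suc] by auto
  qed
qed

lemma funpow_mem_krylov:
  assumes T: "T \<in> isometries" and W: "subspace W" and u: "u \<in> carrier M" and "t < m"
  shows "(T ^^ t) u \<in> krylov T W u m"
proof -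
  have "(T ^^ t) u = \<zero>\<^bsub>M\<^esub> \<oplus>\<^bsub>M\<^esub> \<one> \<odot>\<^bsub>M\<^esub> (T ^^ t) u" using T u by simp
  then have "(T ^^ t) u \<in> krylov T W u (Suc t)"
    using subspace_zero[OF subspace_krylov[OF T W u, of t]] by auto
  then show ?thesis using krylov_mono[OF T subspace_subset[OF W] u, of "Suc t" m] \<open>t < m\<close> by auto
qed

lemma krylov_induct [consumes 1, case_names base step]:
  assumes "y \<in> krylov T W u m"
    and "\<And>w. w \<in> W \<Longrightarrow> P w"
    and "\<And>t x c. \<lbrakk>t < m; P x; c \<in> carrier R\<rbrakk> \<Longrightarrow> P (x \<oplus>\<^bsub>M\<^esub> c \<odot>\<^bsub>M\<^esub> (T ^^ t) u)"
  shows "P y"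
  using assms by (induction m arbitrary: y) auto

lemma mem_krylov_comb:
  assumes "y \<in> krylov T W u m"
  shows "\<exists>w\<in>W. \<exists>c\<in>{..<m} \<rightarrow>\<^sub>E carrier R. y = krylov_comb T w c u m"
  using assms
proof (induction m arbitrary: y)
  case 0
  then show ?case by auto
next
  case (Suc m)
  then obtain x a where x: "x \<in> krylov T W u m" "a \<in> carrier R" "y = x \<oplus>\<^bsub>M\<^esub> a \<odot>\<^bsub>M\<^esub> (T ^^ m) u"
    by auto
  from Suc.IH[OF x(1)] obtain w c
    where wc: "w \<in> W" "c \<in> {..<m} \<rightarrow>\<^sub>E carrier R" "x = krylov_comb T w c u m" by auto
  have cong: "krylov_comb T w (c(m := a)) u l = krylov_comb T w c u l" if "l \<le> m" for l
    using that by (induction l) auto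
  have "c(m := a) \<in> {..<Suc m} \<rightarrow>\<^sub>E carrier R"
    using wc(2) x(2) by (auto simp: lessThan_Suc intro!: PiE_fun_upd)
  moreover have "y = krylov_comb T w (c(m := a)) u (Suc m)" using cong x wc by simp
  ultimately show ?case using wc(1) by blast
qed

lemma card_krylov_le:
  assumes T: "T \<in> isometries" and W: "W \<subseteq> carrier M"
  shows "card (krylov T W u m) \<le> card W * card (carrier R) ^ m"
proof -
  let ?S = "W \<times> ({..<m} \<rightarrow>\<^sub>E carrier R)"
  have fin: "finite ?S" using finite_scalars finite_subset[OF W finite_vectors]
    by (simp add: finite_PiE)
  have "krylov T W u m \<subseteq> (\<lambda>(w, c). krylov_comb T w c u m) ` ?S"
    using mem_krylov_comb[of _ T W u m] by fastforce
  then have "card (krylov T W u m) \<le> card ?S" using fin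
    by (meson card_image_le card_mono finite_imageI le_trans)
  also have "\<dots> = card W * card (carrier R) ^ m" by (simp add: card_cartesian_product card_PiE)
  finally show ?thesis .
qed

text \<open>The isometry \<open>h\<close> is asked to match only the generators, not to intertwine
  \<open>T\<close> and \<open>T'\<close>. This covers conjugation, the partially built isometry in
  \<open>krylov_extend_isometry\<close>, and, with \<open>h = id\<close>, enlarging
  \<open>W\<close>.\<close>

lemma krylov_map:
  assumes y: "y \<in> krylov T W u m" and h: "h \<in> isometries" and T: "T \<in> isometries"
    and W: "W \<subseteq> carrier M" and u: "u \<in> carrier M" and T': "T' \<in> isometries" and W': "subspace W'"
      and u': "u' \<in> carrier M"
    and hW: "\<And>w. w \<in> W \<Longrightarrow> h w \<in> W'" and hu: "\<And>t. t < m \<Longrightarrow> h ((T ^^ t) u) = (T' ^^ t) u'"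
  shows "h y \<in> krylov T' W' u' m"
proof -
  have K: "subspace (krylov T' W' u' m)" using T' W' u' by (rule subspace_krylov)
  have "y \<in> carrier M \<and> h y \<in> krylov T' W' u' m" using y
  proof (induction rule: krylov_induct)
    case (base w)
    then show ?case using W hW krylov_mono[OF T' subspace_subset[OF W'] u', of 0 m] by auto
  next
    case (step t x c)
    then show ?case using h T u hu funpow_mem_krylov[OF T' W' u' step(1)] K
      by (simp add: isometries_add isometries_smult submoduleE(4,5))
  qed
  then show ?thesis ..
qed

text \<open>\<open>T\<close> shifts the generators \<open>T^t u\<close> by one, so only the last of
  them leaves the list, and the hypothesis on \<open>T^e u\<close> brings it back.\<close>

lemma krylov_invariant:
  assumes T: "T \<in> isometries" and W: "subspace W" and u: "u \<in> carrier M"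
    and inv: "\<And>w. w \<in> W \<Longrightarrow> T w \<in> W"
    and e: "(T ^^ e) u \<in> krylov T W u e" and y: "y \<in> krylov T W u e"
  shows "T y \<in> krylov T W u e"
proof -
  have K: "subspace (krylov T W u e)" using T W u by (rule subspace_krylov)
  have "y \<in> carrier M \<and> T y \<in> krylov T W u e" using y
  proof (induction rule: krylov_induct)
    case (base w)
    then show ?case
      using subspace_subset[OF W] inv krylov_mono[OF T subspace_subset[OF W] u, of 0 e] by auto
  next
    case (step t x c)
    have "(T ^^ Suc t) u \<in> krylov T W u e"
      using e funpow_mem_krylov[OF T W u, of "Suc t" e] step(1) by (cases "Suc t = e") auto
    then show ?case using step T u K
      by (simp add: isometries_add isometries_smult submoduleE(4,5))
  qed
  then show ?thesis ..
qed

section \<open>The Gram data of a Krylov sequence\<close>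

lemma funpow_form:
  "\<lbrakk>T \<in> isometries; x \<in> carrier M; y \<in> carrier M\<rbrakk> \<Longrightarrow> B ((T ^^ s) x) ((T ^^ s) y) = B x y"
  by (simp add: funpow_isometries isometries_form)

lemma form_funpow_shift:
  assumes T: "T \<in> isometries" and u: "u \<in> carrier M"
  shows "B ((T ^^ s) u) ((T ^^ (s + t)) u) = B u ((T ^^ t) u)"
  using funpow_form[OF T u, of "(T ^^ t) u" s] T u by (simp add: funpow_add)

text \<open>Up to sign the value depends only on the difference of the exponents. The two
  inequalities \<open>ab\<close> say \<open>|a - b| < N\<close> without subtracting
  naturals.\<close>

lemma form_funpow_determined:
  assumes T: "T \<in> isometries" and u: "u \<in> carrier M" and T': "T' \<in> isometries"
    and u': "u' \<in> carrier M"
    and eq: "\<And>t. t < N \<Longrightarrow> B u ((T ^^ t) u) = B u' ((T' ^^ t) u')"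
    and ab: "a < b + N" "b < a + N"
  shows "B ((T ^^ a) u) ((T ^^ b) u) = B ((T' ^^ a) u') ((T' ^^ b) u')"
proof (cases "a \<le> b")
  case True
  then show ?thesis
    using form_funpow_shift[OF T u, of a "b - a"] form_funpow_shift[OF T' u', of a "b - a"] eq[of "b - a"] ab by simp
next
  case False
  then have "B ((T ^^ b) u) ((T ^^ a) u) = B ((T' ^^ b) u') ((T' ^^ a) u')"
    using form_funpow_shift[OF T u, of b "a - b"] form_funpow_shift[OF T' u', of b "a - b"] eq[of "a - b"] ab by simp
  then show ?thesis
    using form_antisym[of "(T ^^ a) u" "(T ^^ b) u"] form_antisym[of "(T' ^^ a) u'" "(T' ^^ b) u'"] T u T' u' by simp
qed

text \<open>An injective self-map of a finite set is onto. Writing a vector of \<open>W\<close> as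
  \<open>T^s x\<close> with \<open>x\<close> in \<open>W\<close> removes the power of
  \<open>T\<close> from its pairing with \<open>T^s u\<close>.\<close>

lemma funpow_onto_invariant:
  assumes T: "T \<in> isometries" and W: "W \<subseteq> carrier M" and inv: "\<And>w. w \<in> W \<Longrightarrow> T w \<in> W" and y: "y \<in> W"
  shows "\<exists>x\<in>W. (T ^^ s) x = y"
proof -
  have "(T ^^ s) ` W \<subseteq> W" by (induction s) (auto simp: inv)
  moreover have "inj_on (T ^^ s) W"
    using permutes_inj_on[OF isometries_permutes[OF funpow_isometries[OF T]]] .
  moreover have "finite W" using finite_subset[OF W finite_vectors] .
  ultimately have "(T ^^ s) ` W = W" by (simp add: endo_inj_surj)
  then show ?thesis using y by (metis imageE)
qed

lemma krylov_comb_form: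
  assumes T: "T \<in> isometries" and u: "u \<in> carrier M" and T': "T' \<in> isometries"
    and u': "u' \<in> carrier M"
    and z: "z \<in> carrier M" and z': "z' \<in> carrier M" and w: "w \<in> carrier M"
    and c: "\<And>t. t < m \<Longrightarrow> c t \<in> carrier R"
    and eqw: "B z w = B z' w" and eq: "\<And>t. t < m \<Longrightarrow> B z ((T ^^ t) u) = B z' ((T' ^^ t) u')"
  shows "B z (krylov_comb T w c u m) = B z' (krylov_comb T' w c u' m)"
proof -
  have cl: "krylov_comb T w c u l \<in> carrier M" "krylov_comb T' w c u' l \<in> carrier M" if "l \<le> m" for l
    using that T u T' u' w c by (induction l) auto
  have "B z (krylov_comb T w c u l) = B z' (krylov_comb T' w c u' l)" if "l \<le> m" for l
    using that
      by (induction l) (use T u T' u' z z' cl c eqw eq in \<open>auto simp: form_add_right form_smult_right\<close>)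
  then show ?thesis by simp
qed

lemma krylov_comb_map:
  assumes h: "h \<in> isometries" and T: "T \<in> isometries" and u: "u \<in> carrier M" and w: "w \<in> carrier M"
    and c: "\<And>t. t < m \<Longrightarrow> c t \<in> carrier R" and hu: "\<And>t. t < m \<Longrightarrow> h ((T ^^ t) u) = (T' ^^ t) u'"
  shows "h (krylov_comb T w c u m) = krylov_comb T' (h w) c u' m"
proof -
  have cl: "krylov_comb T w c u l \<in> carrier M" if "l \<le> m" for l
    using that T u w c by (induction l) auto
  have "h (krylov_comb T w c u l) = krylov_comb T' (h w) c u' l" if "l \<le> m" for l
    using that by (induction l) (use h T u hu cl c in \<open>auto simp: isometries_add isometries_smult\<close>)
  then show ?thesis by simp
qed

text \<open>With \<open>a t = B u (T\<^sup>t u)\<close>, pairing the relation for \<open>T\<^sup>e u\<close> with \<open>T\<^sup>s u\<close> expresses \<open>a (e - s)\<close> through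
  the \<open>a (j - s)\<close> with \<open>j < e\<close>.  Since \<open>a (- t) = - a t\<close>, for \<open>2 s < e\<close> these all have smaller index in
  absolute value, so that half of the \<open>a t\<close> determine all of them.\<close>

lemma krylov_form_determined:
  assumes T: "T \<in> isometries" and u: "u \<in> carrier M" and T': "T' \<in> isometries"
    and u': "u' \<in> carrier M"
    and w: "w \<in> carrier M" and c: "\<And>t. t < e \<Longrightarrow> c t \<in> carrier R"
    and rel: "(T ^^ e) u = krylov_comb T w c u e" "(T' ^^ e) u' = krylov_comb T' w c u' e"
    and eqw: "\<And>s. B ((T ^^ s) u) w = B ((T' ^^ s) u') w"
    and half: "\<And>t. \<lbrakk>1 \<le> t; t \<le> e div 2\<rbrakk> \<Longrightarrow> B u ((T ^^ t) u) = B u' ((T' ^^ t) u')"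
    and "t < e"
  shows "B u ((T ^^ t) u) = B u' ((T' ^^ t) u')"
  using \<open>t < e\<close>
proof (induction t rule: less_induct)
  case (less t)
  consider "t = 0" | "1 \<le> t" "t \<le> e div 2" | "e div 2 < t" by linarith
  then show ?case
  proof cases
    case 1
    then show ?thesis using u u' by (simp add: form_alternating)
  next
    case 2
    then show ?thesis by (rule half)
  next
    case 3
    \<comment> \<open>Since \<open>t\<close> exceeds \<open>e div 2\<close>, also
      \<open>?s < t\<close>. For every \<open>j < e\<close> the difference of \<open>j\<close> and
      \<open>?s\<close> is then below \<open>t\<close> in absolute value, so the induction
      hypothesis covers each term of the relation.\<close>
    let ?s = "e - t"
    have s: "?s < t" "?s + t = e" using 3 less.prems by linarith+
    have "B ((T ^^ ?s) u) (krylov_comb T w c u e) = B ((T' ^^ ?s) u') (krylov_comb T' w c u' e)"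
    proof (rule krylov_comb_form[OF T u T' u' _ _ w c eqw])
      fix j assume j: "j < e"
      show "B ((T ^^ ?s) u) ((T ^^ j) u) = B ((T' ^^ ?s) u') ((T' ^^ j) u')"
      proof (rule form_funpow_determined[OF T u T' u'])
        show "B u ((T ^^ r) u) = B u' ((T' ^^ r) u')" if "r < t" for r
          using less that by simp
      qed (use s j in linarith)+
    qed (use T u T' u' in auto)
    then have "B ((T ^^ ?s) u) ((T ^^ (?s + t)) u) = B ((T' ^^ ?s) u') ((T' ^^ (?s + t)) u')"
      using rel s by simp
    then show ?thesis using form_funpow_shift[OF T u] form_funpow_shift[OF T' u'] by metis
  qed
qed

text \<open>Witt's theorem for the sequences \<open>T^t u\<close> and \<open>T'^t u'\<close> over a
  common invariant subspace. The vectors are matched one at a time: an isometry \<open>h\<close>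
  that matches the first \<open>m\<close> of them is corrected by one that fixes \<open>W\<close>
  and these vectors.\<close>

lemma krylov_extend_isometry:
  assumes T: "T \<in> isometries" and u: "u \<in> carrier M" and T': "T' \<in> isometries"
    and u': "u' \<in> carrier M"
    and W: "subspace W" and inv: "\<And>x. x \<in> W \<Longrightarrow> T x \<in> W" and agree: "\<And>x. x \<in> W \<Longrightarrow> T' x = T x"
    and indep: "\<And>t. t < e \<Longrightarrow> (T ^^ t) u \<notin> krylov T W u t"
    and indep': "\<And>t. t < e \<Longrightarrow> (T' ^^ t) u' \<notin> krylov T' W u' t"
    and w: "w \<in> W" and c: "c \<in> {..<e} \<rightarrow>\<^sub>E carrier R"
    and rel: "(T ^^ e) u = krylov_comb T w c u e" "(T' ^^ e) u' = krylov_comb T' w c u' e"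
    and eqW: "\<And>y. y \<in> W \<Longrightarrow> B u y = B u' y"
    and half: "\<And>t. \<lbrakk>1 \<le> t; t \<le> e div 2\<rbrakk> \<Longrightarrow> B u ((T ^^ t) u) = B u' ((T' ^^ t) u')"
  shows "\<exists>h\<in>isometries. (\<forall>y\<in>W. h y = y) \<and> (\<forall>t\<le>e. h ((T ^^ t) u) = (T' ^^ t) u')"
proof -
  have WM: "W \<subseteq> carrier M" using W by (rule subspace_subset)
  have cR: "c t \<in> carrier R" if "t < e" for t using c that by auto
  have powW: "(T' ^^ s) y = (T ^^ s) y \<and> (T ^^ s) y \<in> W" if "y \<in> W" for s y
    using that by (induction s) (auto simp: inv agree)
  have eqWs: "B ((T ^^ s) u) y = B ((T' ^^ s) u') y" if y: "y \<in> W" for s y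
  proof -
    obtain x where x: "x \<in> W" "(T ^^ s) x = y" using funpow_onto_invariant[OF T WM inv y] by blast
    then have xM: "x \<in> carrier M" using WM by auto
    have "B ((T ^^ s) u) y = B u x" using x xM u T funpow_form by metis
    moreover have "B ((T' ^^ s) u') y = B u' x" using x xM u' T' funpow_form powW by metis
    ultimately show ?thesis using eqW x by simp
  qed
  have gram: "B u ((T ^^ t) u) = B u' ((T' ^^ t) u')" if "t < e" for t
    using krylov_form_determined[OF T u T' u' _ cR rel eqWs[OF w] half that] w WM by auto
  have "\<exists>h\<in>isometries. (\<forall>y\<in>W. h y = y) \<and> (\<forall>t<m. h ((T ^^ t) u) = (T' ^^ t) u')" if "m \<le> e" for m
    using that
  proof (induction m)
    case 0
    then show ?case using id_isometries by (intro bexI[of _ id]) simp_all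
  next
    case (Suc m)
    then obtain h
      where h: "h \<in> isometries" "\<And>y. y \<in> W \<Longrightarrow> h y = y" "\<And>t. t < m \<Longrightarrow> h ((T ^^ t) u) = (T' ^^ t) u'"
      by auto
    let ?U = "krylov T W u m" and ?z = "(T ^^ m) u" and ?z' = "(T' ^^ m) u'"
    \<comment> \<open>The target pulled back by \<open>h\<close>. It suffices to move
      \<open>?z\<close> to \<open>x\<close> while fixing \<open>?U\<close> pointwise, and to apply
      \<open>h\<close> afterwards.\<close>
    define x where "x = inv_into UNIV h ?z'"
    have hx: "h x = ?z'" using h(1) by (simp add: x_def)
    have xM: "x \<in> carrier M" using h(1) T' u' isometries_inv by (simp add: x_def)
    have U: "subspace ?U" using T W u by (rule subspace_krylov)
    have z: "?z \<in> carrier M" "?z' \<in> carrier M" using T u T' u' by auto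
    have "x \<notin> ?U"
    proof
      assume "x \<in> ?U"
      then have "h x \<in> krylov T' W u' m" using h
        by (intro krylov_map[OF _ h(1) T WM u T' W u']) auto
      then show False using hx indep'[of m] Suc.prems by simp
    qed
    moreover have "B ?z y = B x y" if y: "y \<in> ?U" for y
    proof -
      have "y \<in> carrier M \<and> B ?z y = B ?z' (h y)" using y
      proof (induction rule: krylov_induct)
        case (base y)
        then show ?case using WM eqWs h(2) by auto
      next
        case (step t y a)
        have "B ?z ((T ^^ t) u) = B ?z' ((T' ^^ t) u')"
          by (rule form_funpow_determined[OF T u T' u' gram]) (use step Suc.prems in auto)
        then show ?case using step z T u T' u' h
          by (auto simp: form_add_right form_smult_right isometries_add isometries_smult)
      qed
      then show ?thesis using isometries_form[OF h(1) xM, of y] hx by simp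
    qed
    ultimately obtain k where k: "k \<in> isometries" "\<forall>y\<in>?U. k y = y" "k ?z = x"
      using pointwise_stabilizer_transitive[OF U z(1) _ xM] indep[of m] Suc.prems by force
    have "(h \<circ> k) ((T ^^ t) u) = (T' ^^ t) u'" if "t < Suc m" for t
    proof (cases "t = m")
      case True
      then show ?thesis using k hx by simp
    next
      case False
      then have "t < m" using that by simp
      then show ?thesis using k h funpow_mem_krylov[OF T W u, of t m] by simp
    qed
    moreover have "(h \<circ> k) y = y" if "y \<in> W" for y
      using k h that krylov_mono[OF T WM u, of 0 m] by auto
    ultimately show ?case using isometries_comp[OF h(1) k(1)] by blast
  qed
  then obtain h where h: "h \<in> isometries" "\<forall>y\<in>W. h y = y" "\<forall>t<e. h ((T ^^ t) u) = (T' ^^ t) u'"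
    by blast
  \<comment> \<open>Vector number \<open>e\<close> depends on the earlier ones and on
    \<open>w\<close>, so its image is forced by the common relation.\<close>
  have "h ((T ^^ e) u) = krylov_comb T' (h w) c u' e"
    unfolding rel(1) using h w WM cR by (intro krylov_comb_map[OF _ T u]) auto
  then have "h ((T ^^ e) u) = (T' ^^ e) u'" using h w rel by simp
  then show ?thesis using h by (metis le_neq_implies_less)
qed

text \<open>\<open>hu\<close> reaches up to \<open>t = e\<close>, one further than the generators of
  the subspace, because \<open>T\<close> sends the last generator to \<open>T^e u\<close>.\<close>

lemma krylov_intertwine:
  assumes h: "h \<in> isometries" and T: "T \<in> isometries" and u: "u \<in> carrier M"
    and T': "T' \<in> isometries"
    and u': "u' \<in> carrier M" and W: "W \<subseteq> carrier M" and inv: "\<And>x. x \<in> W \<Longrightarrow> T x \<in> W"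
    and agree: "\<And>x. x \<in> W \<Longrightarrow> T' x = T x"
    and hW: "\<And>y. y \<in> W \<Longrightarrow> h y = y" and hu: "\<And>t. t \<le> e \<Longrightarrow> h ((T ^^ t) u) = (T' ^^ t) u'"
    and y: "y \<in> krylov T W u e"
  shows "h (T y) = T' (h y)"
proof -
  have "y \<in> carrier M \<and> h (T y) = T' (h y)" using y
  proof (induction rule: krylov_induct)
    case (base w)
    then show ?case using W inv agree hW by auto
  next
    case (step t x c)
    have "h (T ((T ^^ t) u)) = T' ((T' ^^ t) u')" using hu[of "Suc t"] step(1) by simp
    then show ?case using step h T T' u u' hu[of t]
      by (simp add: isometries_add isometries_smult)
  qed
  then show ?thesis ..
qed

subsection \<open>Counting isometries with small cyclic subspaces\<close>

text \<open>For invariant \<open>W\<close> this is the number of dimensions that \<open>u\<close>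
  adds. \<open>LEAST\<close> is meaningful once some relation exists, which
  \<open>krylov_stop_props\<close> derives from \<open>cyclic_bounded\<close>.\<close>

definition krylov_stop :: "('b \<Rightarrow> 'b) \<Rightarrow> 'b set \<Rightarrow> 'b \<Rightarrow> nat" where
  "krylov_stop T W u = (LEAST e. (T ^^ e) u \<in> krylov T W u e)"

text \<open>Two points \<open>(T, u)\<close> with the same choice and the same stopping length
  satisfy literally the same relation. Extensional coefficient functions leave finitely many
  candidates to count.\<close>

definition krylov_relation :: "('b \<Rightarrow> 'b) \<Rightarrow> 'b set \<Rightarrow> 'b \<Rightarrow> 'b \<times> (nat \<Rightarrow> 'a)" where
  "krylov_relation T W u = (let e = krylov_stop T W u in
     SOME (w, c). w \<in> W \<and> c \<in> {..<e} \<rightarrow>\<^sub>E carrier R \<and> (T ^^ e) u = krylov_comb T w c u e)"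

text \<open>A complete invariant for adding one vector: by \<open>krylov_data_eq\<close>, equal
  values give an isometry that fixes \<open>W\<close> and carries one extension to the other. The
  range of \<open>t\<close> starts at 1 because the form is alternating, and stops at half by
  \<open>krylov_form_determined\<close>.\<close>

definition krylov_data where
  "krylov_data W = (\<lambda>(T, u). (krylov_stop T W u, krylov_relation T W u, restrict (B u) W,
     \<lambda>t\<in>{1..krylov_stop T W u div 2}. B u ((T ^^ t) u)))"

definition krylov_data_space where
  "krylov_data_space W d = (SIGMA e:{..d}. (W \<times> ({..<e} \<rightarrow>\<^sub>E carrier R)) \<times>
     ((\<lambda>x. restrict (B x) W) ` carrier M \<times> ({1..e div 2} \<rightarrow>\<^sub>E carrier R)))"

lemma krylov_data_space_card:
  assumes W: "subspace W"
  shows "finite (krylov_data_space W d)"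
    and "card (krylov_data_space W d) \<le> 2 * (card W)\<^sup>2 * card (carrier R) ^ (d + d div 2)"
proof -
  let ?F = "\<lambda>e::nat. (W \<times> ({..<e} \<rightarrow>\<^sub>E carrier R)) \<times>
     ((\<lambda>x. restrict (B x) W) ` carrier M \<times> ({1..e div 2} \<rightarrow>\<^sub>E carrier R))"
  let ?q = "card (carrier R)"
  have fin: "finite (?F e)" for e
    using finite_vectors finite_scalars finite_subset[OF subspace_subset[OF W]]
      by (simp add: finite_PiE)
  then show "finite (krylov_data_space W d)"
    unfolding krylov_data_space_def by (rule finite_SigmaI[OF finite_atMost])
  have "card (krylov_data_space W d) = (\<Sum>e\<le>d. card (?F e))"
    unfolding krylov_data_space_def using fin by (intro card_SigmaI) auto
  also have "\<dots> = (\<Sum>e\<le>d. (card W)\<^sup>2 * ?q ^ (e + e div 2))"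
    by (intro sum.cong refl)
      (simp add: card_cartesian_product card_PiE card_functionals[OF W] power_add power2_eq_square)
  also have "\<dots> = (card W)\<^sup>2 * (\<Sum>e\<le>d. ?q ^ (e + e div 2))" by (simp add: sum_distrib_left)
  also have "\<dots> \<le> (card W)\<^sup>2 * (2 * ?q ^ (d + d div 2))"
    using sum_power_half_le[OF card_scalars_ge_2] by (rule mult_left_mono) simp
  finally show "card (krylov_data_space W d) \<le> 2 * (card W)\<^sup>2 * ?q ^ (d + d div 2)"
    by (simp add: mult_ac)
qed

text \<open>The coefficients of the relation may depend on \<open>u\<close>. This vectorwise
  condition is what the count takes from the minimal polynomial; smaller degrees are
  included.\<close>

definition cyclic_bounded :: "nat \<Rightarrow> ('b \<Rightarrow> 'b) set" where
  "cyclic_bounded d = {T \<in> isometries. \<forall>u\<in>carrier M. (T ^^ d) u \<in> krylov T {\<zero>\<^bsub>M\<^esub>} u d}"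

text \<open>Used when a pair is pulled back to a representative: the Krylov sequences of the
  conjugate must still stop within \<open>d\<close> steps.\<close>

lemma cyclic_bounded_conj:
  assumes T: "T \<in> cyclic_bounded d" and g: "g \<in> isometries"
  shows "inv_into UNIV g \<circ> T \<circ> g \<in> cyclic_bounded d"
proof -
  let ?h = "inv_into UNIV g" and ?Z = "{\<zero>\<^bsub>M\<^esub>}"
  have Ti: "T \<in> isometries" using T by (simp add: cyclic_bounded_def)
  have h: "?h \<in> isometries" using g by (rule isometries_inv)
  have S: "?h \<circ> T \<circ> g \<in> isometries" using g h Ti by (intro isometries_comp)
  have pow: "?h ((T ^^ t) (g u)) = ((?h \<circ> T \<circ> g) ^^ t) u" for t u
  proof (induction t)
    case (Suc t)
    have "g (((?h \<circ> T \<circ> g) ^^ t) u) = (T ^^ t) (g u)" using Suc g by (metis isometries_inv_apply(2))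
    then show ?case by (metis comp_apply funpow.simps(2))
  qed (use g in simp)
  have Z: "subspace ?Z" by (rule subspaceI) auto
  have "((?h \<circ> T \<circ> g) ^^ d) u \<in> krylov (?h \<circ> T \<circ> g) ?Z u d" if u: "u \<in> carrier M" for u
  proof -
    have "(T ^^ d) (g u) \<in> krylov T ?Z (g u) d" using T u g by (simp add: cyclic_bounded_def)
    then have "?h ((T ^^ d) (g u)) \<in> krylov (?h \<circ> T \<circ> g) ?Z u d"
      by (rule krylov_map[OF _ h Ti _ _ S Z u]) (use pow u g isometries_zero[OF h] in auto)
    then show ?thesis by (simp only: pow)
  qed
  then show ?thesis using S by (simp add: cyclic_bounded_def)
qed

text \<open>A relation over the zero subspace is also one over \<open>W\<close>, so the sequence
  stops by step \<open>d\<close>. Minimality keeps each earlier vector outside the span of its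
  predecessors and \<open>W\<close>, as Witt's step requires.\<close>

lemma krylov_stop_props:
  assumes T: "T \<in> cyclic_bounded d" and W: "subspace W" and u: "u \<in> carrier M"
  defines "e \<equiv> krylov_stop T W u"
  shows "e \<le> d" and "(T ^^ e) u \<in> krylov T W u e" and "\<And>t. t < e \<Longrightarrow> (T ^^ t) u \<notin> krylov T W u t"
    and "\<exists>w c. krylov_relation T W u = (w, c) \<and> w \<in> W \<and> c \<in> {..<e} \<rightarrow>\<^sub>E carrier R \<and> (T ^^ e) u = krylov_comb T w c u e"
proof -
  have Ti: "T \<in> isometries" using T by (simp add: cyclic_bounded_def)
  have "(T ^^ d) u \<in> krylov T {\<zero>\<^bsub>M\<^esub>} u d" using T u by (simp add: cyclic_bounded_def)
  then have "id ((T ^^ d) u) \<in> krylov T W u d"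
    by (rule krylov_map[OF _ id_isometries Ti _ u Ti W u]) (use subspace_zero[OF W] in auto)
  then have d: "(T ^^ d) u \<in> krylov T W u d" by simp
  then show "e \<le> d" unfolding e_def krylov_stop_def by (rule Least_le)
  show e: "(T ^^ e) u \<in> krylov T W u e"
    unfolding e_def krylov_stop_def
      by (rule LeastI[where P = "\<lambda>e. (T ^^ e) u \<in> krylov T W u e", OF d])
  show "(T ^^ t) u \<notin> krylov T W u t" if "t < e" for t
    using that unfolding e_def krylov_stop_def by (rule not_less_Least)
  let ?P = "\<lambda>(w, c). w \<in> W \<and> c \<in> {..<e} \<rightarrow>\<^sub>E carrier R \<and> (T ^^ e) u = krylov_comb T w c u e"
  have "\<exists>p. ?P p" using mem_krylov_comb[OF e] by auto
  then have "?P (SOME p. ?P p)" by (rule someI_ex)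
  moreover have "krylov_relation T W u = (SOME p. ?P p)"
    by (simp add: krylov_relation_def e_def Let_def)
  ultimately have "?P (krylov_relation T W u)" by simp
  then show "\<exists>w c. krylov_relation T W u = (w, c) \<and> w \<in> W \<and> c \<in> {..<e} \<rightarrow>\<^sub>E carrier R \<and> (T ^^ e) u = krylov_comb T w c u e"
    by (cases "krylov_relation T W u") auto
qed

lemma krylov_data_mem:
  assumes T: "T \<in> cyclic_bounded d" and W: "subspace W" and u: "u \<in> carrier M"
  shows "krylov_data W (T, u) \<in> krylov_data_space W d"
  using krylov_stop_props[OF assms] u T
  by (auto simp: krylov_data_def krylov_data_space_def cyclic_bounded_def)

lemma krylov_data_eq:
  assumes T: "T \<in> cyclic_bounded d" and u: "u \<in> carrier M" and T': "T' \<in> cyclic_bounded d"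
    and u': "u' \<in> carrier M"
    and W: "subspace W" and inv: "\<And>x. x \<in> W \<Longrightarrow> T x \<in> W" and agree: "\<And>x. x \<in> W \<Longrightarrow> T' x = T x"
    and eq: "krylov_data W (T, u) = krylov_data W (T', u')"
  shows "\<exists>h\<in>isometries. (\<forall>y\<in>W. h y = y) \<and> h u = u' \<and>
    (\<forall>y\<in>krylov T W u (krylov_stop T W u). h (T y) = T' (h y))"
proof -
  let ?e = "krylov_stop T W u"
  have Ti: "T \<in> isometries" and Ti': "T' \<in> isometries" using T T' by (auto simp: cyclic_bounded_def)
  have e: "krylov_stop T' W u' = ?e" and r: "krylov_relation T' W u' = krylov_relation T W u"
    and f: "restrict (B u) W = restrict (B u') W"
    and a: "(\<lambda>t\<in>{1..?e div 2}. B u ((T ^^ t) u)) = (\<lambda>t\<in>{1..?e div 2}. B u' ((T' ^^ t) u'))"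
    using eq by (auto simp: krylov_data_def)
  obtain w c where wc: "krylov_relation T W u = (w, c)" "w \<in> W" "c \<in> {..<?e} \<rightarrow>\<^sub>E carrier R"
    "(T ^^ ?e) u = krylov_comb T w c u ?e"
    using krylov_stop_props(4)[OF T W u] by blast
  have wc': "(T' ^^ ?e) u' = krylov_comb T' w c u' ?e"
    using krylov_stop_props(4)[OF T' W u'] e r wc(1) by auto
  have "B u y = B u' y" if "y \<in> W" for y using fun_cong[OF f, of y] that by simp
  moreover have "B u ((T ^^ t) u) = B u' ((T' ^^ t) u')" if "1 \<le> t" "t \<le> ?e div 2" for t
    using fun_cong[OF a, of t] that by simp
  ultimately obtain h
    where h: "h \<in> isometries" "\<forall>y\<in>W. h y = y" "\<forall>t\<le>?e. h ((T ^^ t) u) = (T' ^^ t) u'"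
    using krylov_extend_isometry[OF Ti u Ti' u' W inv agree krylov_stop_props(3)[OF T W u]
        krylov_stop_props(3)[OF T' W u', unfolded e] wc(2-4) wc'] by blast
  have "h u = u'" using h(3) by (metis funpow_0 le0)
  moreover have "h (T y) = T' (h y)" if "y \<in> krylov T W u ?e" for y
    using krylov_intertwine[OF h(1) Ti u Ti' u' subspace_subset[OF W] inv agree _ _ that] h by blast
  ultimately show ?thesis using h by blast
qed

section \<open>Counting pairs up to conjugacy\<close>

definition conjugators :: "('b \<Rightarrow> 'b) \<times> 'b list \<times> 'b set \<Rightarrow> ('b \<Rightarrow> 'b) \<Rightarrow> 'b list \<Rightarrow> ('b \<Rightarrow> 'b) set" where
  "conjugators = (\<lambda>(T0, vs0, W) T vs. {g \<in> isometries. map g vs0 = vs \<and> (\<forall>y\<in>W. g (T0 y) = T (g y))})"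

text \<open>A configuration stands for a conjugacy class of an isometry with a list of vectors. Only
  the action of \<open>T0\<close> on the invariant subspace \<open>W\<close> counts, which is why
  \<open>conjugators\<close> asks for intertwining on \<open>W\<close> alone.\<close>

definition configurations :: "nat \<Rightarrow> (('b \<Rightarrow> 'b) \<times> 'b list \<times> 'b set) set" where
  "configurations m = {(T0, vs0, W). T0 \<in> isometries \<and> subspace W \<and> (\<forall>w\<in>W. T0 w \<in> W) \<and> set vs0 \<subseteq> W \<and> card W \<le> m}"

text \<open>The map \<open>(T, vs) \<mapsto> T \<circ> g\<close>, with \<open>g\<close> conjugating the configuration to \<open>(T, vs)\<close>, is injective:
  on \<open>W\<close> it equals \<open>g \<circ> T0\<close> and \<open>T0\<close> permutes \<open>W\<close>, so it determines \<open>g\<close> on \<open>W\<close>; and \<open>g\<close> can be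
  chosen as a function of its restriction to \<open>W\<close>.\<close>

lemma card_conjugate_le:
  assumes "r \<in> configurations m"
  shows "card {(T, vs). T \<in> isometries \<and> conjugators r T vs \<noteq> {}} \<le> card isometries"
proof -
  obtain T0 vs0 W where r: "r = (T0, vs0, W)" and T0: "T0 \<in> isometries" and W: "subspace W"
    and inv: "\<And>w. w \<in> W \<Longrightarrow> T0 w \<in> W" and vs0: "set vs0 \<subseteq> W"
    using assms by (auto simp: configurations_def)
  have WM: "W \<subseteq> carrier M" using W by (rule subspace_subset)
  let ?X = "{(T, vs). T \<in> isometries \<and> conjugators r T vs \<noteq> {}}"
  define g0 where "g0 = (\<lambda>(T, vs). SOME g. g \<in> conjugators r T vs)"
  define ext where "ext = (\<lambda>\<phi>. SOME g. g \<in> isometries \<and> restrict g W = \<phi>)"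
  define g where "g = (\<lambda>p. ext (restrict (g0 p) W))"
  have g: "g p \<in> isometries" "\<And>y. y \<in> W \<Longrightarrow> g p y = g0 p y" "g0 p \<in> conjugators r (fst p) (snd p)" if "p \<in> ?X" for p
  proof -
    obtain T vs where p: "p = (T, vs)" by (cases p)
    show c: "g0 p \<in> conjugators r (fst p) (snd p)"
      using that p some_in_eq[of "conjugators r T vs"] by (auto simp: g0_def)
    then have "g0 p \<in> isometries" by (simp add: conjugators_def r)
    from conjI[OF this refl] have *: "g p \<in> isometries \<and> restrict (g p) W = restrict (g0 p) W"
      unfolding g_def ext_def
        by (rule someI[where P = "\<lambda>g. g \<in> isometries \<and> restrict g W = restrict (g0 p) W"])
    then show "g p \<in> isometries" by simp
    show "g p y = g0 p y" if "y \<in> W" for y using fun_cong[of _ _ y, OF conjunct2[OF *]] that by simp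
  qed
  have g': "map (g p) vs0 = snd p" "\<And>y. y \<in> W \<Longrightarrow> g p (T0 y) = fst p (g p y)" if "p \<in> ?X" for p
  proof -
    have "map (g p) vs0 = map (g0 p) vs0" using g(2)[OF that] vs0 by (auto intro!: map_cong)
    also have "\<dots> = snd p" using g(3)[OF that] by (simp add: conjugators_def r)
    finally show "map (g p) vs0 = snd p" .
    show "g p (T0 y) = fst p (g p y)" if "y \<in> W" for y
      using g(2,3)[OF \<open>p \<in> ?X\<close>] that inv by (simp add: conjugators_def r)
  qed
  have "inj_on (\<lambda>p. fst p \<circ> g p) ?X"
  proof (rule inj_onI)
    fix p p' assume p: "p \<in> ?X" "p' \<in> ?X" and eq: "fst p \<circ> g p = fst p' \<circ> g p'"
    have "g p x = g p' x" if "x \<in> W" for x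
    proof -
      obtain y where y: "y \<in> W" "T0 y = x"
        using funpow_onto_invariant[OF T0 WM inv \<open>x \<in> W\<close>, of 1] by auto
      show ?thesis using g'(2)[OF p(1) y(1)] g'(2)[OF p(2) y(1)] fun_cong[OF eq, of y] y by simp
    qed
    then have "restrict (g0 p) W = restrict (g0 p') W" using g(2)[OF p(1)] g(2)[OF p(2)]
      by (intro restrict_ext) simp
    then have gg: "g p = g p'" by (simp add: g_def)
    then have "snd p = snd p'" using g'(1)[OF p(1)] g'(1)[OF p(2)] by simp
    moreover have "fst p = fst p'"
    proof
      fix x
      show "fst p x = fst p' x"
        using fun_cong[OF eq, of "inv_into UNIV (g p) x"] g(1)[OF p(1)] gg by simp
    qed
    ultimately show "p = p'" by (simp add: prod_eq_iff)
  qed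
  moreover have "(\<lambda>p. fst p \<circ> g p) ` ?X \<subseteq> isometries"
    using g(1) by (auto intro!: isometries_comp)
  ultimately show ?thesis using finite_isometries by (rule card_inj_on_le)
qed

text \<open>Induction on \<open>k\<close>. Over a configuration with
  \<open>|W| \<le> q^(k d)\<close> a new vector allows at most
  \<open>2 |W|^2 q^(d + d div 2)\<close> values of \<open>krylov_data\<close>, which gives the
  factor for \<open>i = k\<close>; one extension is kept for each value that occurs. The bound on
  \<open>|W|\<close> is carried along for this estimate.\<close>

lemma ex_representatives:
  fixes d :: nat
  defines "q \<equiv> card (carrier R)"
  shows "\<exists>S. finite S \<and> card S \<le> (\<Prod>i<k. 2 * q ^ (2 * i * d + d + d div 2)) \<and>
    S \<subseteq> configurations (q ^ (k * d)) \<and>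
    (\<forall>T\<in>cyclic_bounded d. \<forall>vs. set vs \<subseteq> carrier M \<and> length vs = k \<longrightarrow> (\<exists>r\<in>S. conjugators r T vs \<noteq> {}))"
proof (induction k)
  case 0
  have "subspace {\<zero>\<^bsub>M\<^esub>}" by (rule subspaceI) auto
  then have "{(id, [], {\<zero>\<^bsub>M\<^esub>})} \<subseteq> configurations (q ^ (0 * d))"
    by (auto simp: configurations_def id_isometries)
  moreover have "id \<in> conjugators (id, [], {\<zero>\<^bsub>M\<^esub>}) T []" if "T \<in> cyclic_bounded d" for T
    using that id_isometries by (auto simp: conjugators_def cyclic_bounded_def isometries_zero)
  ultimately show ?case
    by (intro exI[of _ "{(id, [], {\<zero>\<^bsub>M\<^esub>})}"]) (auto simp del: id_apply)
next
  case (Suc k)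
  then obtain S where S: "finite S" "card S \<le> (\<Prod>i<k. 2 * q ^ (2 * i * d + d + d div 2))"
    "S \<subseteq> configurations (q ^ (k * d))"
    "\<And>T vs. \<lbrakk>T \<in> cyclic_bounded d; set vs \<subseteq> carrier M; length vs = k\<rbrakk> \<Longrightarrow> \<exists>r\<in>S. conjugators r T vs \<noteq> {}"
    by blast
  \<comment> \<open>The candidates for extending a representative: \<open>T\<close> is prescribed on
    \<open>W\<close> only, and the new vector is arbitrary.\<close>
  define Y where "Y = (\<lambda>(T0, vs0 :: 'b list, W). {(T, u). T \<in> cyclic_bounded d \<and> u \<in> carrier M \<and> (\<forall>w\<in>W. T w = T0 w)})"
  let ?b = "2 * q ^ (2 * k * d + d + d div 2)"
  have "\<exists>Z. Z \<subseteq> Y r \<and> finite Z \<and> card Z \<le> ?b \<and> (\<forall>x\<in>Y r. \<exists>y\<in>Z. krylov_data (snd (snd r)) y = krylov_data (snd (snd r)) x)"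
    if "r \<in> S" for r
  proof -
    obtain T0 vs0 W where r: "r = (T0, vs0, W)" by (cases r)
    have W: "subspace W" "card W \<le> q ^ (k * d)" using that S(3) r by (auto simp: configurations_def)
    have "krylov_data W ` Y r \<subseteq> krylov_data_space W d"
      using krylov_data_mem[OF _ W(1)] by (auto simp: Y_def r)
    then obtain Z where Z: "Z \<subseteq> Y r" "finite Z" "card Z \<le> card (krylov_data_space W d)"
      "\<And>x. x \<in> Y r \<Longrightarrow> \<exists>y\<in>Z. krylov_data W y = krylov_data W x"
      using finite_representatives[OF _ krylov_data_space_card(1)[OF W(1)]] by metis
    have "card (krylov_data_space W d) \<le> 2 * (card W)\<^sup>2 * q ^ (d + d div 2)"
      using krylov_data_space_card(2)[OF W(1)] by (simp add: q_def)
    also have "\<dots> \<le> 2 * (q ^ (k * d))\<^sup>2 * q ^ (d + d div 2)"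
      using W(2) by (intro mult_right_mono mult_left_mono power_mono) auto
    also have "\<dots> = ?b" by (simp add: power_add[symmetric] power_mult[symmetric] algebra_simps)
    finally show ?thesis using Z r by (intro exI[of _ Z]) auto
  qed
  then obtain Z
    where Z: "\<And>r. r \<in> S \<Longrightarrow> Z r \<subseteq> Y r" "\<And>r. r \<in> S \<Longrightarrow> finite (Z r)" "\<And>r. r \<in> S \<Longrightarrow> card (Z r) \<le> ?b"
    "\<And>r x. \<lbrakk>r \<in> S; x \<in> Y r\<rbrakk> \<Longrightarrow> \<exists>y\<in>Z r. krylov_data (snd (snd r)) y = krylov_data (snd (snd r)) x"
    by metis
  define new
    where "new = (\<lambda>((T0 :: 'b \<Rightarrow> 'b, vs0, W), T, u). (T, u # vs0, krylov T W u (krylov_stop T W u)))"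
  let ?S' = "new ` (SIGMA r:S. Z r)"
  have fin: "finite (SIGMA r:S. Z r)" using S(1) Z(2) by (rule finite_SigmaI)
  have "card ?S' \<le> card (SIGMA r:S. Z r)" using fin by (rule card_image_le)
  also have "\<dots> = (\<Sum>r\<in>S. card (Z r))" using S(1) Z(2) by (intro card_SigmaI) auto
  also have "\<dots> \<le> card S * ?b" using sum_mono[of S "\<lambda>r. card (Z r)" "\<lambda>_. ?b"] Z(3) by simp
  also have "\<dots> \<le> (\<Prod>i<k. 2 * q ^ (2 * i * d + d + d div 2)) * ?b" using S(2)
    by (rule mult_right_mono) simp
  finally have card: "card ?S' \<le> (\<Prod>i<Suc k. 2 * q ^ (2 * i * d + d + d div 2))" by simp
  have conf: "?S' \<subseteq> configurations (q ^ (Suc k * d))"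
  proof
    fix s assume "s \<in> ?S'"
    then obtain T0 vs0 W T u where s: "s = (T, u # vs0, krylov T W u (krylov_stop T W u))"
      "(T0, vs0, W) \<in> S" "(T, u) \<in> Z (T0, vs0, W)" by (auto simp: new_def)
    let ?e = "krylov_stop T W u"
    have W: "subspace W" "card W \<le> q ^ (k * d)" "set vs0 \<subseteq> W" and inv0: "\<And>w. w \<in> W \<Longrightarrow> T0 w \<in> W"
      using S(3) s(2) by (auto simp: configurations_def)
    have T: "T \<in> cyclic_bounded d" and u: "u \<in> carrier M" and agree: "\<And>w. w \<in> W \<Longrightarrow> T w = T0 w"
      using Z(1)[OF s(2)] s(3) by (auto simp: Y_def)
    have inv: "T w \<in> W" if "w \<in> W" for w using inv0 agree that by simp
    have Ti: "T \<in> isometries" using T by (simp add: cyclic_bounded_def)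
    note e = krylov_stop_props[OF T W(1) u]
    have "u \<in> krylov T W u ?e"
      using e(2) funpow_mem_krylov[OF Ti W(1) u, of 0 ?e] by (cases "?e = 0") auto
    moreover have "W \<subseteq> krylov T W u ?e" using krylov_mono[OF Ti subspace_subset[OF W(1)] u, of 0 ?e]
      by simp
    moreover have "card (krylov T W u ?e) \<le> q ^ (Suc k * d)"
    proof -
      have "card (krylov T W u ?e) \<le> card W * q ^ ?e"
        using card_krylov_le[OF Ti subspace_subset[OF W(1)]] by (simp add: q_def)
      also have "\<dots> \<le> q ^ (k * d) * q ^ d"
        using W(2) e(1) card_scalars_ge_2 by (intro mult_mono power_increasing) (auto simp: q_def)
      finally show ?thesis by (simp add: power_add[symmetric] add.commute)
    qed
    ultimately show "s \<in> configurations (q ^ (Suc k * d))"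
      using Ti W(3) subspace_krylov[OF Ti W(1) u] krylov_invariant[OF Ti W(1) u inv e(2)]
      by (auto simp: configurations_def s(1))
  qed
  have "\<exists>r\<in>?S'. conjugators r T vs \<noteq> {}" if T: "T \<in> cyclic_bounded d"
    and vs: "set vs \<subseteq> carrier M" "length vs = Suc k" for T vs
  proof -
    obtain u us where us: "vs = u # us" using vs by (cases vs) auto
    then have u: "u \<in> carrier M" and usM: "set us \<subseteq> carrier M" "length us = k" using vs by auto
    obtain r where rS: "r \<in> S" "conjugators r T us \<noteq> {}" using S(4)[OF T usM] by blast
    obtain T0 vs0 W where r: "r = (T0, vs0, W)" by (cases r)
    obtain g where g: "g \<in> isometries" "map g vs0 = us" "\<And>y. y \<in> W \<Longrightarrow> g (T0 y) = T (g y)"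
      using rS r by (auto simp: conjugators_def)
    have W: "subspace W" "set vs0 \<subseteq> W" and inv0: "\<And>w. w \<in> W \<Longrightarrow> T0 w \<in> W"
      using S(3) rS(1) r by (auto simp: configurations_def)
    \<comment> \<open>Conjugation by \<open>g\<close> turns \<open>T\<close> into an isometry that
      agrees with \<open>T0\<close> on \<open>W\<close>, hence yields a candidate in
      \<open>Y r\<close>. The stored candidate with the same data is carried to it by an isometry
      \<open>h\<close> that fixes \<open>W\<close>, and \<open>g \<circ> h\<close> is the conjugator
      sought.\<close>
    let ?h = "inv_into UNIV g"
    let ?T' = "?h \<circ> T \<circ> g" and ?u' = "?h u"
    have T': "?T' \<in> cyclic_bounded d" using T g(1) by (rule cyclic_bounded_conj)
    have u': "?u' \<in> carrier M" using u isometries_inv[OF g(1)] by simp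
    have agree': "?T' w = T0 w" if "w \<in> W" for w using g(3)[OF that, symmetric] g(1) by simp
    have "(?T', ?u') \<in> Y r" using T' u' agree' by (auto simp: Y_def r)
    then obtain T1 u1 where z: "(T1, u1) \<in> Z r" "krylov_data W (T1, u1) = krylov_data W (?T', ?u')"
      using Z(4)[OF rS(1)] r by fastforce
    have T1: "T1 \<in> cyclic_bounded d" "u1 \<in> carrier M" "\<And>w. w \<in> W \<Longrightarrow> T1 w = T0 w"
      using Z(1)[OF rS(1)] z(1) by (auto simp: Y_def r)
    obtain h where h: "h \<in> isometries" "\<And>y. y \<in> W \<Longrightarrow> h y = y" "h u1 = ?u'"
      "\<And>y. y \<in> krylov T1 W u1 (krylov_stop T1 W u1) \<Longrightarrow> h (T1 y) = ?T' (h y)"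
      using krylov_data_eq[OF T1(1,2) T' u' W(1) _ _ z(2)] T1(3) agree' inv0 by (smt (verit))
    have "g \<circ> h \<in> conjugators (new (r, T1, u1)) T vs"
    proof -
      have "map (g \<circ> h) vs0 = us" using g(2) h(2) W(2) by (auto simp: subset_iff cong: map_cong)
      moreover have "g (h (T1 y)) = T (g (h y))" if "y \<in> krylov T1 W u1 (krylov_stop T1 W u1)" for y
        using h(4)[OF that] g(1) by simp
      ultimately show ?thesis
        using isometries_comp[OF g(1) h(1)] h(3) g(1) by (simp add: conjugators_def new_def r us)
    qed
    then show ?thesis using rS(1) z(1) by blast
  qed
  then show ?case using fin card conf by (intro exI[of _ ?S']) blast
qed

text \<open>Each pair of a \<open>T\<close> in \<open>cyclic_bounded d\<close> and a list of
  \<open>k\<close> vectors is conjugate to a representative, and \<open>card_conjugate_le\<close>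
  bounds how many pairs one representative accounts for.\<close>

theorem card_cyclic_bounded_le:
  fixes d k :: nat
  defines "q \<equiv> card (carrier R)"
  shows "card (cyclic_bounded d) * card (carrier M) ^ k
    \<le> (\<Prod>i<k. 2 * q ^ (2 * i * d + d + d div 2)) * card isometries"
proof -
  from ex_representatives[of d k, folded q_def] obtain S
    where S: "finite S" "card S \<le> (\<Prod>i<k. 2 * q ^ (2 * i * d + d + d div 2))"
    "S \<subseteq> configurations (q ^ (k * d))"
    "\<forall>T\<in>cyclic_bounded d. \<forall>vs. set vs \<subseteq> carrier M \<and> length vs = k \<longrightarrow> (\<exists>r\<in>S. conjugators r T vs \<noteq> {})"
    by (elim exE conjE)
  let ?L = "{vs. set vs \<subseteq> carrier M \<and> length vs = k}"
  let ?X = "\<lambda>r. {(T, vs). T \<in> isometries \<and> conjugators r T vs \<noteq> {}}"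
  \<comment> \<open>\<open>card\<close> is 0 on infinite sets, so the union must be known to be
    finite before it can bound the number of pairs.\<close>
  have finX: "finite (?X r)" if "r \<in> S" for r
  proof -
    obtain T0 vs0 W where r: "r = (T0, vs0, W)" by (cases r)
    have "?X r \<subseteq> isometries \<times> (\<lambda>g. map g vs0) ` isometries" by (auto simp: conjugators_def r)
    then show ?thesis using finite_isometries by (meson finite_SigmaI finite_imageI finite_subset)
  qed
  have "cyclic_bounded d \<times> ?L \<subseteq> (\<Union>r\<in>S. ?X r)"
    using S(4) by (auto simp: cyclic_bounded_def)
  then have "card (cyclic_bounded d \<times> ?L) \<le> card (\<Union>r\<in>S. ?X r)"
    using S(1) finX by (intro card_mono) auto
  also have "\<dots> \<le> (\<Sum>r\<in>S. card (?X r))" using S(1) by (rule card_UN_le)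
  also have "\<dots> \<le> (\<Sum>r\<in>S. card isometries)" using S(3) card_conjugate_le by (intro sum_mono) blast
  also have "\<dots> \<le> (\<Prod>i<k. 2 * q ^ (2 * i * d + d + d div 2)) * card isometries"
    using S(2) by (simp add: mult_right_mono)
  finally show ?thesis using card_lists_length_eq[OF finite_vectors]
    by (simp add: card_cartesian_product)
qed

end

subsection \<open>Coordinate vectors and matrices\<close>

definition coord_space :: "('a, 'r) ring_scheme \<Rightarrow> nat \<Rightarrow> ('a, nat \<Rightarrow> 'a) module" where
  \<comment> \<open>The fields \<open>mult\<close> and \<open>one\<close> of a module record are irrelevant.\<close>
  "coord_space R N = \<lparr>
     carrier = {..<N} \<rightarrow>\<^sub>E carrier R,
     monoid.mult = (\<lambda>x y. x),
     one = (\<lambda>i\<in>{..<N}. \<zero>\<^bsub>R\<^esub>),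
     zero = (\<lambda>i\<in>{..<N}. \<zero>\<^bsub>R\<^esub>),
     add = (\<lambda>x y. \<lambda>i\<in>{..<N}. x i \<oplus>\<^bsub>R\<^esub> y i),
     module.smult = (\<lambda>a x. \<lambda>i\<in>{..<N}. a \<otimes>\<^bsub>R\<^esub> x i)\<rparr>"

definition unit_coord :: "('a, 'r) ring_scheme \<Rightarrow> nat \<Rightarrow> nat \<Rightarrow> nat \<Rightarrow> 'a" where
  "unit_coord R N j = (\<lambda>i\<in>{..<N}. if i = j then \<one>\<^bsub>R\<^esub> else \<zero>\<^bsub>R\<^esub>)"

definition mat_act :: "('a, 'r) ring_scheme \<Rightarrow> nat \<Rightarrow> 'a mat \<Rightarrow> (nat \<Rightarrow> 'a) \<Rightarrow> nat \<Rightarrow> 'a" where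
  "mat_act R N A x = (\<lambda>i\<in>{..<N}. \<Oplus>\<^bsub>R\<^esub>k\<in>{..<N}. A $$ (i, k) \<otimes>\<^bsub>R\<^esub> x k)"

definition mat_of :: "('a, 'r) ring_scheme \<Rightarrow> nat \<Rightarrow> ((nat \<Rightarrow> 'a) \<Rightarrow> nat \<Rightarrow> 'a) \<Rightarrow> 'a mat" where
  "mat_of R N f = mat N N (\<lambda>(i, j). f (unit_coord R N j) i)"

lemma (in abelian_monoid) finsum_eq_single:
  assumes "finite A" "i \<in> A" "f i \<in> carrier G" "\<And>j. \<lbrakk>j \<in> A; j \<noteq> i\<rbrakk> \<Longrightarrow> f j = \<zero>"
  shows "finsum G f A = f i"
proof -
  have "finsum G f A = finsum G f (insert i (A - {i}))" using assms(2) by (simp add: insert_absorb)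
  also have "\<dots> = f i \<oplus> finsum G f (A - {i})" using assms by (intro finsum_insert) auto
  also have "finsum G f (A - {i}) = \<zero>" using assms by (intro add.finprod_one_eqI) auto
  finally show ?thesis using assms by simp
qed

lemma (in abelian_monoid) finsum_swap:
  assumes "finite A" "finite C" "\<And>i j. \<lbrakk>i \<in> A; j \<in> C\<rbrakk> \<Longrightarrow> f i j \<in> carrier G"
  shows "(\<Oplus>i\<in>A. \<Oplus>j\<in>C. f i j) = (\<Oplus>j\<in>C. \<Oplus>i\<in>A. f i j)"
  using assms(1,3)
proof (induction A rule: finite_induct)
  case empty
  then show ?case by simp
next
  case (insert a A)
  have cl: "f a \<in> C \<rightarrow> carrier G" "(\<lambda>j. \<Oplus>i\<in>A. f i j) \<in> C \<rightarrow> carrier G"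
    using insert.prems by (auto intro!: finsum_closed)
  have "(\<Oplus>j\<in>C. \<Oplus>i\<in>insert a A. f i j) = (\<Oplus>j\<in>C. f a j \<oplus> (\<Oplus>i\<in>A. f i j))"
    by (intro finsum_cong') (use insert in \<open>auto intro!: finsum_closed\<close>)
  also have "\<dots> = (\<Oplus>j\<in>C. f a j) \<oplus> (\<Oplus>j\<in>C. \<Oplus>i\<in>A. f i j)"
    using cl by (rule finsum_addf)
  finally have "(\<Oplus>j\<in>C. \<Oplus>i\<in>insert a A. f i j) = (\<Oplus>j\<in>C. f a j) \<oplus> (\<Oplus>i\<in>A. \<Oplus>j\<in>C. f i j)"
    using insert by simp
  moreover have "(\<Oplus>i\<in>insert a A. \<Oplus>j\<in>C. f i j) = (\<Oplus>j\<in>C. f a j) \<oplus> (\<Oplus>i\<in>A. \<Oplus>j\<in>C. f i j)"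
    using insert.hyps insert.prems by (intro finsum_insert) (auto intro!: finsum_closed)
  ultimately show ?case by simp
qed

lemma matrix_ring_carrier:
  "A \<in> carrier (matrix_ring R N) \<longleftrightarrow> A \<in> carrier_mat N N \<and> (\<forall>i<N. \<forall>j<N. A $$ (i, j) \<in> carrier R)"
  unfolding matrix_ring_def by (auto dest!: elements_matD)

lemma matrix_ring_carrierD:
  assumes "A \<in> carrier (matrix_ring R N)"
  shows "dim_row A = N" "dim_col A = N" "\<And>i j. \<lbrakk>i < N; j < N\<rbrakk> \<Longrightarrow> A $$ (i, j) \<in> carrier R"
  using assms by (auto simp: matrix_ring_carrier)

lemma coord_space_simps:
  "x \<in> carrier (coord_space R N) \<longleftrightarrow> x \<in> {..<N} \<rightarrow>\<^sub>E carrier R"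
  "x \<oplus>\<^bsub>coord_space R N\<^esub> y = (\<lambda>i\<in>{..<N}. x i \<oplus>\<^bsub>R\<^esub> y i)"
  "a \<odot>\<^bsub>coord_space R N\<^esub> x = (\<lambda>i\<in>{..<N}. a \<otimes>\<^bsub>R\<^esub> x i)"
  "\<zero>\<^bsub>coord_space R N\<^esub> = (\<lambda>i\<in>{..<N}. \<zero>\<^bsub>R\<^esub>)"
  by (simp_all add: coord_space_def)

lemma coord_eqI:
  assumes "x \<in> carrier (coord_space R N)" "y \<in> carrier (coord_space R N)" "\<And>i. i < N \<Longrightarrow> x i = y i"
  shows "x = y"
  using assms by (auto simp: coord_space_simps intro: PiE_ext)

lemma card_coord_space: "card (carrier (coord_space R N)) = card (carrier R) ^ N"
  by (simp add: coord_space_def card_PiE)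

context cring
begin

lemma coord_closed: "\<lbrakk>x \<in> carrier (coord_space R N); i < N\<rbrakk> \<Longrightarrow> x i \<in> carrier R"
  by (auto simp: coord_space_simps)

lemma coord_space_module: "Module.module R (coord_space R N)"
proof (rule moduleI)
  show "cring R" by (rule is_cring)
  show "abelian_group (coord_space R N)"
  proof (rule abelian_groupI)
    fix x assume x: "x \<in> carrier (coord_space R N)"
    then have "(\<lambda>i\<in>{..<N}. \<ominus> x i) \<in> carrier (coord_space R N)"
      "(\<lambda>i\<in>{..<N}. \<ominus> x i) \<oplus>\<^bsub>coord_space R N\<^esub> x = \<zero>\<^bsub>coord_space R N\<^esub>"
      by (auto simp: coord_space_simps PiE_iff l_neg intro!: restrict_ext)
    then show "\<exists>y\<in>carrier (coord_space R N). y \<oplus>\<^bsub>coord_space R N\<^esub> x = \<zero>\<^bsub>coord_space R N\<^esub>" by blast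
    show "\<zero>\<^bsub>coord_space R N\<^esub> \<oplus>\<^bsub>coord_space R N\<^esub> x = x"
      using x by (intro coord_eqI) (auto simp: coord_space_simps PiE_iff)
  next
    fix x y z assume "x \<in> carrier (coord_space R N)" "y \<in> carrier (coord_space R N)" "z \<in> carrier (coord_space R N)"
    then show "x \<oplus>\<^bsub>coord_space R N\<^esub> y \<oplus>\<^bsub>coord_space R N\<^esub> z = x \<oplus>\<^bsub>coord_space R N\<^esub> (y \<oplus>\<^bsub>coord_space R N\<^esub> z)"
      by (auto simp: coord_space_simps PiE_iff a_assoc intro!: restrict_ext)
  next
    fix x y assume "x \<in> carrier (coord_space R N)" "y \<in> carrier (coord_space R N)"
    then show "x \<oplus>\<^bsub>coord_space R N\<^esub> y = y \<oplus>\<^bsub>coord_space R N\<^esub> x"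
      by (auto simp: coord_space_simps PiE_iff a_comm intro!: restrict_ext)
  qed (auto simp: coord_space_simps PiE_iff)
  fix a x assume ax: "a \<in> carrier R" "x \<in> carrier (coord_space R N)"
  fix b assume b: "b \<in> carrier R"
  show "(a \<oplus> b) \<odot>\<^bsub>coord_space R N\<^esub> x = a \<odot>\<^bsub>coord_space R N\<^esub> x \<oplus>\<^bsub>coord_space R N\<^esub> b \<odot>\<^bsub>coord_space R N\<^esub> x"
    using ax b by (auto simp: coord_space_simps PiE_iff l_distr intro!: restrict_ext)
  show "(a \<otimes> b) \<odot>\<^bsub>coord_space R N\<^esub> x = a \<odot>\<^bsub>coord_space R N\<^esub> (b \<odot>\<^bsub>coord_space R N\<^esub> x)"
    using ax b by (auto simp: coord_space_simps PiE_iff m_assoc intro!: restrict_ext)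
next
  fix a x y assume "a \<in> carrier R" "x \<in> carrier (coord_space R N)" "y \<in> carrier (coord_space R N)"
  then show "a \<odot>\<^bsub>coord_space R N\<^esub> (x \<oplus>\<^bsub>coord_space R N\<^esub> y)
      = a \<odot>\<^bsub>coord_space R N\<^esub> x \<oplus>\<^bsub>coord_space R N\<^esub> a \<odot>\<^bsub>coord_space R N\<^esub> y"
    by (auto simp: coord_space_simps PiE_iff r_distr intro!: restrict_ext)
next
  fix x assume x: "x \<in> carrier (coord_space R N)"
  then show "\<one> \<odot>\<^bsub>coord_space R N\<^esub> x = x"
    by (intro coord_eqI) (auto simp: coord_space_simps PiE_iff)
qed (auto simp: coord_space_simps PiE_iff)

lemma unit_coord_closed: "unit_coord R N j \<in> carrier (coord_space R N)"
  by (auto simp: unit_coord_def coord_space_simps)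

text \<open>The coordinates of \<open>x\<close> are filled in one at a time, through vectors that
  agree with \<open>x\<close> below \<open>m\<close> and vanish from \<open>m\<close> on.\<close>

lemma coord_space_induct [consumes 1, case_names zero step]:
  assumes x: "x \<in> carrier (coord_space R N)" and zero: "P \<zero>\<^bsub>coord_space R N\<^esub>"
    and step: "\<And>y c j. \<lbrakk>y \<in> carrier (coord_space R N); P y; c \<in> carrier R; j < N\<rbrakk> \<Longrightarrow>
      P (y \<oplus>\<^bsub>coord_space R N\<^esub> c \<odot>\<^bsub>coord_space R N\<^esub> unit_coord R N j)"
  shows "P x"
proof -
  let ?t = "\<lambda>m. \<lambda>i\<in>{..<N}. if i < m then x i else \<zero>"
  have t: "?t m \<in> carrier (coord_space R N)" for m using x by (auto simp: coord_space_simps PiE_iff)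
  have "P (?t m)" if "m \<le> N" for m
    using that
  proof (induction m)
    case 0
    have "?t 0 = \<zero>\<^bsub>coord_space R N\<^esub>" by (auto simp: coord_space_simps)
    then show ?case using zero by simp
  next
    case (Suc m)
    have "?t (Suc m) = ?t m \<oplus>\<^bsub>coord_space R N\<^esub> x m \<odot>\<^bsub>coord_space R N\<^esub> unit_coord R N m"
      using x Suc.prems
        by (auto simp: coord_space_simps unit_coord_def PiE_iff less_Suc_eq intro!: restrict_ext)
    moreover have m: "m < N" using Suc.prems by simp
    moreover have "P (?t m)" using m by (intro Suc.IH less_imp_le)
    ultimately show ?case using step[OF t[of m] _ coord_closed[OF x m] m] by metis
  qed
  moreover have "?t N = x" using x by (intro coord_eqI[OF t]) auto
  ultimately show ?thesis by (metis order_refl)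
qed

lemma linear_eq:
  assumes fc: "\<And>x. x \<in> carrier (coord_space R N) \<Longrightarrow> f x \<in> carrier (coord_space R N)"
    and fa: "\<And>x y. \<lbrakk>x \<in> carrier (coord_space R N); y \<in> carrier (coord_space R N)\<rbrakk> \<Longrightarrow>
      f (x \<oplus>\<^bsub>coord_space R N\<^esub> y) = f x \<oplus>\<^bsub>coord_space R N\<^esub> f y"
    and fs: "\<And>a x. \<lbrakk>a \<in> carrier R; x \<in> carrier (coord_space R N)\<rbrakk> \<Longrightarrow>
      f (a \<odot>\<^bsub>coord_space R N\<^esub> x) = a \<odot>\<^bsub>coord_space R N\<^esub> f x"
    and ga: "\<And>x y. \<lbrakk>x \<in> carrier (coord_space R N); y \<in> carrier (coord_space R N)\<rbrakk> \<Longrightarrow>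
      g (x \<oplus>\<^bsub>coord_space R N\<^esub> y) = g x \<oplus>\<^bsub>coord_space R N\<^esub> g y"
    and gs: "\<And>a x. \<lbrakk>a \<in> carrier R; x \<in> carrier (coord_space R N)\<rbrakk> \<Longrightarrow>
      g (a \<odot>\<^bsub>coord_space R N\<^esub> x) = a \<odot>\<^bsub>coord_space R N\<^esub> g x"
    and gc: "\<And>x. x \<in> carrier (coord_space R N) \<Longrightarrow> g x \<in> carrier (coord_space R N)"
    and eq: "\<And>j. j < N \<Longrightarrow> f (unit_coord R N j) = g (unit_coord R N j)"
    and x: "x \<in> carrier (coord_space R N)"
  shows "f x = g x"
proof -
  interpret V: Module.module R "coord_space R N" by (rule coord_space_module)
  show ?thesis using x
  proof (induction rule: coord_space_induct)
    case zero
    have "\<zero>\<^bsub>coord_space R N\<^esub> = \<zero> \<odot>\<^bsub>coord_space R N\<^esub> \<zero>\<^bsub>coord_space R N\<^esub>" by simp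
    then have "f \<zero>\<^bsub>coord_space R N\<^esub> = \<zero>\<^bsub>coord_space R N\<^esub>" "g \<zero>\<^bsub>coord_space R N\<^esub> = \<zero>\<^bsub>coord_space R N\<^esub>"
      using fs[of \<zero> "\<zero>\<^bsub>coord_space R N\<^esub>"] gs[of \<zero> "\<zero>\<^bsub>coord_space R N\<^esub>"] fc gc
      by (metis V.smult_l_null V.zero_closed zero_closed)+
    then show ?case by simp
  next
    case (step y c j)
    then show ?case using fa ga fs gs eq unit_coord_closed by (simp add: unit_coord_closed)
  qed
qed

section \<open>Matrices acting on coordinate vectors\<close>

lemma mat_act_closed:
  "\<lbrakk>A \<in> carrier (matrix_ring R N); x \<in> carrier (coord_space R N)\<rbrakk> \<Longrightarrow> mat_act R N A x \<in> carrier (coord_space R N)"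
  by (auto simp: mat_act_def coord_space_simps PiE_iff matrix_ring_carrierD intro!: finsum_closed)

lemma mat_act_add:
  assumes A: "A \<in> carrier (matrix_ring R N)" and x: "x \<in> carrier (coord_space R N)"
    and y: "y \<in> carrier (coord_space R N)"
  shows "mat_act R N A (x \<oplus>\<^bsub>coord_space R N\<^esub> y) = mat_act R N A x \<oplus>\<^bsub>coord_space R N\<^esub> mat_act R N A y"
proof -
  have "(\<Oplus>k\<in>{..<N}. A $$ (i, k) \<otimes> (x k \<oplus> y k)) = (\<Oplus>k\<in>{..<N}. A $$ (i, k) \<otimes> x k) \<oplus> (\<Oplus>k\<in>{..<N}. A $$ (i, k) \<otimes> y k)"
    if "i < N" for i
  proof -
    have "(\<Oplus>k\<in>{..<N}. A $$ (i, k) \<otimes> (x k \<oplus> y k)) = (\<Oplus>k\<in>{..<N}. A $$ (i, k) \<otimes> x k \<oplus> A $$ (i, k) \<otimes> y k)"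
      using that matrix_ring_carrierD(3)[OF A] coord_closed[OF x] coord_closed[OF y]
      by (intro finsum_cong') (auto simp: r_distr)
    also have "\<dots> = (\<Oplus>k\<in>{..<N}. A $$ (i, k) \<otimes> x k) \<oplus> (\<Oplus>k\<in>{..<N}. A $$ (i, k) \<otimes> y k)"
      using that matrix_ring_carrierD(3)[OF A] coord_closed[OF x] coord_closed[OF y]
        by (intro finsum_addf) auto
    finally show ?thesis .
  qed
  moreover have "(\<Oplus>k\<in>{..<N}. A $$ (i, k) \<otimes> (\<lambda>i\<in>{..<N}. x i \<oplus> y i) k) = (\<Oplus>k\<in>{..<N}. A $$ (i, k) \<otimes> (x k \<oplus> y k))" if "i < N" for i
    using that matrix_ring_carrierD(3)[OF A] coord_closed[OF x] coord_closed[OF y]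
      by (intro finsum_cong') auto
  ultimately show ?thesis by (auto simp: mat_act_def coord_space_simps intro!: restrict_ext)
qed

lemma mat_act_smult:
  assumes A: "A \<in> carrier (matrix_ring R N)" and a: "a \<in> carrier R"
    and x: "x \<in> carrier (coord_space R N)"
  shows "mat_act R N A (a \<odot>\<^bsub>coord_space R N\<^esub> x) = a \<odot>\<^bsub>coord_space R N\<^esub> mat_act R N A x"
proof -
  have "(\<Oplus>k\<in>{..<N}. A $$ (i, k) \<otimes> (\<lambda>i\<in>{..<N}. a \<otimes> x i) k) = a \<otimes> (\<Oplus>k\<in>{..<N}. A $$ (i, k) \<otimes> x k)" if "i < N" for i
  proof -
    have "a \<otimes> (\<Oplus>k\<in>{..<N}. A $$ (i, k) \<otimes> x k) = (\<Oplus>k\<in>{..<N}. a \<otimes> (A $$ (i, k) \<otimes> x k))"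
      using that a matrix_ring_carrierD(3)[OF A] coord_closed[OF x] by (intro finsum_rdistr) auto
    also have "\<dots> = (\<Oplus>k\<in>{..<N}. A $$ (i, k) \<otimes> (\<lambda>i\<in>{..<N}. a \<otimes> x i) k)"
      using that a matrix_ring_carrierD(3)[OF A] coord_closed[OF x]
        by (intro finsum_cong') (auto simp: m_lcomm)
    finally show ?thesis by simp
  qed
  then show ?thesis by (auto simp: mat_act_def coord_space_simps intro!: restrict_ext)
qed

lemma mat_act_unit_coord:
  assumes A: "A \<in> carrier (matrix_ring R N)" and j: "j < N"
  shows "mat_act R N A (unit_coord R N j) = (\<lambda>i\<in>{..<N}. A $$ (i, j))"
proof -
  have "(\<Oplus>k\<in>{..<N}. A $$ (i, k) \<otimes> unit_coord R N j k) = A $$ (i, j)" if "i < N" for i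
    using that j matrix_ring_carrierD(3)[OF A]
      by (subst finsum_eq_single[of _ j]) (auto simp: unit_coord_def)
  then show ?thesis by (auto simp: mat_act_def intro!: restrict_ext)
qed

text \<open>Faithfulness of the action reduces identities of matrices, such as those for the inverse
  in \<open>act_perm_bij\<close>, to identities of maps.\<close>

lemma mat_act_inj:
  assumes A: "A \<in> carrier (matrix_ring R N)" and C: "C \<in> carrier (matrix_ring R N)"
    and eq: "\<And>x. x \<in> carrier (coord_space R N) \<Longrightarrow> mat_act R N A x = mat_act R N C x"
  shows "A = C"
proof (rule eq_matI)
  fix i j assume "i < dim_row C" "j < dim_col C"
  then have ij: "i < N" "j < N" using matrix_ring_carrierD[OF C] by auto
  have "(\<lambda>i\<in>{..<N}. A $$ (i, j)) i = (\<lambda>i\<in>{..<N}. C $$ (i, j)) i"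
    using eq[OF unit_coord_closed, of j] mat_act_unit_coord[OF A ij(2)] mat_act_unit_coord[OF C ij(2)] by simp
  then show "A $$ (i, j) = C $$ (i, j)" using ij by simp
qed (use matrix_ring_carrierD[OF A] matrix_ring_carrierD[OF C] in auto)

lemma mat_of_closed:
  assumes "\<And>x. x \<in> carrier (coord_space R N) \<Longrightarrow> f x \<in> carrier (coord_space R N)"
  shows "mat_of R N f \<in> carrier (matrix_ring R N)"
  using coord_closed[OF assms[OF unit_coord_closed]] by (simp add: matrix_ring_carrier mat_of_def)

lemma mat_act_mat_of:
  assumes fc: "\<And>x. x \<in> carrier (coord_space R N) \<Longrightarrow> f x \<in> carrier (coord_space R N)"
    and fa: "\<And>x y. \<lbrakk>x \<in> carrier (coord_space R N); y \<in> carrier (coord_space R N)\<rbrakk> \<Longrightarrow>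
      f (x \<oplus>\<^bsub>coord_space R N\<^esub> y) = f x \<oplus>\<^bsub>coord_space R N\<^esub> f y"
    and fs: "\<And>a x. \<lbrakk>a \<in> carrier R; x \<in> carrier (coord_space R N)\<rbrakk> \<Longrightarrow>
      f (a \<odot>\<^bsub>coord_space R N\<^esub> x) = a \<odot>\<^bsub>coord_space R N\<^esub> f x"
    and x: "x \<in> carrier (coord_space R N)"
  shows "mat_act R N (mat_of R N f) x = f x"
proof -
  have A: "mat_of R N f \<in> carrier (matrix_ring R N)" using fc by (rule mat_of_closed)
  show ?thesis
  proof (rule linear_eq[OF mat_act_closed[OF A] mat_act_add[OF A] mat_act_smult[OF A] fa fs fc _ x])
    fix j assume j: "j < N"
    have "mat_act R N (mat_of R N f) (unit_coord R N j) = (\<lambda>i\<in>{..<N}. f (unit_coord R N j) i)"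
      unfolding mat_act_unit_coord[OF A j] using j by (auto simp: mat_of_def intro!: restrict_ext)
    also have "\<dots> = f (unit_coord R N j)"
      using fc[OF unit_coord_closed, of j]
        by (intro coord_eqI) (auto simp: coord_space_simps PiE_iff)
    finally show "mat_act R N (mat_of R N f) (unit_coord R N j) = f (unit_coord R N j)" .
  qed
qed

lemma matrix_mult_entry:
  "\<lbrakk>i < N; j < N\<rbrakk> \<Longrightarrow> (A \<otimes>\<^bsub>matrix_ring R N\<^esub> C) $$ (i, j) = (\<Oplus>k\<in>{..<N}. A $$ (i, k) \<otimes> C $$ (k, j))"
  by (simp add: matrix_ring_def)

lemma matrix_mult_closed:
  assumes A: "A \<in> carrier (matrix_ring R N)" and C: "C \<in> carrier (matrix_ring R N)"
  shows "A \<otimes>\<^bsub>matrix_ring R N\<^esub> C \<in> carrier (matrix_ring R N)"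
proof -
  have "A \<otimes>\<^bsub>matrix_ring R N\<^esub> C \<in> carrier_mat N N" by (simp add: matrix_ring_def)
  moreover have "(A \<otimes>\<^bsub>matrix_ring R N\<^esub> C) $$ (i, j) \<in> carrier R" if "i < N" "j < N" for i j
    using that matrix_ring_carrierD(3)[OF A] matrix_ring_carrierD(3)[OF C]
    by (simp add: matrix_mult_entry)
  ultimately show ?thesis by (simp add: matrix_ring_carrier)
qed

text \<open>Both sides are linear in \<open>x\<close>, so unit vectors suffice, and there the
  identity is the definition of the matrix product.\<close>

lemma mat_act_mult:
  assumes A: "A \<in> carrier (matrix_ring R N)" and C: "C \<in> carrier (matrix_ring R N)"
    and x: "x \<in> carrier (coord_space R N)"
  shows "mat_act R N (A \<otimes>\<^bsub>matrix_ring R N\<^esub> C) x = mat_act R N A (mat_act R N C x)"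
proof -
  note AC = matrix_mult_closed[OF A C]
  show ?thesis
  proof (rule linear_eq[OF mat_act_closed[OF AC] mat_act_add[OF AC] mat_act_smult[OF AC] _ _ _ _ x])
    fix j assume j: "j < N"
    have "(\<Oplus>k\<in>{..<N}. A $$ (i, k) \<otimes> (\<lambda>i\<in>{..<N}. C $$ (i, j)) k) = (\<Oplus>k\<in>{..<N}. A $$ (i, k) \<otimes> C $$ (k, j))"
      if "i < N" for i
      using that j matrix_ring_carrierD(3)[OF A] matrix_ring_carrierD(3)[OF C]
        by (intro finsum_cong') auto
    then show "mat_act R N (A \<otimes>\<^bsub>matrix_ring R N\<^esub> C) (unit_coord R N j) = mat_act R N A (mat_act R N C (unit_coord R N j))"
      unfolding mat_act_unit_coord[OF AC j] mat_act_unit_coord[OF C j] mat_act_def[of R N A]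
      using j by (intro restrict_ext) (simp add: matrix_mult_entry)
  qed (simp_all add: mat_act_closed[OF A] mat_act_closed[OF C] mat_act_add[OF A] mat_act_add[OF C]
      mat_act_smult[OF A] mat_act_smult[OF C])
qed

lemma matrix_one_closed: "\<one>\<^bsub>matrix_ring R N\<^esub> \<in> carrier (matrix_ring R N)"
  unfolding matrix_ring_carrier by (simp add: matrix_ring_def)

lemma mat_act_one:
  assumes x: "x \<in> carrier (coord_space R N)"
  shows "mat_act R N \<one>\<^bsub>matrix_ring R N\<^esub> x = x"
proof (rule linear_eq[OF mat_act_closed[OF matrix_one_closed] mat_act_add[OF matrix_one_closed]
      mat_act_smult[OF matrix_one_closed] _ _ _ _ x])
  fix j assume j: "j < N"
  then show "mat_act R N \<one>\<^bsub>matrix_ring R N\<^esub> (unit_coord R N j) = unit_coord R N j"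
    unfolding mat_act_unit_coord[OF matrix_one_closed j]
    by (auto simp: unit_coord_def matrix_ring_def intro!: restrict_ext)
qed auto

lemma matrix_pow_closed:
  "A \<in> carrier (matrix_ring R N) \<Longrightarrow> A [^]\<^bsub>matrix_ring R N\<^esub> (m::nat) \<in> carrier (matrix_ring R N)"
  by (induction m) (auto simp: nat_pow_def matrix_one_closed matrix_mult_closed)

lemma mat_act_funpow:
  assumes A: "A \<in> carrier (matrix_ring R N)" and x: "x \<in> carrier (coord_space R N)"
  shows "mat_act R N (A [^]\<^bsub>matrix_ring R N\<^esub> (m::nat)) x = (mat_act R N A ^^ m) x"
  using x
proof (induction m arbitrary: x)
  case 0
  then show ?case by (simp add: nat_pow_def mat_act_one)
next
  case (Suc m)
  have "A [^]\<^bsub>matrix_ring R N\<^esub> Suc m = A [^]\<^bsub>matrix_ring R N\<^esub> m \<otimes>\<^bsub>matrix_ring R N\<^esub> A"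
    by (simp add: nat_pow_def)
  then show ?case using Suc
    by (simp add: mat_act_mult matrix_pow_closed A mat_act_closed funpow_swap1)
qed

text \<open>The additive structure is what allows the negative in \<open>Omega_mat\<close> and the
  finite sum in \<open>poly_at_mat\<close> to be evaluated entrywise.\<close>

lemma matrix_ring_abelian_group: "abelian_group (matrix_ring R N)"
proof (rule abelian_groupI)
  fix x assume x: "x \<in> carrier (matrix_ring R N)"
  let ?y = "mat N N (\<lambda>(i, j). \<ominus> x $$ (i, j))"
  have "?y \<in> carrier (matrix_ring R N)" using matrix_ring_carrierD[OF x]
    by (auto simp: matrix_ring_carrier)
  moreover have "?y \<oplus>\<^bsub>matrix_ring R N\<^esub> x = \<zero>\<^bsub>matrix_ring R N\<^esub>"
    using matrix_ring_carrierD[OF x] by (auto simp: matrix_ring_def l_neg)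
  ultimately show "\<exists>y\<in>carrier (matrix_ring R N). y \<oplus>\<^bsub>matrix_ring R N\<^esub> x = \<zero>\<^bsub>matrix_ring R N\<^esub>"
    by blast
  show "\<zero>\<^bsub>matrix_ring R N\<^esub> \<oplus>\<^bsub>matrix_ring R N\<^esub> x = x"
    using matrix_ring_carrierD[OF x] by (auto simp: matrix_ring_def)
next
  fix x y assume x: "x \<in> carrier (matrix_ring R N)" and y: "y \<in> carrier (matrix_ring R N)"
  show "x \<oplus>\<^bsub>matrix_ring R N\<^esub> y \<in> carrier (matrix_ring R N)"
    using matrix_ring_carrierD[OF x] matrix_ring_carrierD[OF y] unfolding matrix_ring_carrier
      by (simp add: matrix_ring_def)
  show "x \<oplus>\<^bsub>matrix_ring R N\<^esub> y = y \<oplus>\<^bsub>matrix_ring R N\<^esub> x"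
    using matrix_ring_carrierD[OF x] matrix_ring_carrierD[OF y]
      by (auto simp: matrix_ring_def a_comm)
  fix z assume z: "z \<in> carrier (matrix_ring R N)"
  show "x \<oplus>\<^bsub>matrix_ring R N\<^esub> y \<oplus>\<^bsub>matrix_ring R N\<^esub> z = x \<oplus>\<^bsub>matrix_ring R N\<^esub> (y \<oplus>\<^bsub>matrix_ring R N\<^esub> z)"
    using matrix_ring_carrierD[OF x] matrix_ring_carrierD[OF y] matrix_ring_carrierD[OF z]
    by (auto simp: matrix_ring_def a_assoc)
next
  show "\<zero>\<^bsub>matrix_ring R N\<^esub> \<in> carrier (matrix_ring R N)"
    unfolding matrix_ring_carrier by (simp add: matrix_ring_def)
qed

lemma matrix_neg_one: "\<ominus>\<^bsub>matrix_ring R N\<^esub> \<one>\<^bsub>matrix_ring R N\<^esub> = mat N N (\<lambda>(i, j). if i = j then \<ominus> \<one> else \<zero>)"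
proof -
  interpret M: abelian_group "matrix_ring R N" by (rule matrix_ring_abelian_group)
  show ?thesis
  proof (rule M.minus_equality)
    show "mat N N (\<lambda>(i, j). if i = j then \<ominus> \<one> else \<zero>) \<oplus>\<^bsub>matrix_ring R N\<^esub> \<one>\<^bsub>matrix_ring R N\<^esub> = \<zero>\<^bsub>matrix_ring R N\<^esub>"
      by (auto simp: matrix_ring_def l_neg)
    show "mat N N (\<lambda>(i, j). if i = j then \<ominus> \<one> else \<zero>) \<in> carrier (matrix_ring R N)"
      unfolding matrix_ring_carrier by simp
  qed (rule matrix_one_closed)
qed

lemma matrix_finsum_entry:
  assumes "finite A" "\<And>k. k \<in> A \<Longrightarrow> F k \<in> carrier (matrix_ring R N)" "i < N" "j < N"
  shows "(\<Oplus>\<^bsub>matrix_ring R N\<^esub>k\<in>A. F k) $$ (i, j) = (\<Oplus>k\<in>A. F k $$ (i, j))"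
proof -
  interpret M: abelian_group "matrix_ring R N" by (rule matrix_ring_abelian_group)
  show ?thesis using assms(1,2)
  proof (induction A rule: finite_induct)
    case empty
    have "\<zero>\<^bsub>matrix_ring R N\<^esub> $$ (i, j) = \<zero>" using assms(3,4) by (simp add: matrix_ring_def)
    then show ?case by simp
  next
    case (insert a A)
    have "(\<Oplus>\<^bsub>matrix_ring R N\<^esub>k\<in>insert a A. F k) = F a \<oplus>\<^bsub>matrix_ring R N\<^esub> (\<Oplus>\<^bsub>matrix_ring R N\<^esub>k\<in>A. F k)"
      using insert by (intro M.finsum_insert) auto
    moreover have "(X \<oplus>\<^bsub>matrix_ring R N\<^esub> Y) $$ (i, j) = X $$ (i, j) \<oplus> Y $$ (i, j)" for X Y
      using assms(3,4) by (simp add: matrix_ring_def)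
    moreover have "(\<Oplus>k\<in>insert a A. F k $$ (i, j)) = F a $$ (i, j) \<oplus> (\<Oplus>k\<in>A. F k $$ (i, j))"
      using insert assms(3,4)
        by (intro finsum_insert) (auto intro!: matrix_ring_carrierD(3)[of _ R N])
    ultimately show ?case using insert by simp
  qed
qed

end

subsection \<open>The standard symplectic form\<close>

definition half_form :: "('a, 'r) ring_scheme \<Rightarrow> nat \<Rightarrow> (nat \<Rightarrow> 'a) \<Rightarrow> (nat \<Rightarrow> 'a) \<Rightarrow> 'a" where
  "half_form R n x y = (\<Oplus>\<^bsub>R\<^esub>i\<in>{..<n}. x i \<otimes>\<^bsub>R\<^esub> y (n + i))"

text \<open>The form \<open>x^t Omega y\<close>, split into its two blocks. In this shape
  antisymmetry and vanishing on the diagonal are immediate.\<close>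

definition std_form :: "('a, 'r) ring_scheme \<Rightarrow> nat \<Rightarrow> (nat \<Rightarrow> 'a) \<Rightarrow> (nat \<Rightarrow> 'a) \<Rightarrow> 'a" where
  "std_form R n x y = half_form R n x y \<ominus>\<^bsub>R\<^esub> half_form R n y x"

lemma (in ring) finsum_a_inv:
  "\<lbrakk>finite A; f \<in> A \<rightarrow> carrier R\<rbrakk> \<Longrightarrow> (\<Oplus>i\<in>A. \<ominus> f i) = \<ominus> (\<Oplus>i\<in>A. f i)"
  by (induction A rule: finite_induct) (auto simp: minus_add Pi_def)

context cring
begin

lemma half_form_closed:
  "\<lbrakk>x \<in> carrier (coord_space R (2 * n)); y \<in> carrier (coord_space R (2 * n))\<rbrakk> \<Longrightarrow> half_form R n x y \<in> carrier R"
  unfolding half_form_def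
    by (intro finsum_closed) (auto intro!: coord_closed[of _ "2 * n"] m_closed)

lemma half_form_add:
  assumes x: "x \<in> carrier (coord_space R (2 * n))" and y: "y \<in> carrier (coord_space R (2 * n))"
    and z: "z \<in> carrier (coord_space R (2 * n))"
  shows "half_form R n (x \<oplus>\<^bsub>coord_space R (2 * n)\<^esub> y) z = half_form R n x z \<oplus> half_form R n y z"
    and "half_form R n z (x \<oplus>\<^bsub>coord_space R (2 * n)\<^esub> y) = half_form R n z x \<oplus> half_form R n z y"
proof -
  note c = coord_closed[OF x] coord_closed[OF y] coord_closed[OF z]
  have "half_form R n (x \<oplus>\<^bsub>coord_space R (2 * n)\<^esub> y) z = (\<Oplus>i\<in>{..<n}. x i \<otimes> z (n + i) \<oplus> y i \<otimes> z (n + i))"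
    unfolding half_form_def using c by (intro finsum_cong') (auto simp: coord_space_simps l_distr)
  also have "\<dots> = half_form R n x z \<oplus> half_form R n y z"
    unfolding half_form_def using c by (intro finsum_addf) auto
  finally show "half_form R n (x \<oplus>\<^bsub>coord_space R (2 * n)\<^esub> y) z = half_form R n x z \<oplus> half_form R n y z" .
  have "half_form R n z (x \<oplus>\<^bsub>coord_space R (2 * n)\<^esub> y) = (\<Oplus>i\<in>{..<n}. z i \<otimes> x (n + i) \<oplus> z i \<otimes> y (n + i))"
    unfolding half_form_def using c by (intro finsum_cong') (auto simp: coord_space_simps r_distr)
  also have "\<dots> = half_form R n z x \<oplus> half_form R n z y"
    unfolding half_form_def using c by (intro finsum_addf) auto
  finally show "half_form R n z (x \<oplus>\<^bsub>coord_space R (2 * n)\<^esub> y) = half_form R n z x \<oplus> half_form R n z y" .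
qed

lemma half_form_smult:
  assumes a: "a \<in> carrier R" and x: "x \<in> carrier (coord_space R (2 * n))"
    and y: "y \<in> carrier (coord_space R (2 * n))"
  shows "half_form R n (a \<odot>\<^bsub>coord_space R (2 * n)\<^esub> x) y = a \<otimes> half_form R n x y"
    and "half_form R n y (a \<odot>\<^bsub>coord_space R (2 * n)\<^esub> x) = a \<otimes> half_form R n y x"
proof -
  note c = coord_closed[OF x] coord_closed[OF y]
  have "a \<otimes> half_form R n x y = (\<Oplus>i\<in>{..<n}. a \<otimes> (x i \<otimes> y (n + i)))"
    unfolding half_form_def using c a by (intro finsum_rdistr) auto
  also have "\<dots> = half_form R n (a \<odot>\<^bsub>coord_space R (2 * n)\<^esub> x) y"
    unfolding half_form_def using c a by (intro finsum_cong') (auto simp: coord_space_simps m_assoc)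
  finally show "half_form R n (a \<odot>\<^bsub>coord_space R (2 * n)\<^esub> x) y = a \<otimes> half_form R n x y" by simp
  have "a \<otimes> half_form R n y x = (\<Oplus>i\<in>{..<n}. a \<otimes> (y i \<otimes> x (n + i)))"
    unfolding half_form_def using c a by (intro finsum_rdistr) auto
  also have "\<dots> = half_form R n y (a \<odot>\<^bsub>coord_space R (2 * n)\<^esub> x)"
    unfolding half_form_def using c a by (intro finsum_cong') (auto simp: coord_space_simps m_lcomm)
  finally show "half_form R n y (a \<odot>\<^bsub>coord_space R (2 * n)\<^esub> x) = a \<otimes> half_form R n y x" by simp
qed

lemma half_form_unit_coord_right:
  assumes x: "x \<in> carrier (coord_space R (2 * n))" and j: "j < 2 * n"
  shows "half_form R n x (unit_coord R (2 * n) j) = (if n \<le> j then x (j - n) else \<zero>)"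
proof (cases "n \<le> j")
  case True
  then show ?thesis unfolding half_form_def using j coord_closed[OF x]
    by (subst finsum_eq_single[of _ "j - n"]) (auto simp: unit_coord_def)
next
  case False
  then show ?thesis unfolding half_form_def using coord_closed[OF x]
    by (simp add: unit_coord_def) (intro add.finprod_one_eqI, auto)
qed

lemma half_form_unit_coord_left:
  assumes x: "x \<in> carrier (coord_space R (2 * n))" and j: "j < 2 * n"
  shows "half_form R n (unit_coord R (2 * n) j) x = (if j < n then x (n + j) else \<zero>)"
proof (cases "j < n")
  case True
  then show ?thesis unfolding half_form_def using coord_closed[OF x]
    by (subst finsum_eq_single[of _ j]) (auto simp: unit_coord_def)
next
  case False
  then show ?thesis unfolding half_form_def using coord_closed[OF x]
    by (simp add: unit_coord_def) (intro add.finprod_one_eqI, auto)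
qed

lemma Omega_mat_entry:
  assumes "i < 2 * n" "j < 2 * n"
  shows "Omega_mat R n $$ (i, j) = (if i < n \<and> j = n + i then \<one> else if j < n \<and> i = n + j then \<ominus> \<one> else \<zero>)"
proof -
  have dim: "dim_row \<zero>\<^bsub>matrix_ring R n\<^esub> = n" "dim_col \<zero>\<^bsub>matrix_ring R n\<^esub> = n"
    by (simp_all add: matrix_ring_def)
  have z: "\<zero>\<^bsub>matrix_ring R n\<^esub> $$ (k, l) = \<zero>" if "k < n" "l < n" for k l using that
    by (simp add: matrix_ring_def)
  have o: "\<one>\<^bsub>matrix_ring R n\<^esub> $$ (k, l) = (if k = l then \<one> else \<zero>)" if "k < n" "l < n" for k l
    using that by (simp add: matrix_ring_def)
  show ?thesis unfolding Omega_mat_def matrix_neg_one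
    using assms by (subst index_mat_four_block) (auto simp: dim z o)
qed

lemma Omega_mat_dim: "dim_row (Omega_mat R n) = 2 * n" "dim_col (Omega_mat R n) = 2 * n"
  by (simp_all add: Omega_mat_def matrix_ring_def)

lemma std_form_unit_coord:
  assumes "i < 2 * n" "j < 2 * n"
  shows "std_form R n (unit_coord R (2 * n) i) (unit_coord R (2 * n) j) = Omega_mat R n $$ (i, j)"
  unfolding std_form_def half_form_unit_coord_right[OF unit_coord_closed assms(2)]
    half_form_unit_coord_right[OF unit_coord_closed assms(1)]
  using assms by (auto simp: Omega_mat_entry unit_coord_def minus_eq)

text \<open>Multiplication by \<open>Omega_mat\<close> exchanges the two halves of the index range,
  with a sign on one of them, which produces the two sums of \<open>std_form\<close>. So the
  equation defining \<open>Sp_mat\<close> says that the columns have the same form values as the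
  unit vectors.\<close>

lemma gram_entry:
  assumes A: "A \<in> carrier (matrix_ring R (2 * n))" and i: "i < 2 * n" and j: "j < 2 * n"
  shows "(transpose_mat A \<otimes>\<^bsub>matrix_ring R (2 * n)\<^esub> Omega_mat R n \<otimes>\<^bsub>matrix_ring R (2 * n)\<^esub> A) $$ (i, j)
    = std_form R n (\<lambda>k\<in>{..<2 * n}. A $$ (k, i)) (\<lambda>k\<in>{..<2 * n}. A $$ (k, j))"
proof -
  note d = matrix_ring_carrierD[OF A]
  let ?T = "transpose_mat A \<otimes>\<^bsub>matrix_ring R (2 * n)\<^esub> Omega_mat R n"
  have T1: "?T $$ (i, k) = \<ominus> A $$ (n + k, i)" if "k < n" for k
    using that i d by (simp add: matrix_mult_entry)
      (subst finsum_eq_single[of _ "n + k"], auto simp: Omega_mat_entry r_minus)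
  have T2: "?T $$ (i, n + k) = A $$ (k, i)" if "k < n" for k
    using that i d by (simp add: matrix_mult_entry)
      (subst finsum_eq_single[of _ "k"], auto simp: Omega_mat_entry r_minus)
  have split: "{..<2 * n} = {..<n} \<union> (\<lambda>k. n + k) ` {..<n}"
  proof -
    have "k \<in> (\<lambda>k. n + k) ` {..<n}" if "k < 2 * n" "\<not> k < n" for k
      using that by (intro image_eqI[of _ _ "k - n"]) auto
    then show ?thesis by auto
  qed
  have "(?T \<otimes>\<^bsub>matrix_ring R (2 * n)\<^esub> A) $$ (i, j) = (\<Oplus>k\<in>{..<2 * n}. ?T $$ (i, k) \<otimes> A $$ (k, j))"
    using i j by (rule matrix_mult_entry)
  also have "\<dots> = (\<Oplus>k\<in>{..<n}. ?T $$ (i, k) \<otimes> A $$ (k, j)) \<oplus> (\<Oplus>k\<in>(\<lambda>k. n + k) ` {..<n}. ?T $$ (i, k) \<otimes> A $$ (k, j))"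
    unfolding split using T1 T2 i j d by (intro finsum_Un_disjoint) auto
  also have "(\<Oplus>k\<in>(\<lambda>k. n + k) ` {..<n}. ?T $$ (i, k) \<otimes> A $$ (k, j)) = (\<Oplus>k\<in>{..<n}. ?T $$ (i, n + k) \<otimes> A $$ (n + k, j))"
    using T2 i j d by (intro finsum_reindex) auto
  also have "\<dots> = half_form R n (\<lambda>k\<in>{..<2 * n}. A $$ (k, i)) (\<lambda>k\<in>{..<2 * n}. A $$ (k, j))"
    unfolding half_form_def using T2 i j d by (intro finsum_cong') auto
  also have "(\<Oplus>k\<in>{..<n}. ?T $$ (i, k) \<otimes> A $$ (k, j)) = (\<Oplus>k\<in>{..<n}. \<ominus> (A $$ (k, j) \<otimes> A $$ (n + k, i)))"
    using T1 i j d by (intro finsum_cong') (auto simp: l_minus r_minus m_comm)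
  also have "\<dots> = \<ominus> (\<Oplus>k\<in>{..<n}. A $$ (k, j) \<otimes> A $$ (n + k, i))"
    using i j d by (intro finsum_a_inv) auto
  also have "(\<Oplus>k\<in>{..<n}. A $$ (k, j) \<otimes> A $$ (n + k, i)) = half_form R n (\<lambda>k\<in>{..<2 * n}. A $$ (k, j)) (\<lambda>k\<in>{..<2 * n}. A $$ (k, i))"
    unfolding half_form_def using i j d by (intro finsum_cong') auto
  finally have eq: "(?T \<otimes>\<^bsub>matrix_ring R (2 * n)\<^esub> A) $$ (i, j)
    = \<ominus> half_form R n (\<lambda>k\<in>{..<2 * n}. A $$ (k, j)) (\<lambda>k\<in>{..<2 * n}. A $$ (k, i))
      \<oplus> half_form R n (\<lambda>k\<in>{..<2 * n}. A $$ (k, i)) (\<lambda>k\<in>{..<2 * n}. A $$ (k, j))" .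
  have col: "(\<lambda>k\<in>{..<2 * n}. A $$ (k, l)) \<in> carrier (coord_space R (2 * n))" if "l < 2 * n" for l
    using that d by (simp add: coord_space_simps)
  show ?thesis
    unfolding eq std_form_def minus_eq
    by (rule a_comm[OF a_inv_closed[OF half_form_closed] half_form_closed]) (rule col[OF i] col[OF j])+
qed

end

context field
begin

lemma std_symplectic:
  assumes fin: "finite (carrier R)"
  shows "finite_symplectic_space R (coord_space R (2 * n)) (std_form R n)"
proof -
  interpret V: Module.module R "coord_space R (2 * n)" by (rule coord_space_module)
  show ?thesis
  proof unfold_locales
    show "finite (carrier R)" by (rule fin)
    show "finite (carrier (coord_space R (2 * n)))" using fin
      by (simp add: coord_space_def finite_PiE)
  next
    fix x y assume x: "x \<in> carrier (coord_space R (2 * n))" and y: "y \<in> carrier (coord_space R (2 * n))"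
    note h = half_form_closed[OF x y] half_form_closed[OF y x]
    show "std_form R n x y \<in> carrier R" using h by (simp add: std_form_def)
    show "std_form R n x y = \<ominus> std_form R n y x" using h
      by (simp add: std_form_def minus_eq minus_add a_comm)
    fix a assume a: "a \<in> carrier R"
    show "std_form R n (a \<odot>\<^bsub>coord_space R (2 * n)\<^esub> x) y = a \<otimes> std_form R n x y"
      using h a x y by (simp add: std_form_def half_form_smult minus_eq r_distr r_minus)
  next
    fix x y z assume x: "x \<in> carrier (coord_space R (2 * n))" and y: "y \<in> carrier (coord_space R (2 * n))"
      and z: "z \<in> carrier (coord_space R (2 * n))"
    show "std_form R n (x \<oplus>\<^bsub>coord_space R (2 * n)\<^esub> y) z = std_form R n x z \<oplus> std_form R n y z"
      using half_form_closed[OF x z] half_form_closed[OF y z] half_form_closed[OF z x] half_form_closed[OF z y] x y z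
      by (simp add: std_form_def half_form_add minus_eq minus_add a_ac)
  next
    fix x assume x: "x \<in> carrier (coord_space R (2 * n))"
    show "std_form R n x x = \<zero>" using half_form_closed[OF x x]
      by (simp add: std_form_def minus_eq r_neg)
    assume nz: "x \<noteq> \<zero>\<^bsub>coord_space R (2 * n)\<^esub>"
    have "\<exists>i<2 * n. x i \<noteq> \<zero>"
    proof (rule ccontr)
      assume "\<not> ?thesis"
      then have "x = \<zero>\<^bsub>coord_space R (2 * n)\<^esub>" using x
        by (intro coord_eqI[OF x]) (auto simp: coord_space_simps)
      then show False using nz by simp
    qed
    then obtain i where i: "i < 2 * n" "x i \<noteq> \<zero>" by blast
    have xi: "x i \<in> carrier R" using x i by (simp add: coord_closed)
    \<comment> \<open>The index that \<open>Omega_mat\<close> pairs with \<open>i\<close>: the form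
      with this unit vector reads off \<open>x i\<close> up to sign.\<close>
    let ?j = "if i < n then n + i else i - n"
    have j: "?j < 2 * n" using i by auto
    have "std_form R n x (unit_coord R (2 * n) ?j) \<noteq> \<zero>"
    proof (cases "i < n")
      case True
      then show ?thesis using i xi
        unfolding std_form_def half_form_unit_coord_left[OF x j] half_form_unit_coord_right[OF x j]
        by (simp add: minus_eq)
    next
      case False
      have "\<ominus> x i \<noteq> \<zero>" using i xi by (metis minus_minus minus_zero)
      then show ?thesis using i xi False
        unfolding std_form_def half_form_unit_coord_left[OF x j] half_form_unit_coord_right[OF x j]
        by (auto simp: minus_eq)
    qed
    then show "\<exists>y\<in>carrier (coord_space R (2 * n)). std_form R n x y \<noteq> \<zero>" using unit_coord_closed
      by blast
  qed
qed

text \<open>Acting as the identity outside the carrier matches the convention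
  \<open>permutes\<close> in \<open>isometries\<close>.\<close>

definition act_perm :: "nat \<Rightarrow> 'a mat \<Rightarrow> (nat \<Rightarrow> 'a) \<Rightarrow> nat \<Rightarrow> 'a" where
  "act_perm N A = (\<lambda>x. if x \<in> carrier (coord_space R N) then mat_act R N A x else x)"

lemma Sp_mat_carrier: "A \<in> Sp_mat R n \<Longrightarrow> A \<in> carrier (matrix_ring R (2 * n))"
  by (auto simp: Sp_mat_def GL_mat_def Units_def)

text \<open>Carries the uniform choice of a matrix over to isometries. The Gram matrix gives
  invariance on unit vectors, which is extended linearly in one argument after the other.
  Conversely, the matrix of an isometry is invertible because the inverse isometry provides its
  inverse.\<close>

lemma act_perm_bij:
  assumes fin: "finite (carrier R)"
  shows "bij_betw (act_perm (2 * n)) (Sp_mat R n)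
    (finite_symplectic_space.isometries R (coord_space R (2 * n)) (std_form R n))"
proof -
  interpret S: finite_symplectic_space R "coord_space R (2 * n)" "std_form R n"
    using fin by (rule std_symplectic)
  let ?V = "carrier (coord_space R (2 * n))" and ?e = "unit_coord R (2 * n)"
  have iso: "act_perm (2 * n) A \<in> S.isometries" if A: "A \<in> Sp_mat R n" for A
    unfolding act_perm_def
  proof (rule S.isometriesI)
    have Ac: "A \<in> carrier (matrix_ring R (2 * n))" using A by (rule Sp_mat_carrier)
    note cl = mat_act_closed[OF Ac] and ad = mat_act_add[OF Ac] and sm = mat_act_smult[OF Ac]
    have gram: "std_form R n (mat_act R (2 * n) A (?e i)) (mat_act R (2 * n) A (?e j)) = std_form R n (?e i) (?e j)"
      if "i < 2 * n" "j < 2 * n" for i j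
      using A gram_entry[OF Ac that] that
        by (simp add: Sp_mat_def mat_act_unit_coord[OF Ac] std_form_unit_coord)
    have zero: "mat_act R (2 * n) A \<zero>\<^bsub>coord_space R (2 * n)\<^esub> = \<zero>\<^bsub>coord_space R (2 * n)\<^esub>"
      using sm[of \<zero> "\<zero>\<^bsub>coord_space R (2 * n)\<^esub>"] cl[OF S.M.zero_closed] by simp
    have unit: "std_form R n (mat_act R (2 * n) A x) (mat_act R (2 * n) A (?e j)) = std_form R n x (?e j)"
      if "j < 2 * n" "x \<in> ?V" for x j
      using that(2)
    proof (induction rule: coord_space_induct)
      case zero
      then show ?case
        using \<open>mat_act R (2 * n) A \<zero>\<^bsub>coord_space R (2 * n)\<^esub> = _\<close> cl unit_coord_closed by simp
    next
      case (step y c i)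
      then show ?case using gram[OF step.hyps(3) that(1)]
        by (simp add: ad sm cl unit_coord_closed S.form_add_left S.form_smult_left)
    qed
    show "std_form R n (mat_act R (2 * n) A x) (mat_act R (2 * n) A y) = std_form R n x y"
      if x: "x \<in> ?V" and y: "y \<in> ?V" for x y
      using y
    proof (induction rule: coord_space_induct)
      case zero
      then show ?case using \<open>mat_act R (2 * n) A \<zero>\<^bsub>coord_space R (2 * n)\<^esub> = _\<close> cl[OF x] x by simp
    next
      case (step y c j)
      then show ?case using unit[OF step.hyps(3) x] x
        by (simp add: ad sm cl unit_coord_closed S.form_add_right S.form_smult_right)
    qed
  qed (use mat_act_closed mat_act_add mat_act_smult Sp_mat_carrier[OF A] in auto)
  have inj: "inj_on (act_perm (2 * n)) (Sp_mat R n)"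
  proof (rule inj_onI)
    fix A C assume *: "A \<in> Sp_mat R n" "C \<in> Sp_mat R n" "act_perm (2 * n) A = act_perm (2 * n) C"
    have "mat_act R (2 * n) A x = mat_act R (2 * n) C x" if "x \<in> ?V" for x
      using fun_cong[OF *(3), of x] that by (simp add: act_perm_def)
    then show "A = C" by (rule mat_act_inj[OF Sp_mat_carrier[OF *(1)] Sp_mat_carrier[OF *(2)]])
  qed
  have "g \<in> act_perm (2 * n) ` Sp_mat R n" if g: "g \<in> S.isometries" for g
  proof
    let ?A = "mat_of R (2 * n) g" and ?C = "mat_of R (2 * n) (inv_into UNIV g)"
    have h: "inv_into UNIV g \<in> S.isometries" using g by (rule S.isometries_inv)
    have A: "?A \<in> carrier (matrix_ring R (2 * n))" using g by (intro mat_of_closed) simp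
    have C: "?C \<in> carrier (matrix_ring R (2 * n))" using h by (intro mat_of_closed) simp
    have actA: "mat_act R (2 * n) ?A x = g x" if "x \<in> ?V" for x
      using g that by (intro mat_act_mat_of) (auto simp: S.isometries_add S.isometries_smult)
    have actC: "mat_act R (2 * n) ?C x = inv_into UNIV g x" if "x \<in> ?V" for x
      using h that by (intro mat_act_mat_of) (auto simp: S.isometries_add S.isometries_smult)
    have "?C \<otimes>\<^bsub>matrix_ring R (2 * n)\<^esub> ?A = \<one>\<^bsub>matrix_ring R (2 * n)\<^esub>"
      by (rule mat_act_inj[OF matrix_mult_closed[OF C A] matrix_one_closed])
        (use g h in \<open>simp add: mat_act_mult[OF C A] mat_act_one actA actC\<close>)
    moreover have "?A \<otimes>\<^bsub>matrix_ring R (2 * n)\<^esub> ?C = \<one>\<^bsub>matrix_ring R (2 * n)\<^esub>"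
      by (rule mat_act_inj[OF matrix_mult_closed[OF A C] matrix_one_closed])
        (use g h in \<open>simp add: mat_act_mult[OF A C] mat_act_one actA actC\<close>)
    ultimately have "?A \<in> GL_mat R (2 * n)" using A C by (auto simp: GL_mat_def Units_def)
    moreover have "transpose_mat ?A \<otimes>\<^bsub>matrix_ring R (2 * n)\<^esub> Omega_mat R n \<otimes>\<^bsub>matrix_ring R (2 * n)\<^esub> ?A = Omega_mat R n"
    proof (rule eq_matI)
      fix i j assume "i < dim_row (Omega_mat R n)" "j < dim_col (Omega_mat R n)"
      then have ij: "i < 2 * n" "j < 2 * n" by (auto simp: Omega_mat_dim)
      have col: "(\<lambda>k\<in>{..<2 * n}. ?A $$ (k, l)) = g (?e l)" if "l < 2 * n" for l
        using mat_act_unit_coord[OF A that] actA[OF unit_coord_closed, of l] by simp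
      show "(transpose_mat ?A \<otimes>\<^bsub>matrix_ring R (2 * n)\<^esub> Omega_mat R n \<otimes>\<^bsub>matrix_ring R (2 * n)\<^esub> ?A) $$ (i, j) = Omega_mat R n $$ (i, j)"
        unfolding gram_entry[OF A ij] col[OF ij(1)] col[OF ij(2)]
        using S.isometries_form[OF g unit_coord_closed unit_coord_closed] std_form_unit_coord[OF ij]
          by simp
    qed (simp_all add: matrix_ring_def Omega_mat_def)
    ultimately show "?A \<in> Sp_mat R n" by (simp add: Sp_mat_def)
    show "g = act_perm (2 * n) ?A"
      using actA permutes_not_in[OF S.isometries_permutes[OF g]] by (auto simp: act_perm_def)
  qed
  then show ?thesis using iso inj by (auto simp: bij_betw_def)
qed

end

subsection \<open>Minimal polynomials\<close>

context field
begin

abbreviation cf :: "(nat \<Rightarrow> 'a) \<Rightarrow> nat \<Rightarrow> 'a" where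
  "cf \<equiv> up_ring.coeff (UP R)"

text \<open>An entry of \<open>p(A)\<close> with a fixed upper limit \<open>m\<close> in place of
  \<open>deg R p\<close>. This makes it linear in \<open>p\<close>, whereas the degree may drop in a
  difference.\<close>

definition entry_sum :: "nat \<Rightarrow> 'a mat \<Rightarrow> nat \<Rightarrow> nat \<Rightarrow> nat \<Rightarrow> (nat \<Rightarrow> 'a) \<Rightarrow> 'a" where
  "entry_sum N A i j m p = (\<Oplus>k\<in>{..m}. cf p k \<otimes> (A [^]\<^bsub>matrix_ring R N\<^esub> k) $$ (i, j))"

lemma UP_domain_self: "UP_domain R"
  by unfold_locales

lemma entry_sum_deg:
  assumes A: "A \<in> carrier (matrix_ring R N)" and ij: "i < N" "j < N" and p: "p \<in> carrier (UP R)"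
    and m: "deg R p \<le> m"
  shows "entry_sum N A i j m p = entry_sum N A i j (deg R p) p"
proof -
  interpret P: UP_domain R "UP R" using UP_domain_self by simp
  note e = matrix_ring_carrierD(3)[OF matrix_pow_closed[OF A] ij]
  show ?thesis unfolding entry_sum_def
    by (rule add.finprod_mono_neutral_cong_right) (use m e P.coeff_closed[OF p] P.deg_aboveD[OF _ p] in auto)
qed

lemma entry_sum_diff:
  assumes A: "A \<in> carrier (matrix_ring R N)" and ij: "i < N" "j < N" and p: "p \<in> carrier (UP R)"
    and r: "r \<in> carrier (UP R)"
  shows "entry_sum N A i j m (p \<ominus>\<^bsub>UP R\<^esub> r) = entry_sum N A i j m p \<ominus> entry_sum N A i j m r"
proof -
  interpret P: UP_domain R "UP R" using UP_domain_self by simp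
  let ?A = "\<lambda>k. (A [^]\<^bsub>matrix_ring R N\<^esub> (k::nat)) $$ (i, j)"
  note e = matrix_ring_carrierD(3)[OF matrix_pow_closed[OF A] ij]
  note c = P.coeff_closed[OF p] P.coeff_closed[OF r]
  have "entry_sum N A i j m (p \<ominus>\<^bsub>UP R\<^esub> r) = (\<Oplus>k\<in>{..m}. cf p k \<otimes> ?A k \<oplus> \<ominus> (cf r k \<otimes> ?A k))"
    unfolding entry_sum_def using e c
    by (intro finsum_cong') (auto simp: P.coeff_minus[OF p r] minus_eq l_distr l_minus)
  also have "\<dots> = (\<Oplus>k\<in>{..m}. cf p k \<otimes> ?A k) \<oplus> (\<Oplus>k\<in>{..m}. \<ominus> (cf r k \<otimes> ?A k))"
    using e c by (intro finsum_addf) auto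
  also have "(\<Oplus>k\<in>{..m}. \<ominus> (cf r k \<otimes> ?A k)) = \<ominus> (\<Oplus>k\<in>{..m}. cf r k \<otimes> ?A k)"
    using e c by (intro finsum_a_inv) auto
  finally show ?thesis by (simp add: entry_sum_def minus_eq)
qed

lemma entry_sum_smult:
  assumes A: "A \<in> carrier (matrix_ring R N)" and ij: "i < N" "j < N" and p: "p \<in> carrier (UP R)"
    and a: "a \<in> carrier R"
  shows "entry_sum N A i j m (a \<odot>\<^bsub>UP R\<^esub> p) = a \<otimes> entry_sum N A i j m p"
proof -
  interpret P: UP_domain R "UP R" using UP_domain_self by simp
  note e = matrix_ring_carrierD(3)[OF matrix_pow_closed[OF A] ij]
  note c = P.coeff_closed[OF p]
  have "a \<otimes> entry_sum N A i j m p = (\<Oplus>k\<in>{..m}. a \<otimes> (cf p k \<otimes> (A [^]\<^bsub>matrix_ring R N\<^esub> k) $$ (i, j)))"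
    unfolding entry_sum_def using e c a by (intro finsum_rdistr) auto
  also have "\<dots> = entry_sum N A i j m (a \<odot>\<^bsub>UP R\<^esub> p)"
    unfolding entry_sum_def using e c a
      by (intro finsum_cong') (auto simp: P.coeff_smult[OF a p] m_assoc)
  finally show ?thesis by simp
qed

lemma entry_sum_monom:
  assumes A: "A \<in> carrier (matrix_ring R N)" and ij: "i < N" "j < N" and t: "t \<le> m"
  shows "entry_sum N A i j m (up_ring.monom (UP R) \<one> t) = (A [^]\<^bsub>matrix_ring R N\<^esub> t) $$ (i, j)"
proof -
  interpret P: UP_domain R "UP R" using UP_domain_self by simp
  note e = matrix_ring_carrierD(3)[OF matrix_pow_closed[OF A] ij]
  show ?thesis unfolding entry_sum_def using e t by (subst finsum_eq_single[of _ t]) auto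
qed

lemma poly_at_mat_zero_iff:
  assumes A: "A \<in> carrier (matrix_ring R N)" and p: "p \<in> carrier (UP R)" and m: "deg R p \<le> m"
  shows "poly_at_mat R N p A = \<zero>\<^bsub>matrix_ring R N\<^esub> \<longleftrightarrow> (\<forall>i<N. \<forall>j<N. entry_sum N A i j m p = \<zero>)"
proof -
  interpret P: UP_domain R "UP R" using UP_domain_self by simp
  interpret M: abelian_group "matrix_ring R N" by (rule matrix_ring_abelian_group)
  note pw = matrix_pow_closed[OF A]
  let ?F = "\<lambda>k::nat. map_mat (\<lambda>x. cf p k \<otimes> x) (A [^]\<^bsub>matrix_ring R N\<^esub> k)"
  have F: "?F k \<in> carrier (matrix_ring R N)" for k
    using matrix_ring_carrierD[OF pw[of k]] P.coeff_closed[OF p] by (auto simp: matrix_ring_carrier)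
  have cl: "poly_at_mat R N p A \<in> carrier (matrix_ring R N)"
    unfolding poly_at_mat_def using F by (intro M.finsum_closed) auto
  have "poly_at_mat R N p A $$ (i, j) = entry_sum N A i j m p" if "i < N" "j < N" for i j
  proof -
    have "poly_at_mat R N p A $$ (i, j) = (\<Oplus>k\<in>{..deg R p}. ?F k $$ (i, j))"
      unfolding poly_at_mat_def using F that by (intro matrix_finsum_entry) auto
    also have "\<dots> = entry_sum N A i j (deg R p) p"
      unfolding entry_sum_def
      using that matrix_ring_carrierD[OF pw] P.coeff_closed[OF p] by (intro finsum_cong') auto
    finally show ?thesis using entry_sum_deg[OF A that p m] by simp
  qed
  moreover have "poly_at_mat R N p A = \<zero>\<^bsub>matrix_ring R N\<^esub> \<longleftrightarrow> (\<forall>i<N. \<forall>j<N. poly_at_mat R N p A $$ (i, j) = \<zero>)"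
  proof
    show "\<forall>i<N. \<forall>j<N. poly_at_mat R N p A $$ (i, j) = \<zero>" if "poly_at_mat R N p A = \<zero>\<^bsub>matrix_ring R N\<^esub>"
      unfolding that by (simp add: matrix_ring_def)
    assume *: "\<forall>i<N. \<forall>j<N. poly_at_mat R N p A $$ (i, j) = \<zero>"
    show "poly_at_mat R N p A = \<zero>\<^bsub>matrix_ring R N\<^esub>"
      by (rule eq_matI) (use * matrix_ring_carrierD[OF cl] in \<open>auto simp: matrix_ring_def\<close>)
  qed
  ultimately show ?thesis by simp
qed

lemma finite_matrix_ring:
  assumes fin: "finite (carrier R)"
  shows "finite (carrier (matrix_ring R N))"
proof (rule inj_on_finite)
  let ?I = "{..<N} \<times> {..<N}"
  show "inj_on (\<lambda>A. restrict (\<lambda>p. A $$ p) ?I) (carrier (matrix_ring R N))"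
  proof (rule inj_onI)
    fix A C assume A: "A \<in> carrier (matrix_ring R N)" and C: "C \<in> carrier (matrix_ring R N)"
      and eq: "restrict (\<lambda>p. A $$ p) ?I = restrict (\<lambda>p. C $$ p) ?I"
    show "A = C"
    proof (rule eq_matI)
      fix i j assume "i < dim_row C" "j < dim_col C"
      then show "A $$ (i, j) = C $$ (i, j)"
        using fun_cong[OF eq, of "(i, j)"] matrix_ring_carrierD[OF C] by simp
    qed (use matrix_ring_carrierD[OF A] matrix_ring_carrierD[OF C] in auto)
  qed
  show "(\<lambda>A. restrict (\<lambda>p. A $$ p) ?I) ` carrier (matrix_ring R N) \<subseteq> ?I \<rightarrow>\<^sub>E carrier R"
    by (intro image_subsetI) (auto simp: restrict_PiE_iff matrix_ring_carrierD)
  show "finite (?I \<rightarrow>\<^sub>E carrier R)" using fin by (simp add: finite_PiE)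
qed

text \<open>Among finitely many matrices two powers of \<open>A\<close> coincide, say
  \<open>A^a = A^b\<close> with \<open>b < a\<close>; then \<open>X^a - X^b\<close> is monic and
  annihilates \<open>A\<close>.\<close>

lemma ex_monic_annihilator:
  assumes fin: "finite (carrier R)" and A: "A \<in> carrier (matrix_ring R N)"
  shows "\<exists>p. poly_monic R p \<and> poly_at_mat R N p A = \<zero>\<^bsub>matrix_ring R N\<^esub>"
proof -
  interpret P: UP_domain R "UP R" using UP_domain_self by simp
  let ?A = "\<lambda>k::nat. A [^]\<^bsub>matrix_ring R N\<^esub> k" and ?x = "up_ring.monom (UP R) \<one>"
  have "\<not> inj ?A"
    using range_inj_infinite[of ?A] finite_subset[OF _ finite_matrix_ring[OF fin]] matrix_pow_closed[OF A] by blast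
  then obtain s t where "?A s = ?A t" "s \<noteq> t" by (auto simp: inj_def)
  then obtain a b where ab: "b < a" "?A a = ?A b" by (metis linorder_neqE_nat)
  let ?p = "?x a \<ominus>\<^bsub>UP R\<^esub> ?x b"
  have x: "?x k \<in> carrier (UP R)" for k by simp
  have p: "?p \<in> carrier (UP R)" by simp
  have cp: "cf ?p k = (if a = k then \<one> else \<zero>) \<ominus> (if b = k then \<one> else \<zero>)" for k
    by (simp add: P.coeff_minus[OF x x])
  have deg: "deg R ?p = a"
  proof (rule le_antisym)
    show "deg R ?p \<le> a" using ab by (intro P.deg_aboveI[OF _ p]) (simp add: cp minus_eq)
    show "a \<le> deg R ?p" using ab by (intro P.deg_belowI[OF _ p]) (simp add: cp minus_eq)
  qed
  have "poly_monic R ?p" using p deg cp[of a] ab by (simp add: poly_monic_def minus_eq)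
  moreover have "poly_at_mat R N ?p A = \<zero>\<^bsub>matrix_ring R N\<^esub>"
    unfolding poly_at_mat_zero_iff[OF A p eq_refl[OF deg]]
  proof (intro allI impI)
    fix i j assume ij: "i < N" "j < N"
    show "entry_sum N A i j a ?p = \<zero>"
      unfolding entry_sum_diff[OF A ij x x]
        using ab matrix_ring_carrierD(3)[OF matrix_pow_closed[OF A] ij]
      by (simp add: entry_sum_monom[OF A ij] minus_eq r_neg)
  qed
  ultimately show ?thesis by blast
qed

text \<open>\<open>THE\<close> calls for uniqueness. The difference of two distinct monic
  annihilators of least degree has smaller degree, and dividing it by its leading coefficient gives
  a monic annihilator that contradicts minimality.\<close>

lemma minpoly_props:
  assumes fin: "finite (carrier R)" and A: "A \<in> carrier (matrix_ring R N)"
  shows "poly_monic R (minpoly R N A)" and "poly_at_mat R N (minpoly R N A) A = \<zero>\<^bsub>matrix_ring R N\<^esub>"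
proof -
  interpret P: UP_domain R "UP R" using UP_domain_self by simp
  let ?Q = "\<lambda>p. poly_monic R p \<and> poly_at_mat R N p A = \<zero>\<^bsub>matrix_ring R N\<^esub>"
  let ?S = "\<lambda>p. ?Q p \<and> (\<forall>g. ?Q g \<longrightarrow> deg R p \<le> deg R g)"
  obtain p0 where "?Q p0" using ex_monic_annihilator[OF fin A] by blast
  define p where "p = arg_min (deg R) ?Q"
  have p: "?S p"
    using arg_min_natI[of ?Q p0 "deg R"] arg_min_nat_le[of ?Q _ "deg R"] \<open>?Q p0\<close> by (simp add: p_def)
  have unique: "r = p" if r: "?S r" for r
  proof (rule ccontr)
    assume "r \<noteq> p"
    have pc: "p \<in> carrier (UP R)" and rc: "r \<in> carrier (UP R)" using p r
      by (auto simp: poly_monic_def)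
    have deg: "deg R r = deg R p" using p r by (simp add: le_antisym)
    let ?s = "r \<ominus>\<^bsub>UP R\<^esub> p"
    have sc: "?s \<in> carrier (UP R)" using pc rc by simp
    have nz: "?s \<noteq> \<zero>\<^bsub>UP R\<^esub>"
    proof
      assume "?s = \<zero>\<^bsub>UP R\<^esub>"
      then have "cf r m \<ominus> cf p m = \<zero>" for m using P.coeff_minus[OF rc pc, of m] by simp
      then have "r = p" using P.coeff_closed[OF rc] P.coeff_closed[OF pc]
        by (intro P.up_eqI[OF _ rc pc]) (metis minus_eq minus_equality minus_minus a_inv_closed)
      then show False using \<open>r \<noteq> p\<close> by simp
    qed
    let ?l = "cf ?s (deg R ?s)"
    have l: "?l \<noteq> \<zero>" "?l \<in> carrier R" using P.lcoeff_nonzero[OF nz sc] P.coeff_closed[OF sc] by auto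
    then have lu: "?l \<in> Units R" by (simp add: field_Units)
    then have il: "inv ?l \<in> carrier R" "inv ?l \<noteq> \<zero>" by (auto dest: Units_inv_closed)
      (metis Units_l_inv l_null one_not_zero l(2))
    have "deg R ?s \<le> deg R p"
      by (rule P.deg_aboveI[OF _ sc]) (simp add: P.coeff_minus[OF rc pc] P.deg_aboveD[OF _ pc] P.deg_aboveD[OF _ rc] deg minus_eq)
    \<comment> \<open>The leading coefficients 1 cancel, whereas \<open>?l\<close> is not zero; so
      the degree of \<open>?s\<close> cannot equal \<open>deg R p\<close>.\<close>
    moreover have "cf ?s (deg R p) = \<zero>"
      using p r deg by (simp add: P.coeff_minus[OF rc pc] poly_monic_def minus_eq r_neg)
    ultimately have lt: "deg R ?s < deg R p" using l(1) by (metis le_neq_implies_less)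
    let ?g = "inv ?l \<odot>\<^bsub>UP R\<^esub> ?s"
    have gc: "?g \<in> carrier (UP R)" using il sc by simp
    have dg: "deg R ?g = deg R ?s" using P.deg_smult[OF il(1) sc] il(2) by simp
    have "poly_monic R ?g"
      unfolding poly_monic_def dg using gc P.coeff_smult[OF il(1) sc] Units_l_inv[OF lu] by simp
    moreover have "poly_at_mat R N ?g A = \<zero>\<^bsub>matrix_ring R N\<^esub>"
      unfolding poly_at_mat_zero_iff[OF A gc order_refl]
    proof (intro allI impI)
      fix i j assume ij: "i < N" "j < N"
      have "entry_sum N A i j (deg R p) p = \<zero>" "entry_sum N A i j (deg R p) r = \<zero>"
        using p r poly_at_mat_zero_iff[OF A pc order_refl] poly_at_mat_zero_iff[OF A rc eq_refl[OF deg]] ij by auto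
      then have "entry_sum N A i j (deg R p) ?s = \<zero>"
        by (simp add: entry_sum_diff[OF A ij rc pc] minus_eq)
      then have "entry_sum N A i j (deg R p) ?g = \<zero>" using il
        by (simp add: entry_sum_smult[OF A ij sc il(1)])
      then show "entry_sum N A i j (deg R ?g) ?g = \<zero>"
        using entry_sum_deg[OF A ij gc, of "deg R p"] lt dg by simp
    qed
    ultimately have "deg R p \<le> deg R ?g" using p by blast
    then show False using lt dg by simp
  qed
  have "minpoly R N A = (THE p. ?S p)" by (simp add: minpoly_def conj_assoc)
  moreover have "?S (THE p. ?S p)" using p unique by (rule theI)
  ultimately show "poly_monic R (minpoly R N A)" "poly_at_mat R N (minpoly R N A) A = \<zero>\<^bsub>matrix_ring R N\<^esub>" by simp_all
qed

section \<open>From the minimal polynomial to cyclic subspaces\<close>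

lemma act_perm_funpow:
  assumes A: "A \<in> carrier (matrix_ring R N)" and x: "x \<in> carrier (coord_space R N)"
  shows "(act_perm N A ^^ m) x = mat_act R N (A [^]\<^bsub>matrix_ring R N\<^esub> m) x"
proof -
  have "(act_perm N A ^^ m) x = (mat_act R N A ^^ m) x \<and> (mat_act R N A ^^ m) x \<in> carrier (coord_space R N)"
    by (induction m) (auto simp: x act_perm_def mat_act_closed[OF A])
  then show ?thesis by (simp add: mat_act_funpow[OF A x])
qed

text \<open>This is coordinate \<open>i\<close> of \<open>p(A) x\<close>. Exchanging the sums leaves
  a combination of entries of \<open>p(A)\<close>, all of which vanish.\<close>

lemma poly_at_mat_zero_act:
  assumes A: "A \<in> carrier (matrix_ring R N)" and p: "p \<in> carrier (UP R)"
    and z: "poly_at_mat R N p A = \<zero>\<^bsub>matrix_ring R N\<^esub>"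
    and x: "x \<in> carrier (coord_space R N)" and i: "i < N"
  shows "(\<Oplus>k\<in>{..deg R p}. cf p k \<otimes> mat_act R N (A [^]\<^bsub>matrix_ring R N\<^esub> k) x i) = \<zero>"
proof -
  interpret P: UP_domain R "UP R" using UP_domain_self by simp
  let ?A = "\<lambda>k::nat. A [^]\<^bsub>matrix_ring R N\<^esub> k"
  note c = P.coeff_closed[OF p] and xc = coord_closed[OF x]
  have e: "?A k $$ (i, j) \<in> carrier R" if "j < N" for k j
    using matrix_ring_carrierD(3)[OF matrix_pow_closed[OF A] i that] .
  have "(\<Oplus>k\<in>{..deg R p}. cf p k \<otimes> mat_act R N (?A k) x i) = (\<Oplus>k\<in>{..deg R p}. \<Oplus>j\<in>{..<N}. cf p k \<otimes> ?A k $$ (i, j) \<otimes> x j)"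
  proof (intro finsum_cong' refl)
    fix k
    have "cf p k \<otimes> mat_act R N (?A k) x i = cf p k \<otimes> (\<Oplus>j\<in>{..<N}. ?A k $$ (i, j) \<otimes> x j)"
      using i by (simp add: mat_act_def)
    also have "\<dots> = (\<Oplus>j\<in>{..<N}. cf p k \<otimes> (?A k $$ (i, j) \<otimes> x j))"
      using c xc e by (intro finsum_rdistr) auto
    also have "\<dots> = (\<Oplus>j\<in>{..<N}. cf p k \<otimes> ?A k $$ (i, j) \<otimes> x j)"
      using c xc e by (intro finsum_cong') (auto simp: m_assoc)
    finally show "cf p k \<otimes> mat_act R N (?A k) x i = (\<Oplus>j\<in>{..<N}. cf p k \<otimes> ?A k $$ (i, j) \<otimes> x j)" .
  qed (use c xc e in \<open>auto intro!: finsum_closed\<close>)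
  also have "\<dots> = (\<Oplus>j\<in>{..<N}. \<Oplus>k\<in>{..deg R p}. cf p k \<otimes> ?A k $$ (i, j) \<otimes> x j)"
    using c xc e by (intro finsum_swap) auto
  also have "\<dots> = \<zero>"
  proof (rule add.finprod_one_eqI)
    fix j assume "j \<in> {..<N}"
    then have j: "j < N" by simp
    have "(\<Oplus>k\<in>{..deg R p}. cf p k \<otimes> ?A k $$ (i, j) \<otimes> x j) = entry_sum N A i j (deg R p) p \<otimes> x j"
      unfolding entry_sum_def using c xc e j by (intro finsum_ldistr[symmetric]) auto
    also have "entry_sum N A i j (deg R p) p = \<zero>"
      using z poly_at_mat_zero_iff[OF A p order_refl] i j by simp
    finally show "(\<Oplus>k\<in>{..deg R p}. cf p k \<otimes> ?A k $$ (i, j) \<otimes> x j) = \<zero>" using xc j by simp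
  qed
  finally show ?thesis .
qed

text \<open>As the minimal polynomial is monic, \<open>p(A) x = 0\<close> expresses the top power of
  \<open>A\<close> on \<open>x\<close> through the lower ones, with the negated coefficients of
  \<open>p\<close>.\<close>

lemma act_perm_cyclic_bounded:
  assumes fin: "finite (carrier R)" and A: "A \<in> Sp_mat R n"
  shows "act_perm (2 * n) A \<in> finite_symplectic_space.cyclic_bounded R (coord_space R (2 * n)) (std_form R n)
    (deg R (minpoly R (2 * n) A))"
proof -
  interpret P: UP_domain R "UP R" using UP_domain_self by simp
  interpret S: finite_symplectic_space R "coord_space R (2 * n)" "std_form R n"
    using fin by (rule std_symplectic)
  let ?V = "carrier (coord_space R (2 * n))" and ?T = "act_perm (2 * n) A" and ?p = "minpoly R (2 * n) A"
  let ?Z = "\<zero>\<^bsub>coord_space R (2 * n)\<^esub>"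
  have Ac: "A \<in> carrier (matrix_ring R (2 * n))" using A by (rule Sp_mat_carrier)
  have T: "?T \<in> S.isometries" using act_perm_bij[OF fin] A by (auto simp: bij_betw_def)
  have p: "?p \<in> carrier (UP R)" "cf ?p (deg R ?p) = \<one>"
    using minpoly_props(1)[OF fin Ac] by (auto simp: poly_monic_def)
  have "(?T ^^ deg R ?p) x \<in> S.krylov ?T {?Z} x (deg R ?p)" if x: "x \<in> ?V" for x
  proof -
    define c where "c = (\<lambda>k. \<ominus> cf ?p k)"
    have cc: "c k \<in> carrier R" for k using P.coeff_closed[OF p(1)] by (simp add: c_def)
    let ?y = "S.krylov_comb ?T ?Z c x"
    have Tx: "(?T ^^ k) x \<in> ?V" for k using T x by simp
    have mem: "?y m \<in> S.krylov ?T {?Z} x m" for m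
      by (induction m) (use cc in auto)
    have yV: "?y m \<in> ?V" for m using mem S.krylov_subset[OF T _ x, of "{?Z}" m] by auto
    have coord: "?y m i = (\<Oplus>k\<in>{..<m}. c k \<otimes> (?T ^^ k) x i)" if i: "i < 2 * n" for m i
    proof (induction m)
      case 0
      then show ?case using i by (simp add: coord_space_simps)
    next
      case (Suc m)
      have "?y (Suc m) i = ?y m i \<oplus> c m \<otimes> (?T ^^ m) x i" using i by (simp add: coord_space_simps)
      also have "\<dots> = (\<Oplus>k\<in>{..<Suc m}. c k \<otimes> (?T ^^ k) x i)"
        unfolding lessThan_Suc using Suc cc coord_closed[OF Tx i]
          by (subst finsum_insert) (auto simp: a_comm)
      finally show ?case .
    qed
    have "(?T ^^ deg R ?p) x = ?y (deg R ?p)"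
    proof (rule coord_eqI[OF Tx yV])
      fix i assume i: "i < 2 * n"
      let ?d = "deg R ?p" and ?f = "\<lambda>k. cf ?p k \<otimes> (?T ^^ k) x i"
      have f: "?f k \<in> carrier R" for k using P.coeff_closed[OF p(1)] coord_closed[OF Tx i] by simp
      have "\<zero> = (\<Oplus>k\<in>{..?d}. ?f k)"
        using poly_at_mat_zero_act[OF Ac p(1) minpoly_props(2)[OF fin Ac] x i]
          by (simp add: act_perm_funpow[OF Ac x])
      also have "\<dots> = (\<Oplus>k\<in>insert ?d {..<?d}. ?f k)" by (metis lessThan_Suc lessThan_Suc_atMost)
      also have "\<dots> = ?f ?d \<oplus> (\<Oplus>k\<in>{..<?d}. ?f k)" using f by (intro finsum_insert) auto
      finally have "(?T ^^ ?d) x i \<oplus> (\<Oplus>k\<in>{..<?d}. ?f k) = \<zero>" using p(2) coord_closed[OF Tx i]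
        by simp
      then have "(?T ^^ ?d) x i = \<ominus> (\<Oplus>k\<in>{..<?d}. ?f k)"
        using f coord_closed[OF Tx i] by (intro minus_equality[symmetric] finsum_closed) auto
      also have "\<dots> = (\<Oplus>k\<in>{..<?d}. \<ominus> ?f k)" using f by (intro finsum_a_inv[symmetric]) auto
      also have "\<dots> = (\<Oplus>k\<in>{..<?d}. c k \<otimes> (?T ^^ k) x i)"
        using P.coeff_closed[OF p(1)] coord_closed[OF Tx i]
          by (intro finsum_cong') (auto simp: c_def l_minus)
      finally show "(?T ^^ ?d) x i = ?y ?d i" using coord[OF i] by simp
    qed
    then show ?thesis using mem by simp
  qed
  then show ?thesis using T by (simp add: S.cyclic_bounded_def)
qed

end

subsection \<open>The exponent\<close>

text \<open>With \<open>n = d k + r\<close>, the right side exceeds the left by at least the sum of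
  \<open>(k - 1) (d k / 2 - 1)\<close>, which includes the cost \<open>k - 1\<close> of the factors
  2, and \<open>r k - r^2 / (2 d)\<close>, which stems from rounding \<open>n / d\<close>. Neither
  is negative.\<close>

lemma exponent_bound:
  fixes n d :: nat
  assumes d: "1 \<le> d" "d \<le> n"
  defines "k \<equiv> n div d"
  shows "real (k - 1) + real (\<Sum>i<k. 2 * i * d + d + d div 2) - real (2 * n * k) \<le> - ((real n)\<^sup>2 / (2 * real d))"
proof -
  define r where "r = n mod d"
  have n: "real n = real d * real k + real r" unfolding k_def r_def
    by (metis mult_div_mod_eq of_nat_add of_nat_mult)
  have k: "k \<ge> 1" unfolding k_def using d by (simp add: Suc_le_eq div_greater_zero_iff)
  have r: "real r \<le> real d" using d by (simp add: r_def order_less_imp_le)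
  have "real (\<Sum>i<m. 2 * i * d + d + d div 2) \<le> real d * real m * (real m - 1) + 3 / 2 * real d * real m" for m
  proof (induction m)
    case (Suc m)
    have "real (2 * (d div 2)) \<le> real d" by simp
    then show ?case using Suc by (simp add: algebra_simps add_divide_distrib)
  qed simp
  then have s: "real (\<Sum>i<k. 2 * i * d + d + d div 2) \<le> real d * real k * (real k - 1) + 3 / 2 * real d * real k" .
  have sq: "(real n)\<^sup>2 / (2 * real d) = real d * (real k)\<^sup>2 / 2 + real k * real r + (real r)\<^sup>2 / (2 * real d)"
    using d by (simp add: n power2_eq_square field_simps)
  \<comment> \<open>For \<open>k = 1\<close> the first factor vanishes; otherwise
    \<open>d k \<ge> 2\<close>.\<close>
  have 1: "0 \<le> (real k - 1) * (real d * real k / 2 - 1)"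
  proof (cases "k = 1")
    case False
    then have "real 1 * real 2 \<le> real d * real k" using k d by (intro mult_mono) auto
    then show ?thesis using k by (intro mult_nonneg_nonneg) auto
  qed simp
  have "(real r)\<^sup>2 / (2 * real d) = real r * (real r / (2 * real d))"
    by (simp add: power2_eq_square)
  also have "\<dots> \<le> real r * real k"
    using r k d
      by (intro mult_left_mono) (auto simp: field_simps intro: order_trans[of _ "real d"] mult_mono[of 1 _ 1, simplified])
  finally have 2: "(real r)\<^sup>2 / (2 * real d) \<le> real r * real k" .
  have "real (k - 1) = real k - 1" using k by simp
  then show ?thesis using s sq 1 2 n
    by (simp add: power2_eq_square algebra_simps add_divide_distrib diff_divide_distrib)
qed

lemma probability_bound:
  fixes n d q b g :: nat
  assumes d: "1 \<le> d" "d \<le> n" and q: "2 \<le> q" and g: "0 < g"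
    and b: "\<And>k. b * (q ^ (2 * n)) ^ k \<le> (\<Prod>i<k. 2 * q ^ (2 * i * d + d + d div 2)) * g"
  shows "real b / real g \<le> 2 * real q powr (- ((real n)\<^sup>2 / (2 * real d)))"
proof -
  define k where "k = n div d"
  let ?s = "\<Sum>i<k. 2 * i * d + d + d div 2"
  have k: "k \<ge> 1" unfolding k_def using d by (simp add: Suc_le_eq div_greater_zero_iff)
  have q0: "real q > 0" using q by simp
  have "real b * real q ^ (2 * n * k) = real (b * (q ^ (2 * n)) ^ k)" by (simp add: power_mult)
  also have "\<dots> \<le> real ((\<Prod>i<k. 2 * q ^ (2 * i * d + d + d div 2)) * g)" using b
    by (simp only: of_nat_le_iff)
  also have "\<dots> = 2 ^ k * real q ^ ?s * real g" by (simp add: prod.distrib power_sum)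
  finally have "real b * real q ^ (2 * n * k) \<le> 2 ^ k * real q ^ ?s * real g" .
  then have "real b / real g \<le> 2 ^ k * real q ^ ?s / real q ^ (2 * n * k)"
    using g q0 by (simp add: field_simps)
  \<comment> \<open>One factor 2 is kept as the constant of the theorem. The other
    \<open>k - 1\<close> are bounded by \<open>q\<close> each and become the term
    \<open>k - 1\<close> in \<open>exponent_bound\<close>.\<close>
  also have "\<dots> = 2 * 2 ^ (k - 1) * real q ^ ?s / real q ^ (2 * n * k)" using k by (cases k) auto
  also have "\<dots> \<le> 2 * real q ^ (k - 1) * real q ^ ?s / real q ^ (2 * n * k)"
    using q by (intro divide_right_mono mult_right_mono mult_left_mono power_mono) auto
  also have "\<dots> = 2 * real q powr (real (k - 1) + real ?s - real (2 * n * k))"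
    using q0 by (simp only: powr_diff powr_add powr_realpow)
  also have "\<dots> \<le> 2 * real q powr (- ((real n)\<^sup>2 / (2 * real d)))"
    using q exponent_bound[OF d] unfolding k_def by (intro mult_left_mono powr_mono) auto
  finally show ?thesis .
qed

theorem theorem5p2:
  shows "\<exists>C::real. C > 0 \<and> (\<exists>\<epsilon>::nat \<Rightarrow> real. \<epsilon> \<in> o(\<lambda>n. real n) \<and>
    (\<forall>(R::'a ring) (q::nat) (f::nat \<Rightarrow> 'a) (n::nat) (\<delta>::nat).
       field R \<and> finite (carrier R) \<and> card (carrier R) = q \<and>
       (\<exists>p k. prime p \<and> odd p \<and> k > 0 \<and> q = p ^ k) \<and>
       poly_monic R f \<and> self_reciprocal R f \<and> deg R f = 2 * n \<and>
       \<not> (poly_X R divides\<^bsub>UP R\<^esub> f) \<and> \<delta> < n \<longrightarrow>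
       measure_pmf.prob (pmf_of_set (Sp_mat R n))
         {M. deg R (minpoly R (2 * n) M) = n - \<delta> \<and> charpoly R (2 * n) M = f}
       \<le> C * real q powr (- ((real n)\<^sup>2 / (2 * (real n - real \<delta>))) + \<epsilon> n)))"
proof (intro exI[of _ 2] exI[of _ "\<lambda>_. 0"] conjI allI impI)
  show "(0::real) < 2" by simp
  show "(\<lambda>_::nat. 0::real) \<in> o(\<lambda>n. real n)" by simp
next
  fix R :: "'a ring" and q :: nat and f :: "nat \<Rightarrow> 'a" and n \<delta> :: nat
  assume *: "field R \<and> finite (carrier R) \<and> card (carrier R) = q \<and>
       (\<exists>p k. prime p \<and> odd p \<and> k > 0 \<and> q = p ^ k) \<and>
       poly_monic R f \<and> self_reciprocal R f \<and> deg R f = 2 * n \<and>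
       \<not> (poly_X R divides\<^bsub>UP R\<^esub> f) \<and> \<delta> < n"
  then interpret field R by simp
  have fin: "finite (carrier R)" and q: "card (carrier R) = q" and \<delta>: "\<delta> < n" using * by auto
  interpret S: finite_symplectic_space R "coord_space R (2 * n)" "std_form R n"
    using fin by (rule std_symplectic)
  let ?d = "n - \<delta>" and ?X = "{M. deg R (minpoly R (2 * n) M) = n - \<delta> \<and> charpoly R (2 * n) M = f}"
  have bij: "bij_betw (act_perm (2 * n)) (Sp_mat R n) S.isometries" using fin by (rule act_perm_bij)
  have card: "card (Sp_mat R n) = card S.isometries" using bij by (rule bij_betw_same_card)
  have finSp: "finite (Sp_mat R n)" using bij S.finite_isometries bij_betw_finite by blast
  \<comment> \<open>\<open>pmf_of_set\<close> is the uniform distribution only for a finite nonempty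
    set; the identity shows that the group is not empty.\<close>
  have pos: "0 < card S.isometries" using S.finite_isometries S.id_isometries card_gt_0_iff by blast
  then have ne: "Sp_mat R n \<noteq> {}" using card by auto
  have "card (Sp_mat R n \<inter> ?X) \<le> card (S.cyclic_bounded ?d)"
  proof (rule card_inj_on_le)
    show "inj_on (act_perm (2 * n)) (Sp_mat R n \<inter> ?X)"
      using bij by (auto simp: bij_betw_def intro: inj_on_subset)
    show "act_perm (2 * n) ` (Sp_mat R n \<inter> ?X) \<subseteq> S.cyclic_bounded ?d"
    proof
      fix T assume "T \<in> act_perm (2 * n) ` (Sp_mat R n \<inter> ?X)"
      then obtain A
        where A: "T = act_perm (2 * n) A" "A \<in> Sp_mat R n" "deg R (minpoly R (2 * n) A) = ?d" by auto
      then show "T \<in> S.cyclic_bounded ?d" using act_perm_cyclic_bounded[OF fin A(2)] by simp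
    qed
    show "finite (S.cyclic_bounded ?d)"
      using S.finite_isometries by (rule rev_finite_subset) (auto simp: S.cyclic_bounded_def)
  qed
  then have "real (card (Sp_mat R n \<inter> ?X)) / real (card (Sp_mat R n)) \<le> real (card (S.cyclic_bounded ?d)) / real (card S.isometries)"
    unfolding card by (intro divide_right_mono) auto
  also have "\<dots> \<le> 2 * real q powr (- ((real n)\<^sup>2 / (2 * real ?d)))"
  proof (rule probability_bound[OF _ _ _ pos])
    show "card (S.cyclic_bounded ?d) * (q ^ (2 * n)) ^ k
        \<le> (\<Prod>i<k. 2 * q ^ (2 * i * ?d + ?d + ?d div 2)) * card S.isometries" for k
      using S.card_cyclic_bounded_le[of ?d k] by (simp add: card_coord_space q)
    show "2 \<le> q" using S.card_scalars_ge_2 q by simp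
  qed (use \<delta> in auto)
  finally show "measure_pmf.prob (pmf_of_set (Sp_mat R n)) ?X
      \<le> 2 * real q powr (- ((real n)\<^sup>2 / (2 * (real n - real \<delta>))) + 0)"
    using \<delta> by (simp add: measure_pmf_of_set[OF ne finSp] of_nat_diff)
qed

end
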